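(* Let $(X,\mu,m)$ be a connected weighted graph which admits a compatible intrinsic metric. Then, for $p\in(1,\infty)$, the generator $L_p$ is a restriction of the formal Laplacian $\Delta$ and its domain is $$D(L_p)=\{u\in L^p(X,m)\cap F(X)\mid \Delta u\in L^p(X,m)\}.$$
   Context: Weighted graph: $X$ is a countable discrete set, $m:X\to(0,\infty)$ is extended additively to a measure on all subsets of $X$, and $\mu:X\times X\to[0,\infty)$, $(x,y)\mapsto\mu_{xy}$, is symmetric, zero on the diagonal, and satisfies $\sum_{y\in X}\mu_{xy}<\infty$ for all $x\in X$ (local finiteness is not assumed). Write $x\sim y$ if $\mu_{xy}>0$. The graph is connected if any two vertices $x,y$ are joined by a path $x=x_0\sim x_1\sim\dots\sim x_n=y$. Formal Laplacian: $F(X)=\{f:X\to\mathbb{R}\mid \sum_{y\in X}\mu_{xy}|f(y)|<\infty \text{ for all }x\in X\}$ and $\Delta f(x)=\frac1{m(x)}\sum_{y\in X}\mu_{xy}(f(x)-f(y))$ for $f\in F(X)$. Generators: let $E(f)=\frac12\sum_{x,y\in X}\mu_{xy}|f(x)-f(y)|^2\in[0,\infty]$ for $f:X\to\mathbb{R}$, let $Q$ be the closure in $L^2(X,m)$ of the restriction of $E$ to the finitely supported functions $C_c(X)$, and let $L\ge0$ be the positive selfadjoint operator on $L^2(X,m)$ associated with $Q$ (it is a restriction of $\Delta$). Since $Q$ is a Dirichlet form, the semigroup $e^{-tL}$, $t\ge0$, extends consistently to a $C_0$-semigroup on $L^p(X,m)$, $p\in[1,\infty)$. Its generator is denoted $L_p$,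 with the sign convention that the semigroup is $e^{-tL_p}$. Compatible intrinsic metric: a pseudo metric is a symmetric map $\rho:X\times X\to[0,\infty)$ with zero diagonal satisfying the triangle inequality. It is intrinsic if $\sum_{y\in X}\mu_{xy}\rho^2(x,y)\le m(x)$ for all $x\in X$. Its jump size is $s=\sup\{\rho(x,y)\mid x\sim y\}$. The weighted vertex degree is $\mathrm{Deg}(x)=\frac1{m(x)}\sum_{y\in X}\mu_{xy}$. A pseudo metric is compatible if $s<\infty$ and $\mathrm{Deg}$ is bounded on each ball $B_r=\{x\mid\rho(x,o)\le r\}$, $r\ge0$ ($o\in X$ a fixed vertex; the choice is immaterial). *)

theory Defs
  imports "HOL-Analysis.Analysis" "HOL-Library.Countable"
begin

text \<open>
  The vertex set is the universe of a countable type. As all vertices have positive measure,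
  elements of \<open>L\<^sup>p(X,m)\<close> are functions and not equivalence classes. Unbounded operators are
  represented by their graphs, i.e. as sets of pairs \<open>(u, v)\<close> meaning that \<open>u\<close> is in the domain
  and is mapped to \<open>v\<close>.
\<close>

subsection \<open>Weighted graphs\<close>

definition weighted_graph :: "('a::countable \<Rightarrow> 'a \<Rightarrow> real) \<Rightarrow> ('a \<Rightarrow> real) \<Rightarrow> bool" where
  "weighted_graph \<mu> m \<longleftrightarrow>
     (\<forall>x. 0 < m x) \<and>
     (\<forall>x y. 0 \<le> \<mu> x y) \<and>
     (\<forall>x y. \<mu> x y = \<mu> y x) \<and>
     (\<forall>x. \<mu> x x = 0) \<and>
     (\<forall>x. (\<lambda>y. \<mu> x y) summable_on UNIV)"

definition adjacent :: "('a \<Rightarrow> 'a \<Rightarrow> real) \<Rightarrow> 'a \<Rightarrow> 'a \<Rightarrow> bool" where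
  "adjacent \<mu> x y \<longleftrightarrow> 0 < \<mu> x y"

definition connected_graph :: "('a \<Rightarrow> 'a \<Rightarrow> real) \<Rightarrow> bool" where
  "connected_graph \<mu> \<longleftrightarrow> (\<forall>x y. (adjacent \<mu>)\<^sup>*\<^sup>* x y)"

subsection \<open>Compatible intrinsic metrics\<close>

definition pseudo_metric :: "('a \<Rightarrow> 'a \<Rightarrow> real) \<Rightarrow> bool" where
  "pseudo_metric \<rho> \<longleftrightarrow>
     (\<forall>x y. 0 \<le> \<rho> x y) \<and>
     (\<forall>x y. \<rho> x y = \<rho> y x) \<and>
     (\<forall>x. \<rho> x x = 0) \<and>
     (\<forall>x y z. \<rho> x z \<le> \<rho> x y + \<rho> y z)"

text \<open>Summability is required explicitly, since \<^const>\<open>infsum\<close> is \<open>0\<close> for divergent real sums.\<close>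

definition intrinsic :: "('a \<Rightarrow> 'a \<Rightarrow> real) \<Rightarrow> ('a \<Rightarrow> real) \<Rightarrow> ('a \<Rightarrow> 'a \<Rightarrow> real) \<Rightarrow> bool" where
  "intrinsic \<mu> m \<rho> \<longleftrightarrow>
     (\<forall>x. (\<lambda>y. \<mu> x y * (\<rho> x y)\<^sup>2) summable_on UNIV \<and>
          (\<Sum>\<^sub>\<infinity>y. \<mu> x y * (\<rho> x y)\<^sup>2) \<le> m x)"

definition jump_size :: "('a \<Rightarrow> 'a \<Rightarrow> real) \<Rightarrow> ('a \<Rightarrow> 'a \<Rightarrow> real) \<Rightarrow> ennreal" where
  "jump_size \<mu> \<rho> = Sup {ennreal (\<rho> x y) | x y. adjacent \<mu> x y}"

definition weighted_degree :: "('a \<Rightarrow> 'a \<Rightarrow> real) \<Rightarrow> ('a \<Rightarrow> real) \<Rightarrow> 'a \<Rightarrow> real" where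
  "weighted_degree \<mu> m x = (1 / m x) * (\<Sum>\<^sub>\<infinity>y. \<mu> x y)"

text \<open>All centres are allowed; by the triangle inequality one centre suffices.\<close>

definition compatible :: "('a \<Rightarrow> 'a \<Rightarrow> real) \<Rightarrow> ('a \<Rightarrow> real) \<Rightarrow> ('a \<Rightarrow> 'a \<Rightarrow> real) \<Rightarrow> bool" where
  "compatible \<mu> m \<rho> \<longleftrightarrow>
     jump_size \<mu> \<rho> < \<infinity> \<and>
     (\<forall>x0 r. 0 \<le> r \<longrightarrow> (\<exists>C. \<forall>x. \<rho> x x0 \<le> r \<longrightarrow> weighted_degree \<mu> m x \<le> C))"

subsection \<open>The formal Laplacian\<close>

definition laplacian_dom :: "('a \<Rightarrow> 'a \<Rightarrow> real) \<Rightarrow> ('a \<Rightarrow> real) set" where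
  "laplacian_dom \<mu> = {f. \<forall>x. (\<lambda>y. \<mu> x y * \<bar>f y\<bar>) summable_on UNIV}"

definition formal_laplacian ::
    "('a \<Rightarrow> 'a \<Rightarrow> real) \<Rightarrow> ('a \<Rightarrow> real) \<Rightarrow> ('a \<Rightarrow> real) \<Rightarrow> ('a \<Rightarrow> real)" where
  "formal_laplacian \<mu> m f = (\<lambda>x. (1 / m x) * (\<Sum>\<^sub>\<infinity>y. \<mu> x y * (f x - f y)))"

subsection \<open>Lebesgue spaces\<close>

definition lp_space :: "('a \<Rightarrow> real) \<Rightarrow> real \<Rightarrow> ('a \<Rightarrow> real) set" where
  "lp_space m p = {f. (\<lambda>x. \<bar>f x\<bar> powr p * m x) summable_on UNIV}"

definition lp_norm :: "('a \<Rightarrow> real) \<Rightarrow> real \<Rightarrow> ('a \<Rightarrow> real) \<Rightarrow> real" where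
  "lp_norm m p f = (\<Sum>\<^sub>\<infinity>x. \<bar>f x\<bar> powr p * m x) powr (1 / p)"

definition l2_inner :: "('a \<Rightarrow> real) \<Rightarrow> ('a \<Rightarrow> real) \<Rightarrow> ('a \<Rightarrow> real) \<Rightarrow> real" where
  "l2_inner m f g = (\<Sum>\<^sub>\<infinity>x. f x * g x * m x)"

subsection \<open>Strongly continuous semigroups and their generators\<close>

text \<open>
  Semigroups on a space \<open>V\<close> of functions with norm \<open>N\<close>; the values of \<open>T t f\<close> for \<open>t < 0\<close> or
  \<open>f \<notin> V\<close> are irrelevant.
\<close>

definition C0_semigroup ::
    "('a \<Rightarrow> real) set \<Rightarrow> (('a \<Rightarrow> real) \<Rightarrow> real) \<Rightarrow>
     (real \<Rightarrow> ('a \<Rightarrow> real) \<Rightarrow> ('a \<Rightarrow> real)) \<Rightarrow> bool" where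
  "C0_semigroup V N T \<longleftrightarrow>
     (\<forall>t\<ge>0. \<forall>f\<in>V. T t f \<in> V) \<and>
     (\<forall>t\<ge>0. \<forall>f\<in>V. \<forall>g\<in>V. \<forall>a b. T t (\<lambda>x. a * f x + b * g x) = (\<lambda>x. a * T t f x + b * T t g x)) \<and>
     (\<forall>t\<ge>0. \<exists>C. \<forall>f\<in>V. N (T t f) \<le> C * N f) \<and>
     (\<forall>f\<in>V. T 0 f = f) \<and>
     (\<forall>s\<ge>0. \<forall>t\<ge>0. \<forall>f\<in>V. T (s + t) f = T s (T t f)) \<and>
     (\<forall>f\<in>V. ((\<lambda>t. N (\<lambda>x. T t f x - f x)) \<longlongrightarrow> 0) (at_right 0))"

text \<open>
  The sign convention is that the operator \<open>A\<close> with \<open>T t = exp (- t A)\<close> is called the generator,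
  so \<open>A u = lim (u - T t u) / t\<close> as \<open>t\<close> decreases to \<open>0\<close>.
\<close>

definition generator ::
    "('a \<Rightarrow> real) set \<Rightarrow> (('a \<Rightarrow> real) \<Rightarrow> real) \<Rightarrow>
     (real \<Rightarrow> ('a \<Rightarrow> real) \<Rightarrow> ('a \<Rightarrow> real)) \<Rightarrow> (('a \<Rightarrow> real) \<times> ('a \<Rightarrow> real)) set" where
  "generator V N T =
     {(u, v). u \<in> V \<and> v \<in> V \<and>
        ((\<lambda>t. N (\<lambda>x. (u x - T t u x) / t - v x)) \<longlongrightarrow> 0) (at_right 0)}"

subsection \<open>The Dirichlet form and its operator\<close>

definition energy :: "('a \<Rightarrow> 'a \<Rightarrow> real) \<Rightarrow> ('a \<Rightarrow> real) \<Rightarrow> ennreal" where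
  "energy \<mu> f = (1 / 2) * (\<Sum>\<^sub>\<infinity>(x, y). ennreal (\<mu> x y * \<bar>f x - f y\<bar>\<^sup>2))"

definition finitely_supported :: "('a \<Rightarrow> real) set" where
  "finitely_supported = {f. finite {x. f x \<noteq> 0}}"

text \<open>
  The closure \<open>Q\<close> of the energy on finitely supported functions: a function \<open>u\<close> in \<open>L\<^sup>2\<close> is in the
  form domain if it is the \<open>L\<^sup>2\<close>-limit of an energy-Cauchy sequence of finitely supported functions,
  and \<open>Q u\<close> is the limit of the energies, which does not depend on the sequence.
\<close>

definition form_approx ::
    "('a \<Rightarrow> 'a \<Rightarrow> real) \<Rightarrow> ('a \<Rightarrow> real) \<Rightarrow> (nat \<Rightarrow> 'a \<Rightarrow> real) \<Rightarrow> ('a \<Rightarrow> real) \<Rightarrow> bool" where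
  "form_approx \<mu> m \<phi> u \<longleftrightarrow>
     (\<forall>n. \<phi> n \<in> finitely_supported) \<and>
     (\<lambda>n. lp_norm m 2 (\<lambda>x. \<phi> n x - u x)) \<longlonglongrightarrow> 0 \<and>
     (\<forall>e>0. \<exists>n0. \<forall>i\<ge>n0. \<forall>j\<ge>n0. energy \<mu> (\<lambda>x. \<phi> i x - \<phi> j x) < e)"

definition form_dom :: "('a \<Rightarrow> 'a \<Rightarrow> real) \<Rightarrow> ('a \<Rightarrow> real) \<Rightarrow> ('a \<Rightarrow> real) set" where
  "form_dom \<mu> m = {u \<in> lp_space m 2. \<exists>\<phi>. form_approx \<mu> m \<phi> u}"

definition form_Q :: "('a \<Rightarrow> 'a \<Rightarrow> real) \<Rightarrow> ('a \<Rightarrow> real) \<Rightarrow> ('a \<Rightarrow> real) \<Rightarrow> real" where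
  "form_Q \<mu> m u =
     (THE q. \<exists>\<phi>. form_approx \<mu> m \<phi> u \<and> (\<lambda>n. enn2real (energy \<mu> (\<phi> n))) \<longlonglongrightarrow> q)"

definition form_bilin ::
    "('a \<Rightarrow> 'a \<Rightarrow> real) \<Rightarrow> ('a \<Rightarrow> real) \<Rightarrow> ('a \<Rightarrow> real) \<Rightarrow> ('a \<Rightarrow> real) \<Rightarrow> real" where
  "form_bilin \<mu> m u w =
     (form_Q \<mu> m (\<lambda>x. u x + w x) - form_Q \<mu> m (\<lambda>x. u x - w x)) / 4"

definition form_operator ::
    "('a \<Rightarrow> 'a \<Rightarrow> real) \<Rightarrow> ('a \<Rightarrow> real) \<Rightarrow> (('a \<Rightarrow> real) \<times> ('a \<Rightarrow> real)) set" where
  "form_operator \<mu> m =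
     {(u, v). u \<in> form_dom \<mu> m \<and> v \<in> lp_space m 2 \<and>
        (\<forall>w\<in>form_dom \<mu> m. form_bilin \<mu> m u w = l2_inner m v w)}"

subsection \<open>The semigroups on the Lebesgue spaces\<close>

text \<open>
  \<open>exp (- t L)\<close> is the strongly continuous semigroup on \<open>L\<^sup>2\<close> generated by \<open>L\<close>, and its consistent
  extension to \<open>L\<^sup>p\<close> is the strongly continuous semigroup on \<open>L\<^sup>p\<close> that agrees with it on the
  intersection of \<open>L\<^sup>2\<close> and \<open>L\<^sup>p\<close>. Both exist and are unique on the respective spaces (a semigroup is
  determined by its generator, and the intersection is dense in \<open>L\<^sup>p\<close>); the choice operator only
  fixes the irrelevant values outside these spaces and for negative times.
\<close>

definition heat_semigroup ::
    "('a \<Rightarrow> 'a \<Rightarrow> real) \<Rightarrow> ('a \<Rightarrow> real) \<Rightarrow> real \<Rightarrow> ('a \<Rightarrow> real) \<Rightarrow> ('a \<Rightarrow> real)" where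
  "heat_semigroup \<mu> m =
     (SOME T. C0_semigroup (lp_space m 2) (lp_norm m 2) T \<and>
        generator (lp_space m 2) (lp_norm m 2) T = form_operator \<mu> m)"

definition lp_semigroup ::
    "('a \<Rightarrow> 'a \<Rightarrow> real) \<Rightarrow> ('a \<Rightarrow> real) \<Rightarrow> real \<Rightarrow> real \<Rightarrow> ('a \<Rightarrow> real) \<Rightarrow> ('a \<Rightarrow> real)" where
  "lp_semigroup \<mu> m p =
     (SOME S. C0_semigroup (lp_space m p) (lp_norm m p) S \<and>
        (\<forall>t\<ge>0. \<forall>f \<in> lp_space m 2 \<inter> lp_space m p. S t f = heat_semigroup \<mu> m t f))"

definition lp_generator ::
    "('a \<Rightarrow> 'a \<Rightarrow> real) \<Rightarrow> ('a \<Rightarrow> real) \<Rightarrow> real \<Rightarrow> (('a \<Rightarrow> real) \<times> ('a \<Rightarrow> real)) set" where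
  "lp_generator \<mu> m p = generator (lp_space m p) (lp_norm m p) (lp_semigroup \<mu> m p)"

end

theory Submission
  imports Defs "HOL-Library.Function_Algebras"
begin

text \<open>
  Let \<open>A\<close> be \<open>\<Delta>\<close> on the maximal domain in \<open>L\<^sup>p\<close>. It is m-accretive: testing with \<open>\<phi>\<^sup>2 sgn(u) |u|\<^sup>p\<^sup>-\<^sup>1\<close> for
  cutoffs \<open>\<phi>\<close> built from the intrinsic metric gives accretivity, since the error is at most \<open>C R\<^sup>-\<^sup>2 \<parallel>u\<parallel>\<^sup>p\<close>;
  the equation \<open>u + h \<Delta> u = f\<close> is solved for point masses by a monotone iteration, with solutions in all
  \<open>L\<^sup>p\<close>, and for general \<open>f\<close> by approximation, because compatibility makes \<open>u \<mapsto> \<Delta> u (x)\<close> continuous on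
  \<open>L\<^sup>p\<close>. Hence \<open>A\<close> generates a contraction semigroup, the limit of the powers \<open>(1 + t/n A)\<^sup>-\<^sup>n\<close>, and these
  semigroups are consistent. For \<open>p = 2\<close> the operator \<open>A\<close> is the form operator, again by cutoffs, and a
  semigroup is determined by its generator. So the chosen semigroup on \<open>L\<^sup>p\<close> is the one generated by \<open>A\<close>.
\<close>

section \<open>Generation of contraction semigroups\<close>

text \<open>Accretivity is proved on the maximal domain itself, not on a core: a generator has no
  proper accretive extension, so the domain is identified without approximating its elements in the
  graph norm by finitely supported functions. The price is that a function of this domain has no
  finite energy a priori, and that summation by parts is available only against test functions
  supported in a ball. For those the finite jump size keeps all neighbours in a larger ball, where
  the degree is at most a multiple of \<open>m\<close>, so that the double sums converge absolutely
  although a vertex may have infinitely many neighbours. The semigroups of the statement come from a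
  choice operator. Of the chosen ones only strong continuity and boundedness at each single time are
  known, not contractivity. Uniqueness therefore starts from a uniform boundedness argument near
  time zero and then uses only the accretivity of \<Delta>, applied to the difference of two
  orbits.\<close>

instantiation "fun" :: (type, real_vector) real_vector
begin
definition scaleR_fun :: "real \<Rightarrow> ('a \<Rightarrow> 'b) \<Rightarrow> 'a \<Rightarrow> 'b" where
  "scaleR_fun c f = (\<lambda>x. c *\<^sub>R f x)"
instance
  by standard (auto simp: scaleR_fun_def algebra_simps)
end

text \<open>Used to choose step sizes \<open>c / (N (A u) + 1)\<close>; the summand 1 avoids a case
  distinction for vanishing \<open>A u\<close>.\<close>

lemma mult_div_le: "0 \<le> c \<Longrightarrow> 0 \<le> a \<Longrightarrow> c / (a + 1) * a \<le> c" for a c :: real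
  using mult_left_mono[of "a / (a + 1)" 1 c] by simp

text \<open>The spaces L^p for different p are subsets of one function type, so norm and
  completeness belong to a set and not to a type class. Nonnegativity and homogeneity can be assumed
  on the whole type, since a divergent sum has the value 0 and scaling by a nonzero number preserves
  divergence; they then rewrite without membership conditions. The triangle inequality does need
  membership.\<close>

locale complete_normed_subspace =
  fixes V :: "'v::real_vector set" and N :: "'v \<Rightarrow> real"
  assumes subspace: "subspace V"
    and N_nonneg [simp]: "0 \<le> N f"
    and N_triangle: "f \<in> V \<Longrightarrow> g \<in> V \<Longrightarrow> N (f + g) \<le> N f + N g"
    and N_scale [simp]: "N (c *\<^sub>R f) = \<bar>c\<bar> * N f"
    and N_zeroD: "f \<in> V \<Longrightarrow> N f = 0 \<Longrightarrow> f = 0"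
    and complete: "(\<And>n. X n \<in> V) \<Longrightarrow>
      (\<And>e. 0 < e \<Longrightarrow> \<exists>M. \<forall>i\<ge>M. \<forall>j\<ge>M. N (X i - X j) < e) \<Longrightarrow>
      \<exists>l\<in>V. (\<lambda>n::nat. N (X n - l)) \<longlonglongrightarrow> 0"
begin

lemma V_closed [simp, intro]:
  shows "0 \<in> V" and "f \<in> V \<Longrightarrow> g \<in> V \<Longrightarrow> f + g \<in> V" and "f \<in> V \<Longrightarrow> g \<in> V \<Longrightarrow> f - g \<in> V"
    and "f \<in> V \<Longrightarrow> c *\<^sub>R f \<in> V"
  using subspace by (auto simp: subspace_0 subspace_add subspace_diff subspace_scale)

lemma N_zero [simp]: "N 0 = 0"
  using N_scale[of 0 0] by simp

lemma N_minus [simp]: "N (- f) = N f"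
  using N_scale[of "-1" f] by simp

lemma N_commute: "N (f - g) = N (g - f)"
  using N_minus[of "f - g"] by simp

lemma N_diff_triangle: "f \<in> V \<Longrightarrow> g \<in> V \<Longrightarrow> h \<in> V \<Longrightarrow> N (f - h) \<le> N (f - g) + N (g - h)"
  using N_triangle[of "f - g" "g - h"] by simp

lemma N_diff_le: "f \<in> V \<Longrightarrow> g \<in> V \<Longrightarrow> N (f - g) \<le> N f + N g"
  using N_diff_triangle[of f 0 g] by simp

lemma N_le_diff: "f \<in> V \<Longrightarrow> g \<in> V \<Longrightarrow> N f \<le> N g + N (f - g)"
  using N_triangle[of g "f - g"] by simp

lemma abs_N_diff_le: "f \<in> V \<Longrightarrow> g \<in> V \<Longrightarrow> \<bar>N f - N g\<bar> \<le> N (f - g)"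
  using N_le_diff[of f g] N_le_diff[of g f] by (simp add: N_commute abs_le_iff)

lemma N_limit_unique:
  assumes "F \<noteq> bot" "\<And>n. X n \<in> V" "l \<in> V" "l' \<in> V"
    and "((\<lambda>n. N (X n - l)) \<longlongrightarrow> 0) F" "((\<lambda>n. N (X n - l')) \<longlongrightarrow> 0) F"
  shows "l = l'"
proof -
  have "((\<lambda>n. N (X n - l) + N (X n - l')) \<longlongrightarrow> 0 + 0) F"
    using assms by (intro tendsto_add)
  moreover have "N (l - l') \<le> N (X n - l) + N (X n - l')" for n
    using N_diff_triangle[of l "X n" l'] assms by (simp add: N_commute)
  ultimately have "N (l - l') \<le> 0"
    using tendsto_lowerbound[of "\<lambda>n. N (X n - l) + N (X n - l')" 0 F "N (l - l')"] assms(1) by simp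
  then have "l - l' = 0" using assms by (intro N_zeroD) (auto intro: antisym)
  then show ?thesis by simp
qed

lemma N_limit:
  assumes "\<And>n. X n \<in> V" "l \<in> V" "((\<lambda>n. N (X n - l)) \<longlongrightarrow> 0) F"
  shows "((\<lambda>n. N (X n)) \<longlongrightarrow> N l) F"
proof -
  have "((\<lambda>n. N (X n) - N l) \<longlongrightarrow> 0) F"
    by (rule Lim_null_comparison[OF _ assms(3)]) (use assms in \<open>auto intro!: always_eventually abs_N_diff_le\<close>)
  then show ?thesis by (simp add: LIM_zero_iff)
qed

text \<open>Inserting \<open>B (C ^^ n) f\<close> splits each new error into the old one, not
  enlarged by the contraction \<open>B\<close>, and one step error at a point of the orbit of
  \<open>C\<close>. Hence the step error is required only on a set \<open>S\<close> that
  \<open>C\<close> leaves invariant.\<close>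

lemma telescoping:
  assumes "S \<subseteq> V" "f \<in> S"
    and B: "\<And>g. g \<in> V \<Longrightarrow> B g \<in> V" "\<And>g h. g \<in> V \<Longrightarrow> h \<in> V \<Longrightarrow> N (B g - B h) \<le> N (g - h)"
    and C: "\<And>g. g \<in> S \<Longrightarrow> C g \<in> S"
    and BC: "\<And>g. g \<in> S \<Longrightarrow> N (B g - C g) \<le> e"
  shows "N ((B ^^ n) f - (C ^^ n) f) \<le> real n * e"
proof (induction n)
  case (Suc n)
  have CS: "(C ^^ k) f \<in> S" for k by (induction k) (auto simp: assms)
  have CV: "(C ^^ k) f \<in> V" for k using CS assms by blast
  have BV: "(B ^^ k) f \<in> V" for k using assms by (induction k) auto
  have "N ((B ^^ Suc n) f - (C ^^ Suc n) f) \<le>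
      N (B ((B ^^ n) f) - B ((C ^^ n) f)) + N (B ((C ^^ n) f) - C ((C ^^ n) f))"
    using N_diff_triangle[of "B ((B ^^ n) f)" "B ((C ^^ n) f)" "C ((C ^^ n) f)"] B(1) BV CV CV[of "Suc n"] by auto
  also have "\<dots> \<le> N ((B ^^ n) f - (C ^^ n) f) + e"
    by (intro add_mono B BC CS BV CV)
  finally show ?case using Suc by (simp add: algebra_simps)
qed simp

end

text \<open>The hypotheses of the Hille-Yosida theorem for contraction semigroups, with accretivity
  in place of a resolvent bound. \<open>A\<close> is a total function whose values outside
  \<open>D\<close> carry no meaning.\<close>

locale m_accretive = complete_normed_subspace V N for V :: "'v::real_vector set" and N +
  fixes D :: "'v set" and A :: "'v \<Rightarrow> 'v"
  assumes subspace_D: "subspace D"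
    and D_V: "D \<subseteq> V"
    and A_V [simp]: "u \<in> D \<Longrightarrow> A u \<in> V"
    and A_add: "u \<in> D \<Longrightarrow> v \<in> D \<Longrightarrow> A (u + v) = A u + A v"
    and A_scale: "u \<in> D \<Longrightarrow> A (c *\<^sub>R u) = c *\<^sub>R A u"
    and accretive: "u \<in> D \<Longrightarrow> 0 < h \<Longrightarrow> N u \<le> N (u + h *\<^sub>R A u)"
    and surjective: "f \<in> V \<Longrightarrow> 0 < h \<Longrightarrow> \<exists>u\<in>D. u + h *\<^sub>R A u = f"
    and dense: "f \<in> V \<Longrightarrow> 0 < e \<Longrightarrow> \<exists>u\<in>D. N (f - u) < e"
begin

section \<open>Resolvents of an m-accretive operator\<close>

lemma D_closed [simp, intro]:
  shows "0 \<in> D" and "f \<in> D \<Longrightarrow> g \<in> D \<Longrightarrow> f + g \<in> D" and "f \<in> D \<Longrightarrow> g \<in> D \<Longrightarrow> f - g \<in> D"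
    and "f \<in> D \<Longrightarrow> c *\<^sub>R f \<in> D" and "f \<in> D \<Longrightarrow> f \<in> V"
  using subspace_D D_V by (auto simp: subspace_0 subspace_add subspace_diff subspace_scale)

lemma A_diff: "u \<in> D \<Longrightarrow> v \<in> D \<Longrightarrow> A (u - v) = A u - A v"
  using A_add[of u "(-1) *\<^sub>R v"] A_scale[of v "-1"] D_closed(4)[of v "-1"] by simp

text \<open>The case \<open>h = 0\<close> is separate because \<open>THE\<close> would give the identity only on \<open>D\<close>.\<close>
definition J :: "real \<Rightarrow> 'v \<Rightarrow> 'v" where
  "J h f = (if h = 0 then f else THE u. u \<in> D \<and> u + h *\<^sub>R A u = f)"

lemma J_0 [simp]: "J 0 f = f" by (simp add: J_def)

lemma J_unique: "u \<in> D \<Longrightarrow> v \<in> D \<Longrightarrow> 0 < h \<Longrightarrow> u + h *\<^sub>R A u = v + h *\<^sub>R A v \<Longrightarrow> u = v"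
  using accretive[of "u - v" h] N_zeroD[of "u - v"] order_antisym[OF _ N_nonneg, of "u - v"]
  by (simp add: A_diff algebra_simps)

lemma J_eqI: assumes "u \<in> D" "0 \<le> h" "u + h *\<^sub>R A u = f" shows "J h f = u"
proof (cases "h = 0")
  case False
  then have "(THE u. u \<in> D \<and> u + h *\<^sub>R A u = f) = u"
  proof (intro the_equality conjI)
    fix v assume "v \<in> D \<and> v + h *\<^sub>R A v = f"
    then show "v = u" using assms False by (intro J_unique[of v u h]) auto
  qed (use assms in auto)
  with False show ?thesis by (simp add: J_def)
qed (use assms in simp)

lemma J_ex: "f \<in> V \<Longrightarrow> 0 < h \<Longrightarrow> J h f \<in> D \<and> J h f + h *\<^sub>R A (J h f) = f"
  using surjective[of f h] J_eqI[of _ h f] by force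

lemma J_D [simp]: "f \<in> V \<Longrightarrow> 0 < h \<Longrightarrow> J h f \<in> D" using J_ex by blast

lemma J_eq: "f \<in> V \<Longrightarrow> 0 < h \<Longrightarrow> J h f + h *\<^sub>R A (J h f) = f" using J_ex by blast

lemma J_V [simp]: "f \<in> V \<Longrightarrow> 0 \<le> h \<Longrightarrow> J h f \<in> V"
  using J_D[of f h] by (cases "h = 0") auto

lemma J_in_D [simp]: "f \<in> D \<Longrightarrow> 0 \<le> h \<Longrightarrow> J h f \<in> D"
  using J_D[of f h] by (cases "h = 0") auto

lemma J_contraction: "f \<in> V \<Longrightarrow> 0 \<le> h \<Longrightarrow> N (J h f) \<le> N f"
  using accretive[of "J h f" h] J_ex[of f h] by (cases "h = 0") auto

lemma J_add: assumes "f \<in> V" "g \<in> V" "0 \<le> h" shows "J h (f + g) = J h f + J h g"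
proof (cases "h = 0")
  case False
  with assms have "0 < h" by simp
  then have "J h f + h *\<^sub>R A (J h f) + (J h g + h *\<^sub>R A (J h g)) = f + g"
    by (simp add: J_eq assms)
  with \<open>0 < h\<close> assms show ?thesis by (intro J_eqI) (auto simp: A_add algebra_simps)
qed simp

lemma J_scale: assumes "f \<in> V" "0 \<le> h" shows "J h (c *\<^sub>R f) = c *\<^sub>R J h f"
proof (cases "h = 0")
  case False
  with assms have "0 < h" by simp
  then have "c *\<^sub>R (J h f + h *\<^sub>R A (J h f)) = c *\<^sub>R f"
    by (simp add: J_eq assms)
  with \<open>0 < h\<close> assms show ?thesis by (intro J_eqI) (auto simp: A_scale algebra_simps)
qed simp

lemma J_diff: "f \<in> V \<Longrightarrow> g \<in> V \<Longrightarrow> 0 \<le> h \<Longrightarrow> J h (f - g) = J h f - J h g"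
  using J_add[of f "(-1) *\<^sub>R g" h] J_scale[of g h "-1"] V_closed(4)[of g "-1"] by simp

text \<open>For \<open>u\<close> in \<open>D\<close> the resolvent equation shows that
  \<open>A (J h u)\<close> is a multiple of \<open>u - J h u\<close>, hence again in
  \<open>D\<close>. So \<open>A\<close> may be applied to the equation itself, and uniqueness of its
  solution gives the claim.\<close>

lemma A_J: assumes "u \<in> D" "0 \<le> h" shows "A (J h u) = J h (A u)"
proof (cases "h = 0")
  case False
  with assms have h: "0 < h" by simp
  have eq: "J h u + h *\<^sub>R A (J h u) = u" using h assms by (simp add: J_eq)
  then have eq2: "A (J h u) = (1/h) *\<^sub>R (u - J h u)" using h
    by (metis add_diff_cancel_left' divide_self_if h inverse_eq_divide less_irrefl scaleR_one scaleR_scaleR times_divide_eq_left mult_1)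
  then have AD: "A (J h u) \<in> D" using assms h by simp
  have "A (J h u + h *\<^sub>R A (J h u)) = A u" by (simp add: eq)
  then have "A (J h u) + h *\<^sub>R A (A (J h u)) = A u"
    using assms AD h by (simp add: A_add A_scale)
  then show ?thesis using J_eqI[OF AD, of h "A u"] assms by simp
qed simp

lemma J_commute: assumes "f \<in> V" "0 \<le> h" "0 \<le> k" shows "J h (J k f) = J k (J h f)"
proof (cases "k = 0")
  case False
  with assms have k: "0 < k" by simp
  have "J h (J k f + k *\<^sub>R A (J k f)) = J h f" using k assms by (simp add: J_eq)
  then have "J h (J k f) + k *\<^sub>R A (J h (J k f)) = J h f"
    using assms k by (simp add: J_add J_scale A_J)
  then show ?thesis using J_eqI[of "J h (J k f)" k "J h f"] assms k by simp
qed simp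

lemma J_sub: "f \<in> D \<Longrightarrow> 0 \<le> h \<Longrightarrow> f - J h f = h *\<^sub>R J h (A f)"
  using J_eq[of f h] A_J[of f h] by (cases "h = 0") (auto simp: algebra_simps)

lemma J_sub_le: assumes "f \<in> D" "0 \<le> h" shows "N (f - J h f) \<le> h * N (A f)"
  unfolding J_sub[OF assms] using assms J_contraction[of "A f" h] by (simp add: mult_left_mono)

text \<open>The domain of \<open>A\<^sup>2\<close>, where the errors of the backward Euler scheme
  are of second order in the step size.\<close>

definition D2 :: "'v set" where "D2 = {u \<in> D. A u \<in> D}"

lemma D2_D: "u \<in> D2 \<Longrightarrow> u \<in> D" "u \<in> D2 \<Longrightarrow> A u \<in> D" "u \<in> D2 \<Longrightarrow> u \<in> V" by (auto simp: D2_def)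

lemma J_D2: "u \<in> D2 \<Longrightarrow> 0 \<le> h \<Longrightarrow> J h u \<in> D2"
  by (auto simp: D2_def A_J)

lemma J_D_D2: "u \<in> D \<Longrightarrow> 0 < h \<Longrightarrow> J h u \<in> D2"
  by (auto simp: D2_def A_J)

text \<open>From \<open>(1 + t A) (1 + s A) = 1 + (s + t) A + s t A\<^sup>2\<close>, applied to
  \<open>J (s + t) u\<close>: the two resolvents differ by
  \<open>s t J s J t A\<^sup>2 J (s + t) u\<close>, and all resolvents are contractions commuting
  with \<open>A\<close>.\<close>

lemma J_J_diff: assumes u: "u \<in> D2" and "0 \<le> s" "0 \<le> t"
  shows "N (J s (J t u) - J (s + t) u) \<le> s * t * N (A (A u))"
proof -
  let ?w = "J (s + t) u"
  have w: "?w \<in> D2" using assms by (simp add: J_D2)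
  have "u - ?w = (s + t) *\<^sub>R A ?w"
    using assms J_sub[of u "s + t"] by (simp add: A_J D2_D)
  then have eq: "?w + s *\<^sub>R A ?w + t *\<^sub>R A (?w + s *\<^sub>R A ?w) = u + (s * t) *\<^sub>R A (A ?w)"
    using w by (simp add: A_add A_scale D2_D algebra_simps)
  have "J t (u + (s * t) *\<^sub>R A (A ?w)) = ?w + s *\<^sub>R A ?w"
    using w assms by (intro J_eqI eq) (auto simp: D2_D)
  then have "J s (J t (u + (s * t) *\<^sub>R A (A ?w))) = ?w"
    using w assms by (simp add: J_eqI D2_D)
  then have "J s (J t u) + (s * t) *\<^sub>R J s (J t (A (A ?w))) = ?w"
    using w assms u by (simp add: J_add J_scale D2_D)
  then have "J s (J t u) - ?w = - ((s * t) *\<^sub>R J s (J t (A (A ?w))))"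
    by (simp add: algebra_simps)
  moreover have "N (J s (J t (A (A ?w)))) \<le> N (A (A u))"
    using assms u J_contraction[of "A (A u)" "s+t"] J_contraction[of "J t (A (A ?w))" s] J_contraction[of "A (A ?w)" t]
    by (simp add: A_J D2_D w)
  ultimately show ?thesis using assms by (simp add: mult_left_mono abs_mult)
qed

text \<open>The resolvent gains one order of regularity: \<open>J h u\<close> is in
  \<open>D2\<close> for \<open>u\<close> in \<open>D\<close>, and it is close to \<open>u\<close>
  for small \<open>h\<close> by \<open>J_sub_le\<close>.\<close>

lemma D2_dense: assumes "f \<in> V" "0 < e" shows "\<exists>u\<in>D2. N (f - u) < e"
proof -
  obtain u where u: "u \<in> D" "N (f - u) < e/2" using dense[of f "e/2"] assms by auto
  define h where "h = e / 4 / (N (A u) + 1)"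
  have h: "0 < h" using assms N_nonneg[of "A u"] by (simp add: h_def add_nonneg_pos)
  have "h * N (A u) \<le> e / 4"
    using assms unfolding h_def by (intro mult_div_le) auto
  then have "N (u - J h u) < e/2" using J_sub_le[of u h] u h assms by auto
  then have "N (f - J h u) < e" using N_diff_triangle[of f u "J h u"] u assms h by auto
  then show ?thesis using J_D_D2 u h by blast
qed

subsection \<open>Powers of the resolvent\<close>

lemma Jn_V [simp]: "f \<in> V \<Longrightarrow> 0 \<le> h \<Longrightarrow> (J h ^^ n) f \<in> V"
  by (induction n) auto

lemma Jn_D [simp]: "f \<in> D \<Longrightarrow> 0 \<le> h \<Longrightarrow> (J h ^^ n) f \<in> D"
  by (induction n) auto

lemma Jn_add: "f \<in> V \<Longrightarrow> g \<in> V \<Longrightarrow> 0 \<le> h \<Longrightarrow> (J h ^^ n) (f + g) = (J h ^^ n) f + (J h ^^ n) g"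
  by (induction n) (auto simp: J_add)

lemma Jn_scale: "f \<in> V \<Longrightarrow> 0 \<le> h \<Longrightarrow> (J h ^^ n) (c *\<^sub>R f) = c *\<^sub>R (J h ^^ n) f"
  by (induction n) (auto simp: J_scale)

lemma Jn_diff: "f \<in> V \<Longrightarrow> g \<in> V \<Longrightarrow> 0 \<le> h \<Longrightarrow> (J h ^^ n) (f - g) = (J h ^^ n) f - (J h ^^ n) g"
  by (induction n) (auto simp: J_diff)

lemma Jn_contraction: "f \<in> V \<Longrightarrow> 0 \<le> h \<Longrightarrow> N ((J h ^^ n) f) \<le> N f"
proof (induction n)
  case (Suc n)
  then show ?case using J_contraction[of "(J h ^^ n) f" h] by simp
qed simp

lemma A_Jn: "u \<in> D \<Longrightarrow> 0 \<le> h \<Longrightarrow> A ((J h ^^ n) u) = (J h ^^ n) (A u)"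
  by (induction n) (auto simp: A_J)

lemma J_Jn_commute: "f \<in> V \<Longrightarrow> 0 \<le> h \<Longrightarrow> 0 \<le> k \<Longrightarrow> J h ((J k ^^ n) f) = (J k ^^ n) (J h f)"
  by (induction n) (auto simp: J_commute[of _ h k])

lemma JJ_power: "f \<in> V \<Longrightarrow> 0 \<le> h \<Longrightarrow> 0 \<le> k \<Longrightarrow> ((\<lambda>g. J h (J k g)) ^^ n) f = (J h ^^ n) ((J k ^^ n) f)"
proof (induction n)
  case (Suc n)
  then show ?case using J_Jn_commute[of "(J k ^^ n) f" k h n]
    by (simp add: J_Jn_commute)
qed simp

lemma Jn_sub_le: assumes "f \<in> D" "0 \<le> h" shows "N (f - (J h ^^ n) f) \<le> real n * (h * N (A f))"
proof -
  have "N ((J h ^^ n) f - (id ^^ n) f) \<le> real n * (h * N (A f))"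
  proof (rule telescoping[where S = "{f}"])
    show "N (J h g - J h k) \<le> N (g - k)" if "g \<in> V" "k \<in> V" for g k
      using J_contraction[of "g - k" h] that assms by (simp add: J_diff)
    show "N (J h g - id g) \<le> h * N (A f)" if "g \<in> {f}" for g
      using J_sub_le[of f h] that assms by (simp add: N_commute)
  qed (use assms in auto)
  then show ?thesis by (simp add: N_commute)
qed

text \<open>Telescoping on a sublevel set of \<open>N (A (A g))\<close>. Resolvents preserve it,
  because they are contractions and commute with \<open>A\<close>, so each of the \<open>n\<close>
  steps has the same error bound.\<close>

lemma Jn_JJ_diff:
  assumes "f \<in> D2" "0 \<le> s" "0 \<le> t"
  shows "N ((J s ^^ n) ((J t ^^ n) f) - (J (s + t) ^^ n) f) \<le> real n * (s * t * N (A (A f)))"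
proof -
  have "N (((\<lambda>g. J s (J t g)) ^^ n) f - (J (s + t) ^^ n) f) \<le> real n * (s * t * N (A (A f)))"
  proof (rule telescoping[where S = "{g \<in> D2. N (A (A g)) \<le> N (A (A f))}"])
    show "N (J s (J t g) - J s (J t k)) \<le> N (g - k)" if "g \<in> V" "k \<in> V" for g k
      using J_contraction[of "g - k" t] J_contraction[of "J t (g - k)" s] that assms by (simp add: J_diff)
    show "N (J s (J t g) - J (s + t) g) \<le> s * t * N (A (A f))"
      if "g \<in> {g \<in> D2. N (A (A g)) \<le> N (A (A f))}" for g
      using J_J_diff[of g s t] that assms mult_left_mono[of "N (A (A g))" "N (A (A f))" "s * t"] by auto
    show "J (s + t) g \<in> {g \<in> D2. N (A (A g)) \<le> N (A (A f))}"
      if "g \<in> {g \<in> D2. N (A (A g)) \<le> N (A (A f))}" for g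
      using that assms J_contraction[of "A (A g)" "s + t"] by (auto simp: J_D2 A_J D2_D)
  qed (use assms in \<open>auto simp: D2_D\<close>)
  then show ?thesis using assms by (simp add: JJ_power D2_D)
qed

text \<open>A first order Taylor expansion of the Euler scheme at time \<open>n h\<close>. Step
  \<open>n + 1\<close> contributes \<open>h A f\<close> up to an error of at most
  \<open>(n + 1) h\<^sup>2 N (A (A f))\<close>, and these errors add up to at most
  \<open>(n h)\<^sup>2 N (A (A f))\<close>, however the time is divided into steps.\<close>

lemma Jn_generator_diff:
  assumes "f \<in> D2" "0 \<le> h"
  shows "N (f - (J h ^^ n) f - (real n * h) *\<^sub>R A f) \<le> (real n * h)\<^sup>2 * N (A (A f))"
proof (induction n)
  case (Suc n)
  let ?g = "(J h ^^ n) f" and ?K = "N (A (A f))"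
  note f = D2_D[OF assms(1)]
  have "?g - J h ?g = h *\<^sub>R J h (A ?g)" using assms f by (intro J_sub) auto
  also have "A ?g = (J h ^^ n) (A f)" using assms f by (simp add: A_Jn)
  finally have "?g - J h ?g = h *\<^sub>R (J h ^^ Suc n) (A f)" by simp
  then have "f - (J h ^^ Suc n) f - (real (Suc n) * h) *\<^sub>R A f
     = (f - ?g - (real n * h) *\<^sub>R A f) - h *\<^sub>R (A f - (J h ^^ Suc n) (A f))"
    by (simp add: algebra_simps)
  also have "N \<dots> \<le> N (f - ?g - (real n * h) *\<^sub>R A f) + N (h *\<^sub>R (A f - (J h ^^ Suc n) (A f)))"
    using assms f by (intro N_diff_le) auto
  also have "\<dots> \<le> (real n * h)\<^sup>2 * ?K + h * (real (Suc n) * (h * ?K))"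
    using assms f Jn_sub_le[of "A f" h "Suc n"] Suc
    by (auto intro!: add_mono mult_left_mono simp del: funpow.simps of_nat_Suc)
  also have "\<dots> = ((real n)\<^sup>2 + real n + 1) * h\<^sup>2 * ?K" by (simp add: power2_eq_square algebra_simps)
  also have "\<dots> \<le> (real (Suc n))\<^sup>2 * h\<^sup>2 * ?K"
    by (intro mult_right_mono) (auto simp: power2_eq_square algebra_simps)
  finally show ?case by (simp add: power_mult_distrib)
qed simp

subsection \<open>The semigroup\<close>

text \<open>Backward Euler with dyadic step size. Passing from \<open>k\<close> to
  \<open>Suc k\<close> halves every step, so consecutive approximations compare two half steps with
  one full step, which is what \<open>Jn_JJ_diff\<close> estimates.\<close>

definition E :: "nat \<Rightarrow> real \<Rightarrow> 'v \<Rightarrow> 'v" where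
  "E k t = J (t / 2 ^ k) ^^ (2 ^ k)"

lemma E_V [simp]: "f \<in> V \<Longrightarrow> 0 \<le> t \<Longrightarrow> E k t f \<in> V" by (simp add: E_def)

lemma E_diff: "f \<in> V \<Longrightarrow> g \<in> V \<Longrightarrow> 0 \<le> t \<Longrightarrow> E k t (f - g) = E k t f - E k t g"
  by (simp add: E_def Jn_diff)

lemma E_contraction: "f \<in> V \<Longrightarrow> 0 \<le> t \<Longrightarrow> N (E k t f) \<le> N f"
  by (simp add: E_def Jn_contraction)

lemma E_Suc: assumes "f \<in> D2" "0 \<le> t"
  shows "N (E (Suc k) t f - E k t f) \<le> t\<^sup>2 * N (A (A f)) * (1/2) ^ k"
proof -
  let ?h = "t / 2 ^ Suc k"
  have "(2::nat) ^ Suc k = 2 ^ k + 2 ^ k" by simp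
  then have "E (Suc k) t f = (J ?h ^^ (2 ^ k)) ((J ?h ^^ (2 ^ k)) f)"
    unfolding E_def by (simp only: funpow_add o_apply)
  moreover have "?h + ?h = t / 2 ^ k" by (simp add: field_simps)
  then have "E k t f = (J (?h + ?h) ^^ (2 ^ k)) f" by (simp only: E_def)
  ultimately have "N (E (Suc k) t f - E k t f) \<le> real (2 ^ k) * (?h * ?h * N (A (A f)))"
    using Jn_JJ_diff[OF assms(1), of ?h ?h "2 ^ k"] assms(2)
    by (simp only: divide_nonneg_nonneg zero_le_power zero_le_numeral)
  also have "\<dots> = t\<^sup>2 * N (A (A f)) * (1/2) ^ k / 4"
    by (simp add: power2_eq_square field_simps power_mult_distrib)
  also have "\<dots> \<le> t\<^sup>2 * N (A (A f)) * (1/2) ^ k" by simp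
  finally show ?thesis .
qed

text \<open>The factor on the right is the exact partial sum of the geometric series from
  \<open>E_Suc\<close>; keeping its negative last term lets the induction close.\<close>

lemma E_Cauchy_D2: assumes "f \<in> D2" "0 \<le> t"
  shows "N (E (k + n) t f - E k t f) \<le> t\<^sup>2 * N (A (A f)) * (2 * (1/2) ^ k - 2 * (1/2) ^ (k + n))"
proof (induction n)
  case (Suc n)
  have "N (E (k + Suc n) t f - E k t f) \<le> N (E (Suc (k + n)) t f - E (k + n) t f) + N (E (k + n) t f - E k t f)"
    using assms by (auto intro!: N_diff_triangle simp: D2_D)
  also have "\<dots> \<le> t\<^sup>2 * N (A (A f)) * (1/2) ^ (k + n) + t\<^sup>2 * N (A (A f)) * (2 * (1/2) ^ k - 2 * (1/2) ^ (k + n))"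
    using E_Suc assms Suc by (intro add_mono)
  also have "\<dots> = t\<^sup>2 * N (A (A f)) * (2 * (1/2) ^ k - 2 * (1/2) ^ (k + Suc n))"
    by (simp add: algebra_simps)
  finally show ?case .
qed simp

lemma E_Cauchy_at: assumes "f \<in> D2" "0 \<le> t" "0 < e"
  shows "\<exists>M. \<forall>k\<ge>M. N (E k t f - E M t f) < e"
proof -
  let ?K = "t\<^sup>2 * N (A (A f)) * 2"
  have "(\<lambda>k. ?K * (1/2) ^ k) \<longlonglongrightarrow> ?K * 0"
    by (intro tendsto_mult tendsto_const LIMSEQ_power_zero) auto
  then have "\<forall>\<^sub>F k in sequentially. ?K * (1/2) ^ k < e"
    using assms by (intro order_tendstoD) auto
  then obtain M where M: "?K * (1/2) ^ M < e" by (auto simp: eventually_sequentially)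
  have "N (E k t f - E M t f) < e" if "M \<le> k" for k
  proof -
    have "N (E k t f - E M t f) \<le> t\<^sup>2 * N (A (A f)) * (2 * (1/2) ^ M - 2 * (1/2) ^ k)"
      using E_Cauchy_D2[OF assms(1,2), of M "k - M"] that by simp
    also have "\<dots> \<le> t\<^sup>2 * N (A (A f)) * (2 * (1/2) ^ M)"
      by (intro mult_left_mono) auto
    finally show ?thesis using M by (simp add: mult_ac)
  qed
  then show ?thesis by blast
qed

text \<open>The Cauchy property passes from \<open>D2\<close> to its closure because all
  \<open>E k t\<close> are contractions: approximating \<open>f\<close> costs the same for every
  \<open>k\<close>.\<close>

lemma E_Cauchy: assumes "f \<in> V" "0 \<le> t" "0 < e"
  shows "\<exists>M. \<forall>i\<ge>M. \<forall>j\<ge>M. N (E i t f - E j t f) < e"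
proof -
  obtain u where u: "u \<in> D2" "N (f - u) < e/4" using D2_dense[of f "e/4"] assms by auto
  obtain M where M: "\<And>k. k \<ge> M \<Longrightarrow> N (E k t u - E M t u) < e/4"
    using E_Cauchy_at[of u t "e/4"] u assms by auto
  have uV: "u \<in> V" using u D2_D by blast
  have fu: "N (E k t f - E k t u) < e/4" for k
    using E_contraction[of "f - u" t k] u assms uV by (simp add: E_diff)
  have "N (E i t f - E j t f) < e" if "M \<le> i" "M \<le> j" for i j
  proof -
    have "N (E i t f - E j t f) \<le> N (E i t f - E i t u) + (N (E i t u - E M t u) + (N (E M t u - E j t u) + N (E j t u - E j t f)))"
      using assms uV N_diff_triangle[of "E i t f" "E i t u" "E j t f"] N_diff_triangle[of "E i t u" "E M t u" "E j t f"]
        N_diff_triangle[of "E M t u" "E j t u" "E j t f"] by simp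
    then show ?thesis using fu[of i] fu[of j] M[OF that(1)] M[OF that(2)]
      unfolding N_commute[of "E M t u"] N_commute[of "E j t u" "E j t f"] by linarith
  qed
  then show ?thesis by blast
qed

definition T :: "real \<Rightarrow> 'v \<Rightarrow> 'v" where
  "T t f = (THE l. l \<in> V \<and> (\<lambda>k. N (E k t f - l)) \<longlonglongrightarrow> 0)"

lemma T_ex: assumes "f \<in> V" "0 \<le> t"
  shows "T t f \<in> V \<and> (\<lambda>k. N (E k t f - T t f)) \<longlonglongrightarrow> 0"
proof -
  have "\<exists>l\<in>V. (\<lambda>k. N (E k t f - l)) \<longlonglongrightarrow> 0"
    using assms by (intro complete E_Cauchy) auto
  then have "\<exists>!l. l \<in> V \<and> (\<lambda>k. N (E k t f - l)) \<longlonglongrightarrow> 0"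
    using assms N_limit_unique[of sequentially "\<lambda>k. E k t f"] by auto
  then show ?thesis unfolding T_def by (rule theI')
qed

lemma T_V [simp]: "f \<in> V \<Longrightarrow> 0 \<le> t \<Longrightarrow> T t f \<in> V" using T_ex by blast

lemma T_lim: "f \<in> V \<Longrightarrow> 0 \<le> t \<Longrightarrow> (\<lambda>k. N (E k t f - T t f)) \<longlonglongrightarrow> 0" using T_ex by blast

lemma T_eqI: "f \<in> V \<Longrightarrow> 0 \<le> t \<Longrightarrow> l \<in> V \<Longrightarrow> (\<lambda>k. N (E k t f - l)) \<longlonglongrightarrow> 0 \<Longrightarrow> T t f = l"
  using N_limit_unique[of sequentially "\<lambda>k. E k t f" "T t f" l] T_ex[of f t] by simp

lemma T_0 [simp]: assumes "f \<in> V" shows "T 0 f = f"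
proof (rule T_eqI)
  have "(J 0 ^^ n) f = f" for n by (induction n) auto
  then show "(\<lambda>k. N (E k 0 f - f)) \<longlonglongrightarrow> 0" by (simp add: E_def)
qed (use assms in auto)

lemma T_add: assumes "f \<in> V" "g \<in> V" "0 \<le> t" shows "T t (f + g) = T t f + T t g"
proof (rule T_eqI)
  have *: "E k t (f + g) - (T t f + T t g) = (E k t f - T t f) + (E k t g - T t g)" for k
    using assms by (simp add: E_def Jn_add)
  show "(\<lambda>k. N (E k t (f + g) - (T t f + T t g))) \<longlonglongrightarrow> 0"
    unfolding * using assms
    by (intro Lim_null_comparison[OF _ tendsto_add_zero[OF T_lim[of f t] T_lim[of g t]]])
       (auto intro!: always_eventually N_triangle)
qed (use assms in auto)

lemma T_scale: assumes "f \<in> V" "0 \<le> t" shows "T t (c *\<^sub>R f) = c *\<^sub>R T t f"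
proof (rule T_eqI)
  have *: "E k t (c *\<^sub>R f) - c *\<^sub>R T t f = c *\<^sub>R (E k t f - T t f)" for k
    using assms by (simp add: E_def Jn_scale algebra_simps)
  show "(\<lambda>k. N (E k t (c *\<^sub>R f) - c *\<^sub>R T t f)) \<longlonglongrightarrow> 0"
    unfolding * using tendsto_mult_right_zero[OF T_lim[OF assms], of "\<bar>c\<bar>"] by simp
qed (use assms in auto)

lemma T_diff: "f \<in> V \<Longrightarrow> g \<in> V \<Longrightarrow> 0 \<le> t \<Longrightarrow> T t (f - g) = T t f - T t g"
  using T_add[of f "(-1) *\<^sub>R g" t] T_scale[of g t "-1"] V_closed(4)[of g "-1"] by simp

lemma T_contraction: assumes "f \<in> V" "0 \<le> t" shows "N (T t f) \<le> N f"
  using assms by (intro tendsto_upperbound[OF N_limit[OF _ _ T_lim]]) (auto intro!: always_eventually E_contraction)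

lemma T_sub_le: assumes "f \<in> D" "0 \<le> t" shows "N (f - T t f) \<le> t * N (A f)"
proof (rule tendsto_upperbound)
  have "(\<lambda>k. N (f - E k t f - (f - T t f))) \<longlonglongrightarrow> 0"
    using T_lim[of f t] assms by (simp add: N_commute)
  then show "(\<lambda>k. N (f - E k t f)) \<longlonglongrightarrow> N (f - T t f)"
    using assms by (intro N_limit) auto
  show "\<forall>\<^sub>F k in sequentially. N (f - E k t f) \<le> t * N (A f)"
    using Jn_sub_le[of f "t / 2 ^ k" "2 ^ k" for k] assms by (intro always_eventually) (auto simp: E_def)
qed auto

lemma T_generator_D2: assumes "f \<in> D2" "0 \<le> t" shows "N (f - T t f - t *\<^sub>R A f) \<le> t\<^sup>2 * N (A (A f))"
proof (rule tendsto_upperbound)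
  note f = D2_D[OF assms(1)]
  have "(\<lambda>k. N ((f - E k t f - t *\<^sub>R A f) - (f - T t f - t *\<^sub>R A f))) \<longlonglongrightarrow> 0"
    using T_lim[of f t] assms f by (simp add: N_commute)
  then show "(\<lambda>k. N (f - E k t f - t *\<^sub>R A f)) \<longlonglongrightarrow> N (f - T t f - t *\<^sub>R A f)"
    using assms f by (intro N_limit) auto
  show "\<forall>\<^sub>F k in sequentially. N (f - E k t f - t *\<^sub>R A f) \<le> t\<^sup>2 * N (A (A f))"
    using Jn_generator_diff[of f "t / 2 ^ k" "2 ^ k" for k] assms by (intro always_eventually) (auto simp: E_def)
qed auto

lemma N_eqI: "f \<in> V \<Longrightarrow> g \<in> V \<Longrightarrow> (\<And>e. 0 < e \<Longrightarrow> N (f - g) \<le> e) \<Longrightarrow> f = g"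
  using N_zeroD[of "f - g"] field_le_epsilon[of "N (f - g)" 0] N_nonneg[of "f - g"] by force

text \<open>The approximations do not have the semigroup property, but
  \<open>E k s (E k t f)\<close> and \<open>E k (s + t) f\<close> differ by at most
  \<open>2^k (s / 2^k) (t / 2^k) N (A (A f))\<close>, which vanishes in the limit.\<close>

lemma T_semigroup_D2: assumes "f \<in> D2" "0 \<le> s" "0 \<le> t" shows "T (s + t) f = T s (T t f)"
proof (rule T_eqI)
  note f = D2_D[OF assms(1)]
  have 1: "(\<lambda>k. N (E k s (T t f) - T s (T t f))) \<longlonglongrightarrow> 0"
    using assms f by (intro T_lim) auto
  have 2: "(\<lambda>k. N (E k s (E k t f) - E k s (T t f))) \<longlonglongrightarrow> 0"
  proof (rule Lim_null_comparison[OF _ T_lim[of f t]])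
    show "\<forall>\<^sub>F k in sequentially. norm (N (E k s (E k t f) - E k s (T t f))) \<le> N (E k t f - T t f)"
      using E_contraction[of "E k t f - T t f" s k for k] assms f by (intro always_eventually) (auto simp: E_diff)
  qed (use assms f in auto)
  have 3: "(\<lambda>k. N (E k s (E k t f) - E k (s + t) f)) \<longlonglongrightarrow> 0"
  proof (rule Lim_null_comparison)
    show "\<forall>\<^sub>F k in sequentially. norm (N (E k s (E k t f) - E k (s + t) f)) \<le> s * t * N (A (A f)) * (1/2) ^ k"
    proof (intro always_eventually allI)
      fix k
      have "N (E k s (E k t f) - E k (s + t) f) \<le> real (2 ^ k) * (s / 2 ^ k * (t / 2 ^ k) * N (A (A f)))"
        using Jn_JJ_diff[of f "s / 2 ^ k" "t / 2 ^ k" "2 ^ k"] assms by (simp add: E_def add_divide_distrib)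
      then show "norm (N (E k s (E k t f) - E k (s + t) f)) \<le> s * t * N (A (A f)) * (1/2) ^ k"
        by (simp add: field_simps)
    qed
    have "(\<lambda>k. (1/2::real) ^ k) \<longlonglongrightarrow> 0" by (intro LIMSEQ_power_zero) auto
    then show "(\<lambda>k. s * t * N (A (A f)) * (1/2) ^ k) \<longlonglongrightarrow> 0" by (rule tendsto_mult_right_zero)
  qed
  show "(\<lambda>k. N (E k (s + t) f - T s (T t f))) \<longlonglongrightarrow> 0"
  proof (rule Lim_null_comparison)
    show "(\<lambda>k. N (E k s (E k t f) - E k (s + t) f) + (N (E k s (E k t f) - E k s (T t f)) + N (E k s (T t f) - T s (T t f)))) \<longlonglongrightarrow> 0"
      using tendsto_add[OF 3 tendsto_add[OF 2 1]] by simp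
    show "\<forall>\<^sub>F k in sequentially. norm (N (E k (s + t) f - T s (T t f))) \<le>
      N (E k s (E k t f) - E k (s + t) f) + (N (E k s (E k t f) - E k s (T t f)) + N (E k s (T t f) - T s (T t f)))"
    proof (intro always_eventually allI)
      fix k
      show "norm (N (E k (s + t) f - T s (T t f))) \<le>
      N (E k s (E k t f) - E k (s + t) f) + (N (E k s (E k t f) - E k s (T t f)) + N (E k s (T t f) - T s (T t f)))"
        using N_diff_triangle[of "E k (s + t) f" "E k s (E k t f)" "T s (T t f)"]
          N_diff_triangle[of "E k s (E k t f)" "E k s (T t f)" "T s (T t f)"] assms f
        by (simp add: N_commute)
    qed
  qed
qed (use assms in \<open>auto simp: D2_D\<close>)

lemma T_semigroup: assumes "f \<in> V" "0 \<le> s" "0 \<le> t" shows "T (s + t) f = T s (T t f)"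
proof (rule N_eqI)
  fix e :: real assume "0 < e"
  then obtain u where u: "u \<in> D2" "N (f - u) < e/2" using D2_dense[of f "e/2"] assms by auto
  have uV: "u \<in> V" using u D2_D by blast
  have "N (T (s + t) f - T s (T t f)) \<le> N (T (s + t) f - T (s + t) u) + N (T s (T t u) - T s (T t f))"
    using assms uV u N_diff_triangle[of "T (s + t) f" "T (s + t) u" "T s (T t f)"] by (simp add: T_semigroup_D2)
  also have "T (s + t) f - T (s + t) u = T (s + t) (f - u)" using assms uV by (simp add: T_diff)
  also have "T s (T t u) - T s (T t f) = T s (T t (u - f))" using assms uV by (simp add: T_diff)
  also have "N (T (s + t) (f - u)) + N (T s (T t (u - f))) \<le> N (f - u) + N (u - f)"
    using assms uV T_contraction[of "T t (u - f)" s] T_contraction[of "u - f" t]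
    by (intro add_mono T_contraction) auto
  also have "\<dots> \<le> e" using u by (simp add: N_commute)
  finally show "N (T (s + t) f - T s (T t f)) \<le> e" .
qed (use assms in auto)

lemma T_continuous: assumes "f \<in> V" shows "((\<lambda>t. N (T t f - f)) \<longlongrightarrow> 0) (at_right 0)"
proof (rule tendstoI)
  fix e :: real assume e: "0 < e"
  then obtain u where u: "u \<in> D" "N (f - u) < e/3" using dense[of f "e/3"] assms by auto
  define d where "d = e / 3 / (N (A u) + 1)"
  have d: "0 < d" using e N_nonneg[of "A u"] by (simp add: d_def add_nonneg_pos)
  have "N (T t f - f) < e" if t: "0 < t" "t < d" for t
  proof -
    have "t * N (A u) \<le> d * N (A u)" using t by (intro mult_right_mono) auto
    also have "\<dots> \<le> e/3" using e unfolding d_def by (intro mult_div_le) auto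
    finally have 1: "N (T t u - u) \<le> e/3" using T_sub_le[of u t] u t by (simp add: N_commute)
    have "N (T t f - f) \<le> N (T t f - T t u) + (N (T t u - u) + N (u - f))"
      using N_diff_triangle[of "T t f" "T t u" f] N_diff_triangle[of "T t u" u f] assms u t by simp
    moreover have "N (T t f - T t u) \<le> N (f - u)"
      using T_contraction[of "f - u" t] u assms t by (simp add: T_diff)
    ultimately show ?thesis using 1 u by (simp add: N_commute)
  qed
  then show "\<forall>\<^sub>F t in at_right 0. dist (N (T t f - f)) 0 < e"
    using d by (auto simp: eventually_at_right_field)
qed

text \<open>Strong convergence of \<open>J h\<close> to the identity for small \<open>h\<close>, in
  the form in which it regularises an element of \<open>D\<close>.\<close>

lemma J_lim: assumes "f \<in> V" "0 < e" shows "\<exists>h>0. N (f - J h f) < e"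
proof -
  obtain u where u: "u \<in> D" "N (f - u) < e/3" using dense[of f "e/3"] assms by auto
  define h where "h = e / 3 / (N (A u) + 1)"
  have h: "0 < h" using assms N_nonneg[of "A u"] by (simp add: h_def add_nonneg_pos)
  have "h * N (A u) \<le> e / 3"
    using assms unfolding h_def by (intro mult_div_le) auto
  then have 1: "N (u - J h u) \<le> e/3" using J_sub_le[of u h] u h assms by auto
  have "N (f - J h f) \<le> N (f - u) + (N (u - J h u) + N (J h u - J h f))"
    using N_diff_triangle[of f u "J h f"] N_diff_triangle[of u "J h u" "J h f"] assms u h by simp
  moreover have "N (J h u - J h f) \<le> N (u - f)"
    using J_contraction[of "u - f" h] u assms h by (simp add: J_diff)
  ultimately have "N (f - J h f) < e" using 1 u by (simp add: N_commute)
  then show ?thesis using h by blast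
qed

text \<open>The expansion \<open>T_generator_D2\<close> requires \<open>D2\<close>, so
  \<open>u\<close> is replaced by \<open>J h u\<close>. The difference quotient of
  \<open>u - J h u\<close> is bounded by \<open>N (A u - J h (A u))\<close> uniformly in
  \<open>t\<close>, because \<open>T_sub_le\<close> is linear in \<open>t\<close>.\<close>

lemma T_generator: assumes "u \<in> D"
  shows "((\<lambda>t. N ((1/t) *\<^sub>R (u - T t u) - A u)) \<longlongrightarrow> 0) (at_right 0)"
proof (rule tendstoI)
  fix e :: real assume e: "0 < e"
  then obtain h where h: "0 < h" "N (A u - J h (A u)) < e/3" using J_lim[of "A u" "e/3"] assms by auto
  let ?v = "J h u"
  have v: "?v \<in> D2" using J_D_D2 h assms by blast
  have vD: "?v \<in> D" "A ?v \<in> D" "A ?v = J h (A u)" using v h assms by (auto simp: D2_D A_J)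
  define d where "d = e / 3 / (N (A (A ?v)) + 1)"
  have d: "0 < d" using e N_nonneg[of "A (A ?v)"] by (simp add: d_def add_nonneg_pos)
  have "N ((1/t) *\<^sub>R (u - T t u) - A u) < e" if t: "0 < t" "t < d" for t
  proof -
    have "t * N (A (A ?v)) \<le> d * N (A (A ?v))" using t by (intro mult_right_mono) auto
    also have "\<dots> \<le> e/3" using e unfolding d_def by (intro mult_div_le) auto
    finally have 1: "t * N (A (A ?v)) \<le> e/3" .
    have "N ((u - ?v) - T t (u - ?v)) \<le> t * N (A (u - ?v))"
      using assms vD t by (intro T_sub_le) auto
    also have "A (u - ?v) = A u - J h (A u)" using assms vD by (simp add: A_diff)
    also have "t * N (A u - J h (A u)) \<le> t * (e/3)" using h t by (intro mult_left_mono) auto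
    finally have 2: "N ((u - ?v) - T t (u - ?v)) \<le> t * (e/3)" .
    have 3: "N (?v - T t ?v - t *\<^sub>R A ?v) \<le> t * (e/3)"
      using order_trans[OF T_generator_D2[OF v, of t], of "t * (e/3)"] t mult_left_mono[OF 1, of t]
      by (simp add: power2_eq_square mult.assoc)
    have 4: "N (t *\<^sub>R (A u - A ?v)) < t * (e/3)" using h t vD by simp
    define p q r where "p = (u - ?v) - T t (u - ?v)" and "q = ?v - T t ?v - t *\<^sub>R A ?v"
      and "r = t *\<^sub>R (A u - A ?v)"
    have "u \<in> V" "?v \<in> V" "A u \<in> V" "A ?v \<in> V" using assms vD(1) by auto
    then have V: "p \<in> V" "q \<in> V" "r \<in> V" using t by (simp_all add: p_def q_def r_def)
    have "u - T t u - t *\<^sub>R A u = p + (q - r)"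
      using \<open>u \<in> V\<close> \<open>?v \<in> V\<close> t by (simp add: p_def q_def r_def T_diff scaleR_diff_right)
    also have "N \<dots> \<le> N p + (N q + N r)"
      using N_triangle[of p "q - r"] N_diff_le[of q r] V by simp
    also have "\<dots> < t * (e/3) + (t * (e/3) + t * (e/3))"
      using 2 3 4 unfolding p_def q_def r_def by (intro add_le_less_mono)
    also have "\<dots> = t * e" by (simp add: field_simps)
    finally have "N (u - T t u - t *\<^sub>R A u) < t * e" .
    moreover have "(1/t) *\<^sub>R (u - T t u) - A u = (1/t) *\<^sub>R (u - T t u - t *\<^sub>R A u)"
      using t by (simp add: algebra_simps)
    then have "N ((1/t) *\<^sub>R (u - T t u) - A u) = N (u - T t u - t *\<^sub>R A u) / t"
      using t by (simp only: N_scale) simp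
    ultimately show ?thesis using t by (simp only: pos_divide_less_eq mult.commute)
  qed
  then show "\<forall>\<^sub>F t in at_right 0. dist (N ((1/t) *\<^sub>R (u - T t u) - A u)) 0 < e"
    using d by (auto simp: eventually_at_right_field)
qed

text \<open>Maximality: since \<open>1 + A\<close> is onto, some \<open>f\<close> in
  \<open>D\<close> satisfies \<open>f + A f = u + v\<close>. The difference \<open>w = u - f\<close>
  is then in the domain of the generator with image \<open>- w\<close>, so its orbit would grow like
  e^t. As \<open>T\<close> is contractive, \<open>w\<close> must vanish.\<close>

lemma T_generator_converse:
  assumes u: "u \<in> V" "v \<in> V" and lim: "((\<lambda>t. N ((1/t) *\<^sub>R (u - T t u) - v)) \<longlongrightarrow> 0) (at_right 0)"
  shows "u \<in> D" and "v = A u"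
proof -
  define f where "f = J 1 (u + v)"
  have f: "f \<in> D" "f + A f = u + v" using J_ex[of "u + v" 1] u by (auto simp: f_def)
  define w where "w = u - f"
  have w: "w \<in> V" using u f by (auto simp: w_def)
  have vA: "v - A f = - w" using f by (simp add: w_def algebra_simps)
  have "((\<lambda>t. N ((1/t) *\<^sub>R (u - T t u) - v) + N ((1/t) *\<^sub>R (f - T t f) - A f)) \<longlongrightarrow> 0 + 0) (at_right 0)"
    by (intro tendsto_add lim T_generator f)
  moreover have "\<forall>\<^sub>F t in at_right 0. N w \<le> N ((1/t) *\<^sub>R (u - T t u) - v) + N ((1/t) *\<^sub>R (f - T t f) - A f)"
    unfolding eventually_at_right_field
  proof (intro exI[of _ 1] conjI allI impI)
    fix t :: real assume t: "0 < t" "t < 1"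
    let ?r = "(1/t) *\<^sub>R (w - T t w) + w"
    have "?r = ((1/t) *\<^sub>R (u - T t u) - v) - ((1/t) *\<^sub>R (f - T t f) - A f) + (w + (v - A f))"
      using u f t by (simp add: w_def T_diff scaleR_diff_right)
    also have "\<dots> = ((1/t) *\<^sub>R (u - T t u) - v) - ((1/t) *\<^sub>R (f - T t f) - A f)"
      by (simp add: vA)
    also have "N \<dots> \<le> N ((1/t) *\<^sub>R (u - T t u) - v) + N ((1/t) *\<^sub>R (f - T t f) - A f)"
      using u f t by (intro N_diff_le) auto
    finally have r: "N ?r \<le> \<dots>" .
    \<comment> \<open>Contractivity enters here: with \<open>N (T t w) \<le> N w\<close> this
      identity bounds \<open>N w\<close> by the residual \<open>?r\<close>, which tends to
      0.\<close>
    have "(1 + t) *\<^sub>R w = t *\<^sub>R ?r + T t w" using t by (simp add: algebra_simps)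
    then have "N ((1 + t) *\<^sub>R w) \<le> N (t *\<^sub>R ?r) + N (T t w)"
      using N_triangle[of "t *\<^sub>R ?r" "T t w"] w t by simp
    then have "(1 + t) * N w \<le> t * N ?r + N w" using T_contraction[of w t] w t by simp
    then have "t * N w \<le> t * N ?r" by (simp add: algebra_simps)
    then have "N w \<le> N ?r" using t by simp
    then show "N w \<le> N ((1/t) *\<^sub>R (u - T t u) - v) + N ((1/t) *\<^sub>R (f - T t f) - A f)" using r by simp
  qed simp
  ultimately have "N w \<le> 0 + 0" by (rule tendsto_lowerbound) simp
  then have "w = 0" using N_zeroD[OF w] N_nonneg[of w] by simp
  then show "u \<in> D" "v = A u" using f by (auto simp: w_def)
qed

end

section \<open>Uniqueness of semigroups\<close>

text \<open>A continuous function whose upper right derivative is at most 0 does not increase. The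
  last point where it lies below the line of slope \<open>e\<close> must be \<open>t\<close>, since
  the right derivative would push this point further.\<close>

lemma nonpos_of_right_derivative_nonpos:
  fixes \<phi> :: "real \<Rightarrow> real"
  assumes "0 \<le> t" "\<phi> 0 \<le> 0" "continuous_on {0..t} \<phi>"
    and right: "\<And>s e. 0 \<le> s \<Longrightarrow> s < t \<Longrightarrow> 0 < e \<Longrightarrow> \<exists>d>0. \<forall>h. 0 < h \<and> h < d \<longrightarrow> \<phi> (s + h) \<le> \<phi> s + e * h"
  shows "\<phi> t \<le> 0"
proof (rule field_le_epsilon)
  fix e0 :: real assume "0 < e0"
  define e where "e = e0 / (t + 1)"
  have e: "0 < e" "e * t \<le> e0" using \<open>0 < e0\<close> \<open>0 \<le> t\<close> by (auto simp: e_def field_simps)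
  define Z where "Z = {s \<in> {0..t}. \<phi> s \<le> e * s}"
  have "closed Z" unfolding Z_def
    by (intro continuous_on_closed_Collect_le assms continuous_intros)
  moreover have Z: "Z \<noteq> {}" "bdd_above Z" using assms by (auto simp: Z_def bdd_above_def)
  ultimately have c: "Sup Z \<in> Z" by (intro closed_contains_Sup)
  have "Sup Z = t"
  proof (rule ccontr)
    assume "Sup Z \<noteq> t"
    with c have "0 \<le> Sup Z" "Sup Z < t" by (auto simp: Z_def)
    then obtain d where d: "d > 0" "\<And>h. 0 < h \<Longrightarrow> h < d \<Longrightarrow> \<phi> (Sup Z + h) \<le> \<phi> (Sup Z) + e * h"
      using right[of "Sup Z" e] e by auto
    define h where "h = min (d/2) (t - Sup Z)"
    have h: "0 < h" "h < d" "Sup Z + h \<le> t" using d \<open>Sup Z < t\<close> by (auto simp: h_def)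
    have "\<phi> (Sup Z + h) \<le> e * (Sup Z + h)" using d(2)[OF h(1,2)] c by (simp add: Z_def algebra_simps)
    then have "Sup Z + h \<in> Z" using h c by (auto simp: Z_def)
    then show False using cSup_upper[OF _ Z(2)] h by fastforce
  qed
  then show "\<phi> t \<le> 0 + e0" using c e by (simp add: Z_def)
qed

context complete_normed_subspace
begin

text \<open>
  Sokal's gliding hump: if the operators \<open>S t\<close> had unbounded norms as \<open>t\<close> tends to \<open>0\<close>, a series with
  terms of size \<open>3\<^sup>-\<^sup>n\<close>, each of which is almost maximally stretched by some \<open>S (t\<^sub>n)\<close> with norm at least
  \<open>4\<^sup>n\<close>, would converge to a vector with unbounded orbit near \<open>0\<close>.
\<close>
lemma uniformly_bounded_near_0:
  fixes S :: "real \<Rightarrow> 'v \<Rightarrow> 'v"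
  assumes SV: "\<And>t f. 0 \<le> t \<Longrightarrow> f \<in> V \<Longrightarrow> S t f \<in> V"
    and S_diff: "\<And>t f g. 0 \<le> t \<Longrightarrow> f \<in> V \<Longrightarrow> g \<in> V \<Longrightarrow> S t (f - g) = S t f - S t g"
    and S_scale: "\<And>t f c. 0 \<le> t \<Longrightarrow> f \<in> V \<Longrightarrow> S t (c *\<^sub>R f) = c *\<^sub>R S t f"
    and S_bdd: "\<And>t. 0 \<le> t \<Longrightarrow> \<exists>C. \<forall>f\<in>V. N (S t f) \<le> C * N f"
    and S_cont: "\<And>f. f \<in> V \<Longrightarrow> ((\<lambda>t. N (S t f - f)) \<longlongrightarrow> 0) (at_right 0)"
  shows "\<exists>d>0. \<exists>M. \<forall>t. 0 < t \<and> t < d \<longrightarrow> (\<forall>f\<in>V. N (S t f) \<le> M * N f)"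
proof (rule ccontr)
  assume "\<not> ?thesis"
  then have neg: "\<exists>t f. 0 < t \<and> t < d \<and> f \<in> V \<and> M * N f < N (S t f)" if "0 < d" for d M
    using that by (auto simp: not_le) meson
  have "\<exists>t f. 0 < t \<and> t < 1 / real (Suc n) \<and> f \<in> V \<and> 4 ^ n * N f < N (S t f)" for n
    by (rule neg) simp
  then obtain t f where tf: "\<And>n. 0 < t n" "\<And>n. t n < 1 / real (Suc n)" "\<And>n. f n \<in> V"
    "\<And>n. 4 ^ n * N (f n) < N (S (t n) (f n))" by metis
  define L where "L n = S (t n)" for n
  have LV: "L n g \<in> V" if "g \<in> V" for n g using SV[of "t n" g] tf(1)[of n] that by (simp add: L_def)
  have L_diff: "L n (g - h) = L n g - L n h" if "g \<in> V" "h \<in> V" for n g h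
    using S_diff[of "t n"] tf(1)[of n] that by (simp add: L_def)
  have L_scale: "L n (c *\<^sub>R g) = c *\<^sub>R L n g" if "g \<in> V" for n g c
    using S_scale[of "t n"] tf(1)[of n] that by (simp add: L_def)
  \<comment> \<open>The supremum \<open>q n\<close> of this set is the operator norm of
    \<open>L n\<close>.\<close>
  define Q where "Q n = {N (L n g) | g. g \<in> V \<and> N g \<le> 1}" for n
  have bdd: "bdd_above (Q n)" for n
  proof -
    obtain C where C: "\<And>g. g \<in> V \<Longrightarrow> N (L n g) \<le> C * N g"
      using S_bdd[of "t n"] tf(1)[of n] by (auto simp: L_def)
    have "N (L n g) \<le> max C 0" if "g \<in> V" "N g \<le> 1" for g
    proof -
      have "N (L n g) \<le> max C 0 * N g" using C[OF that(1)] by (meson N_nonneg max.cobounded1 mult_right_mono order_trans)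
      also have "\<dots> \<le> max C 0 * 1" using that by (intro mult_left_mono) auto
      finally show ?thesis by simp
    qed
    then show ?thesis by (auto simp: bdd_above_def Q_def)
  qed
  define q where "q n = Sup (Q n)" for n
  have qle: "N (L n g) \<le> q n * N g" if "g \<in> V" for n g
  proof (cases "N g = 0")
    case True
    then have "g = 0" using that N_zeroD by blast
    then have "L n g = 0" using L_scale[of 0 n 0] by simp
    then show ?thesis using True by simp
  next
    case False
    then have pos: "0 < N g" using N_nonneg[of g] by linarith
    have "N (L n ((1 / N g) *\<^sub>R g)) \<in> Q n"
      unfolding Q_def using that pos by (auto intro!: exI[of _ "(1 / N g) *\<^sub>R g"])
    then have "N (L n ((1 / N g) *\<^sub>R g)) \<le> q n" unfolding q_def by (rule cSup_upper[OF _ bdd])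
    then show ?thesis using that pos by (simp add: L_scale field_simps)
  qed
  have fpos: "0 < N (f n)" for n
  proof -
    have "N (f n) \<noteq> 0" using qle[of "f n" n] tf(3,4)[of n] by (auto simp: L_def)
    then show ?thesis using N_nonneg[of "f n"] by linarith
  qed
  have q4: "4 ^ n \<le> q n" for n
  proof -
    have "4 ^ n * N (f n) \<le> q n * N (f n)" using tf(4)[of n] qle[of "f n" n] tf(3)[of n] by (simp add: L_def)
    then show ?thesis using fpos[of n] by simp
  qed
  have qpos: "0 < q n" for n using q4[of n] by (rule less_le_trans[rotated]) simp
  have "\<exists>y\<in>V. N y \<le> 1 \<and> 3/4 * q n < N (L n y)" for n
  proof -
    \<comment> \<open>The operator norm need not be attained, hence the factor 3/4; any factor above
      1/2 would leave room for the tail of the series estimated below.\<close>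
    have "Q n \<noteq> {}" unfolding Q_def by (auto intro!: exI[of _ 0])
    moreover have "3/4 * q n < Sup (Q n)" using qpos[of n] by (simp add: q_def)
    ultimately obtain z where "z \<in> Q n" "3/4 * q n < z" using less_cSupD by metis
    then show ?thesis by (auto simp: Q_def)
  qed
  then obtain y where y: "\<And>n. y n \<in> V" "\<And>n. N (y n) \<le> 1" "\<And>n. 3/4 * q n < N (L n (y n))" by metis
  define c where "c n = (1/3::real) ^ n *\<^sub>R y n" for n
  have cV: "c n \<in> V" and cN: "N (c n) \<le> (1/3) ^ n" for n
    using y(1,2)[of n] by (auto simp: c_def mult_left_le)
  \<comment> \<open>The sign of each new term is chosen after the partial sum is known. As
    \<open>2 L n (c n)\<close> is the difference of the images of \<open>x n + c n\<close> and
    \<open>x n - c n\<close>, one of the two images has norm at least \<open>N (L n (c n))\<close>,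
    so earlier terms cannot cancel the new one.\<close>
  define x where "x = rec_nat 0 (\<lambda>n z. if N (L n (c n)) \<le> N (L n (z + c n)) then z + c n else z - c n)"
  have xSuc: "x (Suc n) = (if N (L n (c n)) \<le> N (L n (x n + c n)) then x n + c n else x n - c n)" for n
    by (simp add: x_def)
  have xV: "x n \<in> V" for n
    by (induction n) (auto simp: xSuc cV, simp add: x_def)
  have xL: "N (L n (c n)) \<le> N (L n (x (Suc n)))" for n
  proof (cases "N (L n (c n)) \<le> N (L n (x n + c n))")
    case False
    have "2 * N (L n (c n)) = N (L n ((x n + c n) - (x n - c n)))"
      using L_scale[OF cV, of n 2 n] by (simp flip: scaleR_2)
    also have "L n ((x n + c n) - (x n - c n)) = L n (x n + c n) - L n (x n - c n)"
      using xV cV by (intro L_diff) auto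
    also have "N \<dots> \<le> N (L n (x n + c n)) + N (L n (x n - c n))"
      using xV cV by (intro N_diff_le LV) auto
    finally show ?thesis using False by (simp add: xSuc)
  qed (simp add: xSuc)
  have xstep: "N (x (Suc n) - x n) \<le> (1/3) ^ n" for n using cN[of n] by (simp add: xSuc)
  have xdist: "N (x (Suc n + j) - x (Suc n)) \<le> ((1/3) ^ n - (1/3) ^ (n + j)) / 2" for n j
  proof (induction j)
    case (Suc j)
    have "N (x (Suc n + Suc j) - x (Suc n)) \<le> N (x (Suc (Suc n + j)) - x (Suc n + j)) + N (x (Suc n + j) - x (Suc n))"
      using N_diff_triangle[of "x (Suc (Suc n + j))" "x (Suc n + j)" "x (Suc n)"] xV by simp
    also have "\<dots> \<le> (1/3) ^ (Suc n + j) + ((1/3) ^ n - (1/3) ^ (n + j)) / 2"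
      by (intro add_mono xstep Suc)
    also have "\<dots> = ((1/3) ^ n - (1/3) ^ (n + Suc j)) / 2" by (simp add: field_simps)
    finally show ?case .
  qed simp
  \<comment> \<open>Half of \<open>(1/3) ^ n\<close> is the sum of all later powers of 1/3.\<close>
  have xdist': "N (x k - x (Suc n)) \<le> (1/3) ^ n / 2" if "Suc n \<le> k" for k n
  proof -
    have "((1/3::real) ^ n - (1/3) ^ (n + (k - Suc n))) / 2 \<le> (1/3) ^ n / 2" by simp
    with xdist[of n "k - Suc n"] have "N (x (Suc n + (k - Suc n)) - x (Suc n)) \<le> (1/3) ^ n / 2"
      by (rule order_trans)
    then show ?thesis using that by simp
  qed
  have "\<exists>z\<in>V. (\<lambda>n. N (x n - z)) \<longlonglongrightarrow> 0"
  proof (rule complete)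
    fix e :: real assume "0 < e"
    have "(\<lambda>n. (1/3::real) ^ n) \<longlonglongrightarrow> 0" by (intro LIMSEQ_power_zero) auto
    then have "\<forall>\<^sub>F n in sequentially. (1/3::real) ^ n < e" using \<open>0 < e\<close> by (intro order_tendstoD) auto
    then obtain n where n: "(1/3::real) ^ n < e" by (auto simp: eventually_sequentially)
    have "N (x i - x j) < e" if "Suc n \<le> i" "Suc n \<le> j" for i j
    proof -
      have "N (x i - x j) \<le> N (x i - x (Suc n)) + N (x (Suc n) - x j)" by (intro N_diff_triangle xV)
      also have "\<dots> \<le> (1/3) ^ n / 2 + (1/3) ^ n / 2"
        using xdist'[OF that(1)] xdist'[OF that(2)] by (intro add_mono) (auto simp: N_commute)
      finally show ?thesis using n by simp
    qed
    then show "\<exists>M. \<forall>i\<ge>M. \<forall>j\<ge>M. N (x i - x j) < e" by blast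
  qed (rule xV)
  then obtain z where z: "z \<in> V" "(\<lambda>n. N (x n - z)) \<longlonglongrightarrow> 0" by blast
  have zdist: "N (z - x (Suc n)) \<le> (1/3) ^ n / 2" for n
  proof (rule tendsto_upperbound)
    have "(\<lambda>k. N (x k - x (Suc n) - (z - x (Suc n)))) \<longlonglongrightarrow> 0" using z by simp
    then show "(\<lambda>k. N (x k - x (Suc n))) \<longlonglongrightarrow> N (z - x (Suc n))" using z xV by (intro N_limit) auto
    show "\<forall>\<^sub>F k in sequentially. N (x k - x (Suc n)) \<le> (1/3) ^ n / 2"
      unfolding eventually_sequentially using xdist' by blast
  qed simp
  \<comment> \<open>The term \<open>n\<close> contributes at least 3/4 and the tail removes at most
    1/2 of \<open>q n / 3^n\<close>; the remaining quarter is at least \<open>(4/3)^n / 4\<close>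
    because \<open>q n\<close> is at least \<open>4^n\<close>.\<close>
  have lower: "(4/3) ^ n / 4 \<le> N (L n z)" for n
  proof -
    have "N (L n (x (Suc n))) \<le> N (L n z) + N (L n (x (Suc n)) - L n z)"
      using xV z LV by (intro N_le_diff) auto
    also have "L n (x (Suc n)) - L n z = L n (x (Suc n) - z)" using L_diff xV z by simp
    also have "N (L n (x (Suc n) - z)) \<le> q n * N (x (Suc n) - z)" using xV z by (intro qle) auto
    also have "\<dots> \<le> q n * ((1/3) ^ n / 2)"
      using zdist[of n] qpos[of n] by (intro mult_left_mono) (auto simp: N_commute)
    finally have 1: "N (L n (x (Suc n))) \<le> N (L n z) + q n * ((1/3) ^ n / 2)" by simp
    have "(1/3) ^ n * (3/4 * q n) \<le> (1/3) ^ n * N (L n (y n))"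
      using y(3)[of n] by (intro mult_left_mono) auto
    also have "\<dots> = N (L n (c n))" using y(1)[of n] by (simp add: c_def L_scale)
    finally have "(1/3) ^ n * (3/4 * q n) \<le> N (L n (x (Suc n)))" using xL[of n] by simp
    with 1 have "(1/3) ^ n * q n / 4 \<le> N (L n z)" by (simp add: algebra_simps)
    moreover have "(1/3) ^ n * 4 ^ n \<le> (1/3) ^ n * q n" using q4[of n] by (intro mult_left_mono) auto
    moreover have "(1/3) ^ n * 4 ^ n = (4/3::real) ^ n" by (simp add: power_mult_distrib[symmetric])
    ultimately show ?thesis by simp
  qed
  \<comment> \<open>The times \<open>t n\<close> decrease to 0 in the limit, so strong continuity at
    \<open>z\<close> keeps \<open>N (L n z)\<close> bounded, against the lower bound just
    shown.\<close>
  have "filterlim t (at_right 0) sequentially"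
    unfolding filterlim_at
  proof (intro conjI)
    show "t \<longlonglongrightarrow> 0"
      by (rule Lim_null_comparison[OF _ LIMSEQ_inverse_real_of_nat])
        (use tf(1,2) in \<open>auto intro!: always_eventually less_imp_le simp: inverse_eq_divide abs_of_pos less_imp_le\<close>)
    show "\<forall>\<^sub>F n in sequentially. t n \<in> {0<..} \<and> t n \<noteq> 0"
      using tf(1) by (auto intro!: always_eventually simp: less_imp_neq[symmetric])
  qed
  then have "(\<lambda>n. N (L n z - z)) \<longlonglongrightarrow> 0" unfolding L_def by (rule filterlim_compose[OF S_cont[OF z(1)]])
  then have "\<forall>\<^sub>F n in sequentially. N (L n z - z) < 1" by (rule order_tendstoD) simp
  moreover have "filterlim (\<lambda>n. (4/3::real) ^ n) at_top sequentially" 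
    by (rule filterlim_at_infinity_imp_filterlim_at_top[OF filterlim_realpow_sequentially_gt1]) auto
  then have "\<forall>\<^sub>F n in sequentially. 4 * (N z + 1) < (4/3::real) ^ n" by (simp add: filterlim_at_top_dense)
  ultimately have "\<forall>\<^sub>F n in sequentially. False"
  proof eventually_elim
    case (elim n)
    have "N (L n z) \<le> N z + N (L n z - z)" using z LV by (intro N_le_diff) auto
    then show ?case using elim lower[of n] by simp
  qed
  then show False by simp
qed

end

section \<open>Two semigroups with the same generator\<close>

context m_accretive
begin

text \<open>The bounded operator \<open>S t\<close> can be pulled through the difference quotient of
  \<open>u\<close>, so the quotient of \<open>S t u\<close> converges to \<open>S t (A u)\<close>.
  By \<open>gen'\<close> convergence alone implies membership in \<open>D\<close>.\<close>

lemma semigroup_commutes_generator: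
  fixes S :: "real \<Rightarrow> 'v \<Rightarrow> 'v"
  assumes SV: "\<And>t f. 0 \<le> t \<Longrightarrow> f \<in> V \<Longrightarrow> S t f \<in> V"
    and S_diff: "\<And>t f g. 0 \<le> t \<Longrightarrow> f \<in> V \<Longrightarrow> g \<in> V \<Longrightarrow> S t (f - g) = S t f - S t g"
    and S_scale: "\<And>t f c. 0 \<le> t \<Longrightarrow> f \<in> V \<Longrightarrow> S t (c *\<^sub>R f) = c *\<^sub>R S t f"
    and S_bdd: "\<And>t. 0 \<le> t \<Longrightarrow> \<exists>C. \<forall>f\<in>V. N (S t f) \<le> C * N f"
    and S_add: "\<And>s t f. 0 \<le> s \<Longrightarrow> 0 \<le> t \<Longrightarrow> f \<in> V \<Longrightarrow> S (s + t) f = S s (S t f)"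
    and gen: "\<And>u. u \<in> D \<Longrightarrow> ((\<lambda>t. N ((1/t) *\<^sub>R (u - S t u) - A u)) \<longlongrightarrow> 0) (at_right 0)"
    and gen': "\<And>u v. u \<in> V \<Longrightarrow> v \<in> V \<Longrightarrow> ((\<lambda>t. N ((1/t) *\<^sub>R (u - S t u) - v)) \<longlongrightarrow> 0) (at_right 0) \<Longrightarrow>
      u \<in> D \<and> v = A u"
    and "u \<in> D" "0 \<le> t"
  shows "S t u \<in> D \<and> A (S t u) = S t (A u)"
proof -
  obtain C where C: "\<And>f. f \<in> V \<Longrightarrow> N (S t f) \<le> C * N f" using S_bdd[OF \<open>0 \<le> t\<close>] by blast
  have uV: "u \<in> V" using \<open>u \<in> D\<close> by auto
  have "((\<lambda>h. N ((1/h) *\<^sub>R (S t u - S h (S t u)) - S t (A u))) \<longlongrightarrow> 0) (at_right 0)"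
  proof (rule Lim_null_comparison)
    show "((\<lambda>h. C * N ((1/h) *\<^sub>R (u - S h u) - A u)) \<longlongrightarrow> 0) (at_right 0)"
      by (intro tendsto_mult_right_zero gen \<open>u \<in> D\<close>)
    show "\<forall>\<^sub>F h in at_right 0. norm (N ((1/h) *\<^sub>R (S t u - S h (S t u)) - S t (A u))) \<le> C * N ((1/h) *\<^sub>R (u - S h u) - A u)"
      unfolding eventually_at_right_field
    proof (intro exI[of _ 1] conjI allI impI)
      fix h :: real assume h: "0 < h" "h < 1"
      have "S h (S t u) = S t (S h u)"
        using S_add[of h t u] S_add[of t h u] h assms(9) uV by (simp add: add.commute)
      then have "(1/h) *\<^sub>R (S t u - S h (S t u)) - S t (A u) = S t ((1/h) *\<^sub>R (u - S h u) - A u)"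
        using h \<open>0 \<le> t\<close> uV \<open>u \<in> D\<close> SV by (simp add: S_diff S_scale)
      then show "norm (N ((1/h) *\<^sub>R (S t u - S h (S t u)) - S t (A u))) \<le> C * N ((1/h) *\<^sub>R (u - S h u) - A u)"
        using C[of "(1/h) *\<^sub>R (u - S h u) - A u"] h SV uV \<open>u \<in> D\<close> by simp
    qed simp
  qed
  then show ?thesis using gen'[of "S t u" "S t (A u)"] SV assms(9) uV \<open>u \<in> D\<close> by auto
qed

lemma T_commutes:
  assumes "u \<in> D" "0 \<le> t"
  shows "T t u \<in> D \<and> A (T t u) = T t (A u)"
proof (rule semigroup_commutes_generator[of T])
  show "\<exists>C. \<forall>f\<in>V. N (T t f) \<le> C * N f" if "0 \<le> t" for t
    using T_contraction that by (intro exI[of _ 1]) auto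
  show "u \<in> D \<and> v = A u"
    if "u \<in> V" "v \<in> V" "((\<lambda>t. N ((1/t) *\<^sub>R (u - T t u) - v)) \<longlongrightarrow> 0) (at_right 0)" for u v
    using T_generator_converse[OF that] by simp
qed (simp_all add: T_diff T_scale T_semigroup T_generator assms)

text \<open>The difference \<open>w\<close> of two orbits starting in \<open>D\<close> solves
  \<open>w' = - A w\<close> with \<open>w 0 = 0\<close>. Accretivity of \<open>A\<close> makes its
  norm nonincreasing, so contractivity of \<open>S\<close> is not assumed; a bound for
  \<open>S\<close> on \<open>{0..t}\<close> serves for continuity of \<open>w\<close> and for the
  passage from \<open>D\<close> to \<open>V\<close>.\<close>

theorem semigroup_unique:
  fixes S :: "real \<Rightarrow> 'v \<Rightarrow> 'v"
  assumes SV: "\<And>t f. 0 \<le> t \<Longrightarrow> f \<in> V \<Longrightarrow> S t f \<in> V"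
    and S_diff: "\<And>t f g. 0 \<le> t \<Longrightarrow> f \<in> V \<Longrightarrow> g \<in> V \<Longrightarrow> S t (f - g) = S t f - S t g"
    and S_scale: "\<And>t f c. 0 \<le> t \<Longrightarrow> f \<in> V \<Longrightarrow> S t (c *\<^sub>R f) = c *\<^sub>R S t f"
    and S_bdd: "\<And>t. 0 \<le> t \<Longrightarrow> \<exists>C. \<forall>f\<in>V. N (S t f) \<le> C * N f"
    and S_0: "\<And>f. f \<in> V \<Longrightarrow> S 0 f = f"
    and S_add: "\<And>s t f. 0 \<le> s \<Longrightarrow> 0 \<le> t \<Longrightarrow> f \<in> V \<Longrightarrow> S (s + t) f = S s (S t f)"
    and S_cont: "\<And>f. f \<in> V \<Longrightarrow> ((\<lambda>t. N (S t f - f)) \<longlongrightarrow> 0) (at_right 0)"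
    and gen: "\<And>u. u \<in> D \<Longrightarrow> ((\<lambda>t. N ((1/t) *\<^sub>R (u - S t u) - A u)) \<longlongrightarrow> 0) (at_right 0)"
    and gen': "\<And>u v. u \<in> V \<Longrightarrow> v \<in> V \<Longrightarrow> ((\<lambda>t. N ((1/t) *\<^sub>R (u - S t u) - v)) \<longlongrightarrow> 0) (at_right 0) \<Longrightarrow>
      u \<in> D \<and> v = A u"
    and f: "f \<in> V" and t: "0 \<le> t"
  shows "S t f = T t f"
proof -
  have comm: "S s u \<in> D \<and> A (S s u) = S s (A u)" if "u \<in> D" "0 \<le> s" for s u
    by (rule semigroup_commutes_generator[of S]) (fact SV S_diff S_scale S_bdd S_add gen gen' that)+
  obtain d M0 where d: "0 < d" and M0: "\<And>s g. 0 < s \<Longrightarrow> s < d \<Longrightarrow> g \<in> V \<Longrightarrow> N (S s g) \<le> M0 * N g"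
  proof -
    have "\<exists>d>0. \<exists>M. \<forall>s. 0 < s \<and> s < d \<longrightarrow> (\<forall>g\<in>V. N (S s g) \<le> M * N g)"
      by (rule uniformly_bounded_near_0[of S]) (fact SV S_diff S_scale S_bdd S_cont)+
    then show ?thesis using that by blast
  qed
  \<comment> \<open>A bound of at least 1 also covers time 0, where \<open>S 0\<close> is the
    identity.\<close>
  define M where "M = max M0 1"
  have M: "N (S s g) \<le> M * N g" if "0 \<le> s" "s < d" "g \<in> V" for s g
  proof (cases "s = 0")
    case True
    have "1 * N g \<le> M * N g" by (intro mult_right_mono) (auto simp: M_def)
    then show ?thesis using True S_0 that by simp
  next
    case False
    then have "N (S s g) \<le> M0 * N g" using that by (intro M0) auto
    also have "\<dots> \<le> M * N g" by (intro mult_right_mono) (auto simp: M_def)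
    finally show ?thesis .
  qed
  have Mn: "N (S (real n * s) g) \<le> M ^ n * N g" if "0 \<le> s" "s < d" "g \<in> V" for n s g
  proof (induction n)
    case (Suc n)
    have "N (S (real (Suc n) * s) g) = N (S s (S (real n * s) g))"
      using S_add[of s "real n * s" g] that by (simp add: algebra_simps)
    also have "\<dots> \<le> M * N (S (real n * s) g)" using SV that by (intro M) auto
    also have "\<dots> \<le> M * (M ^ n * N g)" using Suc by (intro mult_left_mono) (auto simp: M_def)
    finally show ?case by (simp add: mult_ac)
  qed (use S_0 that in auto)
  \<comment> \<open>Dividing a time up to \<open>t\<close> into \<open>n\<close> equal pieces makes
    each piece shorter than \<open>d\<close>, where the bound \<open>M\<close> applies.\<close>
  obtain n where n: "t / d < real n" using reals_Archimedean2 by blast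
  then have n0: "0 < real n" using t d by (meson divide_nonneg_pos le_less_trans)
  define K where "K = M ^ n"
  have K: "N (S s g) \<le> K * N g" if "0 \<le> s" "s \<le> t" "g \<in> V" for s g
  proof -
    have "s / real n < d" using n n0 d that by (simp add: field_simps)
    then show ?thesis using Mn[of "s / real n" g n] that n0 by (simp add: K_def)
  qed
  have K1: "1 \<le> K" unfolding K_def M_def by simp
  have main: "S t u = T t u" if u: "u \<in> D" for u
  proof -
    have uV: "u \<in> V" using u by auto
    define w where "w s = S s u - T s u" for s
    have wV: "w s \<in> V" if "0 \<le> s" for s using SV uV that by (simp add: w_def)
    define r where "r h = K * N (S h u - u) + N (T h u - u)" for h
    have r_lim: "(r \<longlongrightarrow> 0) (at_right 0)"
      using tendsto_add[OF tendsto_mult_right_zero[OF S_cont[OF uV], of K] T_continuous[OF uV]]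
      by (simp add: r_def[abs_def])
    \<comment> \<open>The bound depends on \<open>h\<close> but not on \<open>a\<close>. Hence it
      controls increments to the left as well, which right continuity at each single point would
      not.\<close>
    have w_diff: "N (w (a + h) - w a) \<le> r h" if "0 \<le> a" "0 \<le> h" "a + h \<le> t" for a h
    proof -
      have "w (a + h) - w a = S a (S h u - u) - T a (T h u - u)"
        using that uV SV by (simp add: w_def S_add S_diff T_diff T_semigroup)
      also have "N \<dots> \<le> N (S a (S h u - u)) + N (T a (T h u - u))"
        using that uV SV by (intro N_diff_le) auto
      also have "\<dots> \<le> r h" unfolding r_def
        using that uV SV by (intro add_mono K T_contraction) auto
      finally show ?thesis .
    qed
    have "N (w t) \<le> 0"
    proof (rule nonpos_of_right_derivative_nonpos[OF t])
      show "N (w 0) \<le> 0" using uV by (simp add: w_def S_0)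
      show "continuous_on {0..t} (\<lambda>s. N (w s))"
        unfolding continuous_on_iff
      proof (intro ballI allI impI)
        fix a e :: real assume a: "a \<in> {0..t}" and e: "0 < e"
        obtain b where b: "0 < b" "\<And>h. 0 < h \<Longrightarrow> h < b \<Longrightarrow> r h < e"
          using order_tendstoD(2)[OF r_lim e] by (auto simp: eventually_at_right_field)
        have *: "\<bar>N (w y) - N (w x)\<bar> < e" if "0 \<le> x" "x < y" "y \<le> t" "y - x < b" for x y
          using abs_N_diff_le[of "w y" "w x"] w_diff[of x "y - x"] b(2)[of "y - x"] wV that by fastforce
        have "dist (N (w x)) (N (w a)) < e" if "x \<in> {0..t}" "dist x a < b" for x
          using *[of x a] *[of a x] that a e by (cases x a rule: linorder_cases) (auto simp: dist_real_def abs_minus_commute)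
        then show "\<exists>d>0. \<forall>x'\<in>{0..t}. dist x' a < d \<longrightarrow> dist (N (w x')) (N (w a)) < e" using b(1) by blast
      qed
    next
      fix s e :: real assume s: "0 \<le> s" "s < t" "0 < e"
      have Su: "S s u \<in> D" "A (S s u) = S s (A u)" and Tu: "T s u \<in> D" "A (T s u) = T s (A u)"
        using comm[of u s] T_commutes[of u s] s u by auto
      define R where "R h = N ((1/h) *\<^sub>R (S s u - S h (S s u)) - A (S s u)) + N ((1/h) *\<^sub>R (T s u - T h (T s u)) - A (T s u))
        + (N (S h (S s (A u)) - S s (A u)) + N (T h (T s (A u)) - T s (A u)))" for h
      have "((\<lambda>h. R h) \<longlongrightarrow> 0 + 0 + (0 + 0)) (at_right 0)" unfolding R_def
        by (intro tendsto_add gen T_generator Su Tu S_cont T_continuous SV T_V A_V u s)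
      then have "\<forall>\<^sub>F h in at_right 0. R h < e" using s by (intro order_tendstoD) auto
      then obtain b where b: "0 < b" "\<And>h. 0 < h \<Longrightarrow> h < b \<Longrightarrow> R h < e" by (auto simp: eventually_at_right_field)
      have "N (w (s + h)) \<le> N (w s) + e * h" if h: "0 < h" "h < b" for h
      proof -
        have wD: "w (s + h) \<in> D" and Aw: "A (w (s + h)) = S h (S s (A u)) - T h (T s (A u))"
          using comm[of u "s + h"] T_commutes[of u "s + h"] s u h S_add[of h s "A u"] T_semigroup[of "A u" h s]
          by (auto simp: w_def A_diff add.commute)
        have wsh: "w (s + h) = S h (S s u) - T h (T s u)"
          using s h uV S_add[of h s u] T_semigroup[of u h s] by (simp add: w_def add.commute)
        define p1 where "p1 = (1/h) *\<^sub>R (S s u - S h (S s u)) - A (S s u)"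
        define p2 where "p2 = (1/h) *\<^sub>R (T s u - T h (T s u)) - A (T s u)"
        define p3 where "p3 = S h (S s (A u)) - S s (A u)"
        define p4 where "p4 = T h (T s (A u)) - T s (A u)"
        have pV: "p1 \<in> V" "p2 \<in> V" "p3 \<in> V" "p4 \<in> V"
          using SV u uV s h Su Tu by (auto simp: p1_def p2_def p3_def p4_def)
        have e1: "S h (S s u) = S s u - h *\<^sub>R (p1 + A (S s u))" and e2: "T h (T s u) = T s u - h *\<^sub>R (p2 + A (T s u))"
          using h by (simp_all add: p1_def p2_def)
        \<comment> \<open>A backward Euler step up to errors that vanish with \<open>h\<close>:
          evaluating \<open>A\<close> at the new time \<open>s + h\<close> is what allows
          accretivity to compare \<open>w (s + h)\<close> with \<open>w s\<close>.\<close>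
        have "w (s + h) + h *\<^sub>R A (w (s + h)) = w s + h *\<^sub>R ((p2 - p1) + (p3 - p4))"
        proof -
          have "w (s + h) = (S s u - h *\<^sub>R (p1 + A (S s u))) - (T s u - h *\<^sub>R (p2 + A (T s u)))"
            by (simp only: wsh e1 e2)
          then show ?thesis unfolding Aw by (simp add: w_def Su Tu p3_def p4_def algebra_simps)
        qed
        then have "N (w (s + h)) \<le> N (w s + h *\<^sub>R ((p2 - p1) + (p3 - p4)))"
          using accretive[OF wD h(1)] by simp
        also have "\<dots> \<le> N (w s) + h * N ((p2 - p1) + (p3 - p4))"
          using N_triangle[of "w s" "h *\<^sub>R ((p2 - p1) + (p3 - p4))"] wV[of s] s pV h by simp
        also have "N ((p2 - p1) + (p3 - p4)) \<le> R h"
          using N_triangle[of "p2 - p1" "p3 - p4"] N_diff_le[of p2 p1] N_diff_le[of p3 p4] pV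
          unfolding R_def p1_def[symmetric] p2_def[symmetric] p3_def[symmetric] p4_def[symmetric] by simp
        also have "R h \<le> e" using b(2)[OF h] by simp
        finally show ?thesis using h by (simp add: mult_left_mono mult.commute)
      qed
      then show "\<exists>d>0. \<forall>h. 0 < h \<and> h < d \<longrightarrow> N (w (s + h)) \<le> N (w s) + e * h" using b(1) by blast
    qed
    then have "w t = 0" using N_zeroD[OF wV[OF t]] N_nonneg[of "w t"] by simp
    then show ?thesis by (simp add: w_def)
  qed
  show ?thesis
  proof (rule N_eqI)
    fix e :: real assume e: "0 < e"
    then obtain u where u: "u \<in> D" "N (f - u) < e / (K + 1)" using dense[OF f, of "e / (K + 1)"] K1 by auto
    have uV: "u \<in> V" using u by auto
    have "S t f - T t f = S t (f - u) - T t (f - u)"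
      using main[OF u(1)] f uV t by (simp add: S_diff T_diff)
    also have "N \<dots> \<le> N (S t (f - u)) + N (T t (f - u))" using f uV t SV by (intro N_diff_le) auto
    also have "\<dots> \<le> K * N (f - u) + N (f - u)" using f uV t by (intro add_mono K T_contraction) auto
    also have "\<dots> \<le> e" using u K1 by (simp add: field_simps)
    finally show "N (S t f - T t f) \<le> e" .
  qed (use SV f t in auto)
qed

end

section \<open>Lebesgue spaces\<close>

lemma infsum_le_of_finite_sums:
  fixes f :: "'a \<Rightarrow> real"
  assumes "\<And>x. 0 \<le> f x" "\<And>F. finite F \<Longrightarrow> sum f F \<le> C"
  shows "f summable_on UNIV" and "infsum f UNIV \<le> C"
proof -
  show "f summable_on UNIV"
    using assms by (intro nonneg_bdd_above_summable_on) (auto simp: bdd_above_def)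
  then show "infsum f UNIV \<le> C" using assms by (intro infsum_le_finite_sums)
qed

lemma infsum_fatou:
  fixes f :: "'b \<Rightarrow> 'a \<Rightarrow> real"
  assumes "\<forall>\<^sub>F n in G. f n summable_on UNIV \<and> infsum (f n) UNIV \<le> C" "G \<noteq> bot"
    and "\<And>n x. 0 \<le> f n x" "\<And>x. ((\<lambda>n. f n x) \<longlongrightarrow> g x) G"
  shows "g summable_on UNIV" and "infsum g UNIV \<le> C"
proof -
  have g0: "0 \<le> g x" for x using assms by (intro tendsto_lowerbound[of "\<lambda>n. f n x"]) auto
  have le: "sum g F \<le> C" if "finite F" for F
  proof (rule tendsto_upperbound)
    show "((\<lambda>n. sum (f n) F) \<longlongrightarrow> sum g F) G" by (intro tendsto_sum assms)
    show "\<forall>\<^sub>F n in G. sum (f n) F \<le> C"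
      using assms(1)
      by eventually_elim (use assms(3) that in \<open>auto intro: order_trans[OF finite_sum_le_infsum]\<close>)
  qed fact
  then show "g summable_on UNIV" "infsum g UNIV \<le> C" using infsum_le_of_finite_sums[OF g0 le] by auto
qed

text \<open>A finite set carries the sum of the majorant up to \<open>e/3\<close>. On it convergence
  is a finite matter, and outside both sums are below \<open>e/3\<close>.\<close>

lemma infsum_dominated_convergence:
  fixes f :: "nat \<Rightarrow> 'a \<Rightarrow> real"
  assumes h: "h summable_on UNIV" and le: "\<And>n x. \<bar>f n x\<bar> \<le> h x"
    and lim: "\<And>x. (\<lambda>n. f n x) \<longlonglongrightarrow> g x"
  shows "g summable_on UNIV" and "(\<lambda>n. infsum (f n) UNIV) \<longlonglongrightarrow> infsum g UNIV"
proof -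
  have gle: "\<bar>g x\<bar> \<le> h x" for x
    by (rule tendsto_upperbound[OF tendsto_rabs[OF lim]]) (use le in auto)
  have h0: "0 \<le> h x" for x using le[of 0 x] by linarith
  have sum: "k summable_on A" if "\<And>x. \<bar>k x\<bar> \<le> h x" for k :: "'a \<Rightarrow> real" and A
    using summable_on_comparison_test[OF summable_on_subset_banach[OF h], of A "\<lambda>x. \<bar>k x\<bar>"] that
      summable_on_iff_abs_summable_on_real by fastforce
  show "g summable_on UNIV" by (rule sum) (rule gle)
  have bound: "\<bar>infsum k (- F)\<bar> \<le> infsum h (- F)" if "\<And>x. \<bar>k x\<bar> \<le> h x" for k :: "'a \<Rightarrow> real" and F
  proof -
    have "\<bar>infsum k (- F)\<bar> \<le> infsum (\<lambda>x. \<bar>k x\<bar>) (- F)"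
      using norm_infsum_bound[of k "- F"] sum[of k, OF that] summable_on_iff_abs_summable_on_real[of k "- F"] by simp
    also have "\<dots> \<le> infsum h (- F)"
      using that h0 by (intro infsum_mono sum) (auto)
    finally show ?thesis .
  qed
  have split: "infsum k UNIV = sum k F + infsum k (- F)" if "\<And>x. \<bar>k x\<bar> \<le> h x" "finite F" for k :: "'a \<Rightarrow> real" and F
    using infsum_Un_disjoint[of k F "- F"] sum[of k, OF that(1)] that(2) by (simp add: Compl_partition)
  show "(\<lambda>n. infsum (f n) UNIV) \<longlonglongrightarrow> infsum g UNIV"
  proof (rule tendstoI)
    fix e :: real assume e: "0 < e"
    have "(sum h \<longlongrightarrow> infsum h UNIV) (finite_subsets_at_top UNIV)" by (rule infsum_tendsto[OF h])
    then have "\<forall>\<^sub>F F in finite_subsets_at_top UNIV. infsum h UNIV - e/3 < sum h F"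
      using e by (intro order_tendstoD) auto
    then obtain F where F: "finite F" "infsum h UNIV - e/3 < sum h F"
      by (auto simp: eventually_finite_subsets_at_top)
    have tail: "infsum h (- F) < e/3" using split[of h F] F h0 by simp
    have "(\<lambda>n. sum (f n) F) \<longlonglongrightarrow> sum g F" by (intro tendsto_sum lim)
    then have "\<forall>\<^sub>F n in sequentially. dist (sum (f n) F) (sum g F) < e/3" using e by (intro tendstoD) auto
    then show "\<forall>\<^sub>F n in sequentially. dist (infsum (f n) UNIV) (infsum g UNIV) < e"
    proof eventually_elim
      case (elim n)
      have "infsum (f n) UNIV = sum (f n) F + infsum (f n) (- F)" "infsum g UNIV = sum g F + infsum g (- F)"
        using split[OF le F(1)] split[of g, OF gle F(1)] by auto
      moreover have "\<bar>infsum (f n) (- F)\<bar> \<le> infsum h (- F)" "\<bar>infsum g (- F)\<bar> \<le> infsum h (- F)"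
        using bound[OF le] bound[of g, OF gle] by auto
      ultimately show ?case using elim tail unfolding dist_real_def by linarith
    qed
  qed
qed

lemma summable_on_comparison_abs:
  fixes f g :: "'a \<Rightarrow> real"
  assumes "g summable_on A" "\<And>x. x \<in> A \<Longrightarrow> \<bar>f x\<bar> \<le> g x"
  shows "f summable_on A"
proof -
  have "(\<lambda>x. \<bar>f x\<bar>) summable_on A"
    by (rule summable_on_comparison_test[OF assms(1)]) (use assms in auto)
  then show ?thesis using summable_on_iff_abs_summable_on_real[of f A] by simp
qed

lemma abs_infsum_le:
  fixes f g :: "'a \<Rightarrow> real"
  assumes "g summable_on A" "\<And>x. x \<in> A \<Longrightarrow> \<bar>f x\<bar> \<le> g x"
  shows "\<bar>infsum f A\<bar> \<le> infsum g A"
proof -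
  have f: "(\<lambda>x. \<bar>f x\<bar>) summable_on A"
    by (rule summable_on_comparison_abs[OF assms(1)]) (use assms in auto)
  then have "\<bar>infsum f A\<bar> \<le> infsum (\<lambda>x. \<bar>f x\<bar>) A"
    using norm_infsum_bound[of f A] by simp
  also have "\<dots> \<le> infsum g A" using assms by (intro infsum_mono f)
  finally show ?thesis .
qed

subsection \<open>Inequalities for powers\<close>

lemma Young_powr:
  fixes a b p :: real
  assumes "1 < p" "0 \<le> a" "0 \<le> b"
  shows "p * (a * b powr (p - 1)) \<le> a powr p + (p - 1) * b powr p"
proof -
  define q where "q = p / (p - 1)"
  have q: "1 < q" "1 / p + 1 / q = 1" "(p - 1) * q = p" using assms by (auto simp: q_def field_simps)
  have "a * b powr (p - 1) \<le> a powr p / p + (b powr (p - 1)) powr q / q"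
    using assms q by (intro Youngs_inequality) auto
  also have "(b powr (p - 1)) powr q = b powr p" by (simp add: powr_powr q)
  also have "a powr p / p + b powr p / q = (a powr p + (p - 1) * b powr p) / p"
    using assms by (simp add: q_def field_simps)
  finally show ?thesis using assms by (simp add: field_simps)
qed

text \<open>Young's inequality rearranged: \<open>p * b powr (p - 1)\<close> is the slope of the
  p-th power at \<open>b\<close>.\<close>

lemma powr_tangent:
  fixes a b p :: real
  assumes "1 < p" "0 \<le> a" "0 \<le> b"
  shows "b powr p + p * (a - b) * b powr (p - 1) \<le> a powr p"
proof -
  have b: "b * b powr (p - 1) = b powr p" using assms by (cases "b = 0") (auto simp: powr_mult_base)
  have "p * (a - b) * b powr (p - 1) = p * (a * b powr (p - 1)) - p * (b * b powr (p - 1))"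
    "(p - 1) * b powr p = p * b powr p - b powr p"
    by (simp_all add: algebra_simps)
  then show ?thesis using Young_powr[OF assms] unfolding b by linarith
qed

text \<open>The weighted sum of the two tangent inequalities at the convex combination; the linear
  terms cancel.\<close>

lemma powr_convex_combination:
  fixes a b p :: real
  assumes "1 < p" "0 \<le> x" "0 \<le> y" "0 \<le> s" "0 \<le> t" "s + t = 1"
  shows "(s * x + t * y) powr p \<le> s * x powr p + t * y powr p"
proof -
  let ?c = "s * x + t * y"
  have "s * (?c powr p + p * (x - ?c) * ?c powr (p - 1)) + t * (?c powr p + p * (y - ?c) * ?c powr (p - 1))
      \<le> s * x powr p + t * y powr p"
    using assms by (intro add_mono mult_left_mono powr_tangent) auto
  also have "s * (?c powr p + p * (x - ?c) * ?c powr (p - 1)) + t * (?c powr p + p * (y - ?c) * ?c powr (p - 1))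
    = (s + t) * ?c powr p + p * (s * x + t * y - (s + t) * ?c) * ?c powr (p - 1)"
    by (simp add: algebra_simps)
  finally show ?thesis using assms by simp
qed

text \<open>Replacing the smaller of the two numbers by the larger one suffices here, and no
  constant depending on \<open>p\<close> appears.\<close>

lemma mult_powr_le:
  fixes a b p :: real
  assumes "1 < p" "0 \<le> a" "0 \<le> b"
  shows "a * b powr (p - 1) \<le> a powr p + b powr p"
proof (cases "a \<le> b")
  case True
  then have "a * b powr (p - 1) \<le> b * b powr (p - 1)" by (intro mult_right_mono) auto
  also have "\<dots> = b powr p" using assms by (cases "b = 0") (auto simp: powr_mult_base)
  finally show ?thesis by (simp add: add_increasing)
next
  case False
  then have "a * b powr (p - 1) \<le> a * a powr (p - 1)" using assms by (intro mult_left_mono powr_mono2) auto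
  also have "\<dots> = a powr p" using assms by (cases "a = 0") (auto simp: powr_mult_base)
  finally show ?thesis by (simp add: add_increasing2)
qed

lemma powr_add_le:
  fixes a b p :: real
  assumes "0 < p" "0 \<le> a" "0 \<le> b"
  shows "(a + b) powr p \<le> 2 powr p * (a powr p + b powr p)"
proof -
  have "(a + b) powr p \<le> (2 * max a b) powr p" using assms by (intro powr_mono2) auto
  also have "\<dots> = 2 powr p * max a b powr p" using assms by (simp add: powr_mult)
  also have "\<dots> \<le> 2 powr p * (a powr p + b powr p)"
    by (intro mult_left_mono) (auto simp: max_def)
  finally show ?thesis .
qed

subsection \<open>The spaces\<close>

locale lp =
  fixes m :: "'a \<Rightarrow> real" and p :: real
  assumes m_pos: "\<And>x. 0 < m x" and p: "1 < p"
begin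

abbreviation "V \<equiv> lp_space m p"
abbreviation "N \<equiv> lp_norm m p"

lemma lp_nonneg [simp]: "0 \<le> N f" by (simp add: lp_norm_def)

lemma m_nonneg [simp]: "0 \<le> m x" using m_pos[of x] by simp

lemma infsum_powr_nonneg [simp]: "0 \<le> (\<Sum>\<^sub>\<infinity>x. \<bar>f x\<bar> powr p * m x)"
  by (intro infsum_nonneg) auto

lemma lp_norm_powr: "N f powr p = (\<Sum>\<^sub>\<infinity>x. \<bar>f x\<bar> powr p * m x)"
  using p by (simp add: lp_norm_def powr_powr)

lemma lp_norm_leI: assumes "(\<Sum>\<^sub>\<infinity>x. \<bar>f x\<bar> powr p * m x) \<le> c powr p" "0 \<le> c" shows "N f \<le> c"
proof -
  have "N f powr p \<le> c powr p" using assms by (simp add: lp_norm_powr)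
  then show ?thesis using assms p by (meson lp_nonneg not_le powr_less_mono2 less_trans zero_less_one)
qed

lemma lp_spaceD: "f \<in> V \<Longrightarrow> (\<lambda>x. \<bar>f x\<bar> powr p * m x) summable_on UNIV"
  by (simp add: lp_space_def)

lemma lp_space_comparison:
  assumes "g \<in> V" "\<And>x. \<bar>f x\<bar> \<le> \<bar>g x\<bar>"
  shows "f \<in> V" "N f \<le> N g"
proof -
  have le: "\<bar>f x\<bar> powr p * m x \<le> \<bar>g x\<bar> powr p * m x" for x
    using assms p by (intro mult_right_mono powr_mono2) auto
  show f: "f \<in> V" unfolding lp_space_def mem_Collect_eq
    by (rule summable_on_comparison_test[OF lp_spaceD[OF assms(1)]]) (use le in auto)
  have "(\<Sum>\<^sub>\<infinity>x. \<bar>f x\<bar> powr p * m x) \<le> (\<Sum>\<^sub>\<infinity>x. \<bar>g x\<bar> powr p * m x)"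
    by (intro infsum_mono lp_spaceD assms f le)
  then show "N f \<le> N g" by (intro lp_norm_leI) (auto simp: lp_norm_powr)
qed

lemma lp_space_scale: "f \<in> V \<Longrightarrow> (\<lambda>x. c * f x) \<in> V"
  by (auto simp: lp_space_def abs_mult powr_mult mult.assoc intro!: summable_on_cmult_right)

lemma lp_norm_scale: "N (\<lambda>x. c * f x) = \<bar>c\<bar> * N f"
  using p by (simp add: lp_norm_def abs_mult powr_mult mult.assoc infsum_cmult_right' powr_powr)

lemma lp_space_add: assumes "f \<in> V" "g \<in> V" shows "(\<lambda>x. f x + g x) \<in> V"
proof -
  have "(\<lambda>x. 2 powr p * (\<bar>f x\<bar> powr p * m x + \<bar>g x\<bar> powr p * m x)) summable_on UNIV"
    using assms by (intro summable_on_cmult_right summable_on_add) (auto simp: lp_space_def)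
  then show ?thesis unfolding lp_space_def mem_Collect_eq
  proof (rule summable_on_comparison_test)
    fix x
    have "\<bar>f x + g x\<bar> powr p \<le> (\<bar>f x\<bar> + \<bar>g x\<bar>) powr p" using p by (intro powr_mono2) auto
    also have "\<dots> \<le> 2 powr p * (\<bar>f x\<bar> powr p + \<bar>g x\<bar> powr p)" using p by (intro powr_add_le) auto
    finally show "\<bar>f x + g x\<bar> powr p * m x \<le> 2 powr p * (\<bar>f x\<bar> powr p * m x + \<bar>g x\<bar> powr p * m x)"
      using mult_right_mono[OF _ m_nonneg[of x]] by (fastforce simp: algebra_simps)
  qed simp
qed

lemma lp_space_diff: "f \<in> V \<Longrightarrow> g \<in> V \<Longrightarrow> (\<lambda>x. f x - g x) \<in> V"
  using lp_space_add[of f "\<lambda>x. (-1) * g x"] lp_space_scale[of g "-1"] by simp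

lemma lp_pointwise: assumes "f \<in> V" shows "\<bar>f x\<bar> powr p * m x \<le> N f powr p"
  using finite_sum_le_infsum[OF lp_spaceD[OF assms], of "{x}"] by (simp add: lp_norm_powr)

lemma lp_norm_eq_0: assumes "f \<in> V" "N f = 0" shows "f x = 0"
proof -
  have "\<bar>f x\<bar> powr p * m x \<le> 0" using lp_pointwise[OF assms(1), of x] assms by simp
  then show ?thesis using m_pos[of x] p by (auto simp: mult_le_0_iff)
qed

lemma lp_pointwise_le: assumes "f \<in> V" shows "\<bar>f x\<bar> \<le> N f / m x powr (1 / p)"
proof -
  have "\<bar>f x\<bar> * m x powr (1/p) = (\<bar>f x\<bar> powr p * m x) powr (1/p)"
    using p by (simp add: powr_mult powr_powr)
  also have "\<dots> \<le> (N f powr p) powr (1/p)"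
    using p lp_pointwise[OF assms, of x] by (intro powr_mono2) auto
  also have "\<dots> = N f" using p by (simp add: powr_powr)
  finally show ?thesis using m_pos[of x] by (simp add: field_simps)
qed

text \<open>Every point has positive mass, so norm convergence implies pointwise convergence for
  each exponent. This makes limits in different L^p spaces comparable.\<close>

lemma lp_pointwise_tendsto:
  assumes "\<And>n. (\<lambda>x. f n x - g x) \<in> V" "((\<lambda>n. N (\<lambda>x. f n x - g x)) \<longlongrightarrow> 0) G"
  shows "((\<lambda>n. f n x) \<longlongrightarrow> g x) G"
proof -
  have "((\<lambda>n. N (\<lambda>x. f n x - g x) / m x powr (1 / p)) \<longlongrightarrow> 0) G"
    by (rule tendsto_divide_zero[OF assms(2)])
  then have "((\<lambda>n. f n x - g x) \<longlongrightarrow> 0) G"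
    by (rule Lim_null_comparison[rotated]) (use lp_pointwise_le[OF assms(1)] in \<open>auto intro!: always_eventually\<close>)
  then show ?thesis by (simp add: LIM_zero_iff)
qed

text \<open>Minkowski's inequality from convexity: with norms \<open>a\<close> and \<open>b\<close>,
  the sum is \<open>a + b\<close> times the convex combination of \<open>f / a\<close> and
  \<open>g / b\<close> with weights \<open>a / (a + b)\<close> and
  \<open>b / (a + b)\<close>.\<close>

lemma lp_norm_triangle: assumes f: "f \<in> V" and g: "g \<in> V" shows "N (\<lambda>x. f x + g x) \<le> N f + N g"
proof -
  consider "N f = 0" | "N g = 0" | "0 < N f" "0 < N g" using lp_nonneg[of f] lp_nonneg[of g] by linarith
  then show ?thesis
  proof cases
    case 1
    then show ?thesis using lp_norm_eq_0[OF f] by simp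
  next
    case 2
    then show ?thesis using lp_norm_eq_0[OF g] by simp
  next
    case 3
    define a b where "a = N f" and "b = N g"
    have ab: "0 < a" "0 < b" using 3 by (auto simp: a_def b_def)
    have le: "\<bar>f x + g x\<bar> powr p * m x \<le>
      (a + b) powr p * (a / (a + b) * ((\<bar>f x\<bar> powr p * m x) / a powr p) + b / (a + b) * ((\<bar>g x\<bar> powr p * m x) / b powr p))" for x
    proof -
      have "\<bar>f x + g x\<bar> powr p \<le> (\<bar>f x\<bar> + \<bar>g x\<bar>) powr p" using p by (intro powr_mono2) auto
      also have "\<bar>f x\<bar> + \<bar>g x\<bar> = (a + b) * (a / (a + b) * (\<bar>f x\<bar> / a) + b / (a + b) * (\<bar>g x\<bar> / b))"
        using ab unfolding distrib_left by simp
      also have "\<dots> powr p = (a + b) powr p * (a / (a + b) * (\<bar>f x\<bar> / a) + b / (a + b) * (\<bar>g x\<bar> / b)) powr p"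
        using ab by (intro powr_mult)
      also have "\<dots> \<le> (a + b) powr p * (a / (a + b) * (\<bar>f x\<bar> / a) powr p + b / (a + b) * (\<bar>g x\<bar> / b) powr p)"
        using ab p by (intro mult_left_mono powr_convex_combination) (auto simp flip: add_divide_distrib)
      finally have "\<bar>f x + g x\<bar> powr p * m x \<le>
        (a + b) powr p * (a / (a + b) * (\<bar>f x\<bar> / a) powr p + b / (a + b) * (\<bar>g x\<bar> / b) powr p) * m x"
        by (intro mult_right_mono) auto
      then show ?thesis using ab by (simp add: powr_divide algebra_simps)
    qed
    have sf: "(\<lambda>x. a / (a + b) * ((\<bar>f x\<bar> powr p * m x) / a powr p)) summable_on UNIV"
      and sg: "(\<lambda>x. b / (a + b) * ((\<bar>g x\<bar> powr p * m x) / b powr p)) summable_on UNIV"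
      using lp_spaceD[OF f] lp_spaceD[OF g] unfolding divide_inverse
      by (auto intro!: summable_on_cmult_right summable_on_cmult_left)
    have "(\<Sum>\<^sub>\<infinity>x. \<bar>f x + g x\<bar> powr p * m x) \<le> (\<Sum>\<^sub>\<infinity>x. (a + b) powr p *
      (a / (a + b) * ((\<bar>f x\<bar> powr p * m x) / a powr p) + b / (a + b) * ((\<bar>g x\<bar> powr p * m x) / b powr p)))"
      by (intro infsum_mono lp_spaceD lp_space_add f g le summable_on_cmult_right summable_on_add sf sg)
    also have "\<dots> = (a + b) powr p * (a / (a + b) * ((\<Sum>\<^sub>\<infinity>x. \<bar>f x\<bar> powr p * m x) / a powr p)
        + b / (a + b) * ((\<Sum>\<^sub>\<infinity>x. \<bar>g x\<bar> powr p * m x) / b powr p))"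
      using infsum_add[OF sf sg] by (simp add: infsum_cmult_right' infsum_cmult_left' divide_inverse del: infsum_powr_nonneg)
    also have "\<dots> = (a + b) powr p * (a / (a + b) + b / (a + b))"
      using ab by (simp flip: lp_norm_powr add: a_def b_def)
    also have "\<dots> = (a + b) powr p" using ab by (simp flip: add_divide_distrib)
    finally show ?thesis unfolding a_def b_def by (rule lp_norm_leI) simp
  qed
qed

lemma lp_fatou:
  fixes X :: "'b \<Rightarrow> 'a \<Rightarrow> real"
  assumes "\<forall>\<^sub>F n in G. X n \<in> V \<and> N (X n) \<le> c" "G \<noteq> bot" "0 \<le> c" "\<And>x. ((\<lambda>n. X n x) \<longlongrightarrow> g x) G"
  shows "g \<in> V" and "N g \<le> c"
proof -
  have ev: "\<forall>\<^sub>F n in G. (\<lambda>x. \<bar>X n x\<bar> powr p * m x) summable_on UNIV \<and> (\<Sum>\<^sub>\<infinity>x. \<bar>X n x\<bar> powr p * m x) \<le> c powr p"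
    using assms(1)
    by eventually_elim (use p in \<open>auto simp: lp_spaceD powr_mono2 simp flip: lp_norm_powr\<close>)
  have lim: "((\<lambda>n. \<bar>X n x\<bar> powr p * m x) \<longlongrightarrow> \<bar>g x\<bar> powr p * m x) G" for x
    using p by (intro tendsto_intros tendsto_powr2 assms) auto
  show "g \<in> V" using infsum_fatou(1)[OF ev assms(2) _ lim] by (simp add: lp_space_def)
  show "N g \<le> c" using infsum_fatou(2)[OF ev assms(2) _ lim] assms by (intro lp_norm_leI) auto
qed

text \<open>Pointwise limits exist because evaluation is bounded; Fatou in the second index turns
  the Cauchy condition into norm convergence.\<close>

lemma lp_complete:
  assumes X: "\<And>n. X n \<in> V" and Cauchy: "\<And>e. 0 < e \<Longrightarrow> \<exists>M. \<forall>i\<ge>M. \<forall>j\<ge>M. N (\<lambda>x. X i x - X j x) < e"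
  shows "\<exists>l\<in>V. (\<lambda>n::nat. N (\<lambda>x. X n x - l x)) \<longlonglongrightarrow> 0"
proof -
  have "Cauchy (\<lambda>n. X n x)" for x
    unfolding Cauchy_def
  proof (intro allI impI)
    fix e :: real assume "0 < e"
    then obtain M where M: "\<And>i j. i \<ge> M \<Longrightarrow> j \<ge> M \<Longrightarrow> N (\<lambda>x. X i x - X j x) < e * m x powr (1/p)"
      using Cauchy[of "e * m x powr (1/p)"] m_pos[of x] by auto
    have "dist (X i x) (X j x) < e" if "i \<ge> M" "j \<ge> M" for i j
    proof -
      have "\<bar>X i x - X j x\<bar> \<le> N (\<lambda>x. X i x - X j x) / m x powr (1/p)"
        using lp_pointwise_le[OF lp_space_diff[OF X X]] .
      also have "\<dots> < e" using M[OF that] m_pos[of x] by (simp add: field_simps)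
      finally show ?thesis by (simp add: dist_real_def)
    qed
    then show "\<exists>M. \<forall>i\<ge>M. \<forall>j\<ge>M. dist (X i x) (X j x) < e" by blast
  qed
  then have "\<forall>x. \<exists>z. (\<lambda>n. X n x) \<longlonglongrightarrow> z" by (simp add: Cauchy_convergent_iff convergent_def)
  then have "\<exists>l. \<forall>x. (\<lambda>n. X n x) \<longlonglongrightarrow> l x" by (rule choice)
  then obtain l where l: "\<And>x. (\<lambda>n. X n x) \<longlonglongrightarrow> l x" by blast
  have *: "(\<lambda>x. X i x - l x) \<in> V \<and> N (\<lambda>x. X i x - l x) \<le> e"
    if "0 < e" "\<And>i j. i \<ge> M \<Longrightarrow> j \<ge> M \<Longrightarrow> N (\<lambda>x. X i x - X j x) < e" "i \<ge> M" for i e M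
  proof -
    have ev: "\<forall>\<^sub>F j in sequentially. (\<lambda>x. X i x - X j x) \<in> V \<and> N (\<lambda>x. X i x - X j x) \<le> e"
      unfolding eventually_sequentially using that(2)[OF that(3)] lp_space_diff[OF X X] by (auto intro: less_imp_le)
    show ?thesis
      using lp_fatou[OF ev _ _ tendsto_diff[OF tendsto_const l]] that(1) by auto
  qed
  obtain M where "\<And>i j. i \<ge> M \<Longrightarrow> j \<ge> M \<Longrightarrow> N (\<lambda>x. X i x - X j x) < 1" using Cauchy[of 1] by auto
  then have "(\<lambda>x. X M x - l x) \<in> V" using *[of 1 M M] by auto
  from lp_space_diff[OF X[of M] this] have "l \<in> V" by simp
  moreover have "(\<lambda>n. N (\<lambda>x. X n x - l x)) \<longlonglongrightarrow> 0"
  proof (rule tendstoI)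
    fix e :: real assume "0 < e"
    then obtain M where "\<And>i j. i \<ge> M \<Longrightarrow> j \<ge> M \<Longrightarrow> N (\<lambda>x. X i x - X j x) < e/2" using Cauchy[of "e/2"] by auto
    then have "N (\<lambda>x. X n x - l x) \<le> e/2" if "M \<le> n" for n using *[of "e/2" M n] \<open>0 < e\<close> that by auto
    then have "dist (N (\<lambda>x. X n x - l x)) 0 < e" if "M \<le> n" for n
      using \<open>0 < e\<close> that by (fastforce simp: dist_real_def)
    then show "\<forall>\<^sub>F n in sequentially. dist (N (\<lambda>x. X n x - l x)) 0 < e"
      unfolding eventually_sequentially by blast
  qed
  ultimately show ?thesis by blast
qed

abbreviation truncate :: "('a \<Rightarrow> real) \<Rightarrow> 'a set \<Rightarrow> 'a \<Rightarrow> real" where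
  "truncate f F \<equiv> (\<lambda>x. if x \<in> F then f x else 0)"

lemma finitely_supported_lp: assumes "f \<in> finitely_supported" shows "f \<in> V"
proof -
  have "(\<lambda>x. \<bar>f x\<bar> powr p * m x) summable_on {x. f x \<noteq> 0}"
    using assms by (intro summable_on_finite) (simp add: finitely_supported_def)
  then show ?thesis unfolding lp_space_def mem_Collect_eq
    by (rule summable_on_cong_neutral[THEN iffD1, rotated -1]) auto
qed

lemma truncate_finitely_supported: "finite F \<Longrightarrow> truncate f F \<in> finitely_supported"
  by (auto simp: finitely_supported_def)

lemma truncate_tendsto: assumes f: "f \<in> V"
  shows "((\<lambda>F. N (\<lambda>x. f x - truncate f F x)) \<longlongrightarrow> 0) (finite_subsets_at_top UNIV)"
proof -
  let ?s = "\<lambda>x. \<bar>f x\<bar> powr p * m x"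
  have eq: "(\<Sum>\<^sub>\<infinity>x. \<bar>f x - truncate f F x\<bar> powr p * m x) = infsum ?s UNIV - sum ?s F" if "finite F" for F
  proof -
    have "(\<Sum>\<^sub>\<infinity>x. \<bar>f x - truncate f F x\<bar> powr p * m x) = infsum ?s (- F)"
      by (intro infsum_cong_neutral) auto
    moreover have "infsum ?s UNIV = sum ?s F + infsum ?s (- F)"
      using infsum_Un_disjoint[of ?s F "- F"] summable_on_subset_banach[OF lp_spaceD[OF f]] that
      by (simp add: Compl_partition del: infsum_powr_nonneg)
    ultimately show ?thesis by simp
  qed
  have "((\<lambda>F. infsum ?s UNIV - sum ?s F) \<longlongrightarrow> infsum ?s UNIV - infsum ?s UNIV) (finite_subsets_at_top UNIV)"
    by (intro tendsto_diff tendsto_const infsum_tendsto lp_spaceD f)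
  then have "((\<lambda>F. (infsum ?s UNIV - sum ?s F) powr (1/p)) \<longlongrightarrow> 0 powr (1/p)) (finite_subsets_at_top UNIV)"
    using p by (intro tendsto_powr2 tendsto_const)
      (auto intro!: eventually_finite_subsets_at_top_weakI finite_sum_le_infsum lp_spaceD f)
  moreover have "\<forall>\<^sub>F F in finite_subsets_at_top UNIV. (infsum ?s UNIV - sum ?s F) powr (1/p) = N (\<lambda>x. f x - truncate f F x)"
    by (rule eventually_finite_subsets_at_top_weakI) (simp add: lp_norm_def eq)
  ultimately show ?thesis by (auto elim: Lim_transform_eventually)
qed

end

text \<open>Tonelli together with the swap of the two variables. It serves for three kernels: \<mu>
  with row sums \<open>deg\<close>, \<open>\<mu> x y * (\<rho> x y)\<^sup>2\<close> with row sums at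
  most \<open>m\<close>, and \<mu> localised to a ball, with row sums at most a multiple of
  \<open>m\<close>.\<close>

lemma infsum_double_kernel:
  fixes \<kappa> :: "'a \<Rightarrow> 'a \<Rightarrow> real"
  assumes nonneg: "\<And>x y. 0 \<le> \<kappa> x y" and sym: "\<And>x y. \<kappa> x y = \<kappa> y x"
    and rows: "\<And>x. \<kappa> x summable_on UNIV" "\<And>x. infsum (\<kappa> x) UNIV \<le> c x"
    and f: "\<And>x. 0 \<le> f x" "(\<lambda>x. f x * c x) summable_on UNIV"
  shows "(\<lambda>(x, y). \<kappa> x y * f x) summable_on UNIV"
    and "(\<Sum>\<^sub>\<infinity>(x, y). \<kappa> x y * f x) \<le> (\<Sum>\<^sub>\<infinity>x. f x * c x)"
    and "(\<lambda>(x, y). \<kappa> x y * f y) summable_on UNIV"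
    and "(\<Sum>\<^sub>\<infinity>(x, y). \<kappa> x y * f y) = (\<Sum>\<^sub>\<infinity>(x, y). \<kappa> x y * f x)"
proof -
  have row: "(\<lambda>y. \<kappa> x y * f x) summable_on UNIV" for x by (intro summable_on_cmult_left rows)
  have row_sum: "(\<Sum>\<^sub>\<infinity>y. \<kappa> x y * f x) = f x * infsum (\<kappa> x) UNIV" for x
    by (simp only: infsum_cmult_left') (simp add: mult.commute)
  have le: "f x * infsum (\<kappa> x) UNIV \<le> f x * c x" for x using f rows by (intro mult_left_mono) auto
  have sum: "(\<lambda>x. f x * infsum (\<kappa> x) UNIV) summable_on UNIV"
    by (rule summable_on_comparison_test[OF f(2)]) (auto intro!: le mult_nonneg_nonneg f infsum_nonneg nonneg)
  have "(\<lambda>(x, y). \<kappa> x y * f x) summable_on (Sigma UNIV (\<lambda>_. UNIV))"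
  proof (rule summable_on_SigmaI[OF _ sum])
    show "((\<lambda>y. case (x, y) of (x, y) \<Rightarrow> \<kappa> x y * f x) has_sum f x * infsum (\<kappa> x) UNIV) UNIV" for x
      using has_sum_infsum[OF row[of x]] by (simp add: row_sum)
  qed (use nonneg f in auto)
  then show 1: "(\<lambda>(x, y). \<kappa> x y * f x) summable_on UNIV" by simp
  have "(\<Sum>\<^sub>\<infinity>(x, y). \<kappa> x y * f x) = (\<Sum>\<^sub>\<infinity>x. f x * infsum (\<kappa> x) UNIV)"
    using infsum_Sigma'_banach[of "\<lambda>x y. \<kappa> x y * f x" UNIV "\<lambda>_. UNIV"] 1 by (simp add: row_sum)
  also have "\<dots> \<le> (\<Sum>\<^sub>\<infinity>x. f x * c x)" by (intro infsum_mono sum f le)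
  finally show "(\<Sum>\<^sub>\<infinity>(x, y). \<kappa> x y * f x) \<le> (\<Sum>\<^sub>\<infinity>x. f x * c x)" .
  have swap: "(\<lambda>(x, y). \<kappa> x y * f y) = (\<lambda>z. (case prod.swap z of (x, y) \<Rightarrow> \<kappa> x y * f x))"
    using sym by (auto simp: fun_eq_iff)
  have bij: "bij_betw prod.swap (UNIV :: ('a \<times> 'a) set) UNIV" by simp
  show "(\<lambda>(x, y). \<kappa> x y * f y) summable_on UNIV"
    unfolding swap using 1 by (subst summable_on_reindex_bij_betw[OF bij])
  show "(\<Sum>\<^sub>\<infinity>(x, y). \<kappa> x y * f y) = (\<Sum>\<^sub>\<infinity>(x, y). \<kappa> x y * f x)"
    unfolding swap by (rule infsum_reindex_bij_betw[OF bij])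
qed

lemma finitely_supported_induct [consumes 1, case_names zero add]:
  assumes f: "f \<in> finitely_supported"
    and zero: "P (\<lambda>_. 0)"
    and add: "\<And>f z c. P f \<Longrightarrow> P (\<lambda>x. f x + c * (if x = z then 1 else 0))"
  shows "P f"
proof -
  have "P (\<lambda>x. if x \<in> F then g x else 0)" if "finite F" for F :: "'a set" and g :: "'a \<Rightarrow> real"
    using that
  proof (induction F)
    case (insert z F)
    have "(\<lambda>x. if x \<in> insert z F then g x else 0) = (\<lambda>x. (if x \<in> F then g x else 0) + g z * (if x = z then 1 else 0))"
      using insert(2) by (auto simp: fun_eq_iff)
    then show ?case using add[OF insert(3), of "g z" z] by simp
  qed (use zero in simp)
  moreover have "(\<lambda>x. if x \<in> {x. f x \<noteq> 0} then f x else 0) = f" by auto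
  moreover have "finite {x. f x \<noteq> 0}" using f by (simp add: finitely_supported_def)
  ultimately show ?thesis by metis
qed

subsection \<open>The basic inequality of the Caccioppoli estimate\<close>

text \<open>With \<open>q = p - 1\<close> this is the duality map of L^p up to normalisation: the
  derivative of \<open>\<bar>a\<bar> powr p\<close> divided by \<open>p\<close>.\<close>

definition signed_powr :: "real \<Rightarrow> real \<Rightarrow> real" where
  "signed_powr a q = sgn a * \<bar>a\<bar> powr q"

lemma abs_signed_powr [simp]: "\<bar>signed_powr a q\<bar> = \<bar>a\<bar> powr q"
  by (simp add: signed_powr_def abs_mult sgn_real_def)

lemma signed_powr_minus [simp]: "signed_powr (- a) q = - signed_powr a q"
  by (simp add: signed_powr_def sgn_minus)

lemma signed_powr_nonneg: "0 \<le> a \<Longrightarrow> signed_powr a q = a powr q"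
  by (cases "a = 0") (auto simp: signed_powr_def)

lemma signed_powr_nonneg_iff: "0 \<le> a \<Longrightarrow> 0 \<le> signed_powr a q" "a \<le> 0 \<Longrightarrow> signed_powr a q \<le> 0"
  by (auto simp: signed_powr_def sgn_real_def)

lemma tangent_signed_powr:
  fixes u w p :: real
  assumes "1 < p"
  shows "\<bar>u\<bar> powr p + p * signed_powr u (p - 1) * (w - u) \<le> \<bar>w\<bar> powr p"
proof -
  have "signed_powr u (p - 1) * u = \<bar>u\<bar> * \<bar>u\<bar> powr (p - 1)"
    by (cases "0 \<le> u") (auto simp: signed_powr_def sgn_real_def)
  also have "\<dots> = \<bar>u\<bar> powr p" by (simp add: powr_mult_base)
  finally have "signed_powr u (p - 1) * u = \<bar>u\<bar> powr p" .
  moreover have "signed_powr u (p - 1) * w \<le> \<bar>w\<bar> * \<bar>u\<bar> powr (p - 1)"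
    using abs_ge_self[of "signed_powr u (p - 1) * w"] by (simp add: abs_mult mult.commute)
  then have "p * (signed_powr u (p - 1) * w) \<le> p * (\<bar>w\<bar> * \<bar>u\<bar> powr (p - 1))"
    using assms by (intro mult_left_mono) auto
  moreover have "p * signed_powr u (p - 1) * (w - u) = p * (signed_powr u (p - 1) * w) - p * (signed_powr u (p - 1) * u)"
    "(p - 1) * \<bar>u\<bar> powr p = p * \<bar>u\<bar> powr p - \<bar>u\<bar> powr p"
    by (simp_all add: algebra_simps)
  ultimately show ?thesis using Young_powr[OF assms, of "\<bar>w\<bar>" "\<bar>u\<bar>"] by simp
qed

text \<open>By the mean value theorem the difference of the powers is
  \<open>(p - 1) * z powr (p - 2)\<close> times \<open>a - b\<close> with \<open>z\<close> between
  \<open>b\<close> and \<open>a\<close>. The exponent \<open>p - 2\<close> may have either sign, so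
  \<open>z powr (p - 2)\<close> is not estimated alone: the other factor supplies
  \<open>z powr p\<close>, and the product is a square that is monotone in \<open>z\<close>.\<close>

lemma powr_difference_lower:
  fixes a b p :: real
  assumes p: "1 < p" and ab: "0 \<le> b" "b \<le> a"
  shows "(p - 1) * ((a - b) * (b powr (p - 1))\<^sup>2) \<le> (a powr (p - 1) - b powr (p - 1)) * (a powr p + b powr p)"
proof (cases "b = 0 \<or> a = b")
  case False
  with ab have b: "0 < b" "b < a" by auto
  have "\<exists>z>b. z < a \<and> a powr (p - 1) - b powr (p - 1) = (a - b) * ((p - 1) * z powr (p - 1 - 1))"
    using b by (intro MVT2 has_real_derivative_powr) auto
  then obtain z where z: "b < z" "z < a" and eq: "a powr (p - 1) - b powr (p - 1) = (a - b) * ((p - 1) * z powr (p - 2))"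
    by auto
  have "(b powr (p - 1))\<^sup>2 \<le> (z powr (p - 1))\<^sup>2"
    using b z p by (intro power_mono powr_mono2) auto
  also have "\<dots> = z powr (p - 2) * z powr p" by (simp add: power2_eq_square flip: powr_add)
  also have "\<dots> \<le> z powr (p - 2) * (a powr p + b powr p)"
    using b z p powr_mono2[of p z a] by (intro mult_left_mono) (auto simp: add_increasing2)
  finally have "(p - 1) * (a - b) * (b powr (p - 1))\<^sup>2 \<le> (p - 1) * (a - b) * (z powr (p - 2) * (a powr p + b powr p))"
    using p b by (intro mult_left_mono) auto
  then show ?thesis unfolding eq by (simp add: mult_ac)
qed (use p ab in \<open>auto intro!: mult_nonneg_nonneg powr_mono2\<close>)

lemma two_mult_le_of_square_le:
  fixes z P Q s t :: real
  assumes "z\<^sup>2 \<le> P * Q" "0 \<le> P" "0 \<le> Q"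
  shows "- (2 * s * t * z) \<le> s\<^sup>2 * P + t\<^sup>2 * Q"
proof -
  have "\<bar>z\<bar> \<le> sqrt P * sqrt Q"
    using real_sqrt_le_mono[OF assms(1)] by (simp add: real_sqrt_mult)
  then have "2 * \<bar>s\<bar> * \<bar>t\<bar> * \<bar>z\<bar> \<le> 2 * \<bar>s\<bar> * \<bar>t\<bar> * (sqrt P * sqrt Q)" by (intro mult_left_mono) auto
  also have "\<dots> \<le> (\<bar>s\<bar> * sqrt P)\<^sup>2 + (\<bar>t\<bar> * sqrt Q)\<^sup>2"
    using sum_squares_bound[of "\<bar>s\<bar> * sqrt P" "\<bar>t\<bar> * sqrt Q"] by (simp add: mult_ac)
  also have "\<dots> = s\<^sup>2 * P + t\<^sup>2 * Q" using assms by (simp add: power_mult_distrib)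
  finally have "2 * \<bar>s\<bar> * \<bar>t\<bar> * \<bar>z\<bar> \<le> s\<^sup>2 * P + t\<^sup>2 * Q" .
  moreover have "- (2 * s * t * z) \<le> \<bar>2 * s * t * z\<bar>" by simp
  then have "- (2 * s * t * z) \<le> 2 * \<bar>s\<bar> * \<bar>t\<bar> * \<bar>z\<bar>" by (simp add: abs_mult)
  ultimately show ?thesis by linarith
qed

text \<open>With \<open>g = t - s\<close> and \<open>z = (a - b) * K\<close> the right side equals
  \<open>s\<^sup>2 * P - 2 * s * g * z - g\<^sup>2 * z\<close>. The nonnegative term
  \<open>s\<^sup>2 * P\<close> absorbs the mixed term at the cost of
  \<open>g\<^sup>2 * X / (p - 1)\<close>, and \<open>z \<le> X\<close> bounds the last one; the
  constant collects these two losses.\<close>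

lemma cutoff_ineq_ordered:
  fixes a b p s t :: real
  assumes p: "1 < p" and ab: "0 \<le> b" "b \<le> a"
  shows "- (1 + 1 / (p - 1)) * (s - t)\<^sup>2 * (a powr p + b powr p)
    \<le> (a - b) * (s\<^sup>2 * a powr (p - 1) - t\<^sup>2 * b powr (p - 1))"
proof -
  define K where "K = b powr (p - 1)"
  define X where "X = a powr p + b powr p"
  define P where "P = (a - b) * (a powr (p - 1) - K)"
  define g where "g = t - s"
  have K: "0 \<le> K" and X: "0 \<le> X" by (auto simp: K_def X_def)
  have P: "0 \<le> P" unfolding P_def K_def using assms by (intro mult_nonneg_nonneg) (auto intro!: powr_mono2)
  have z: "(a - b) * K \<le> X"
  proof -
    have "(a - b) * K \<le> a * K" using K ab by (intro mult_right_mono) auto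
    also have "\<dots> \<le> X" unfolding K_def X_def using p ab by (intro mult_powr_le) auto
    finally show ?thesis .
  qed
  have "(p - 1) * ((a - b) * K\<^sup>2) \<le> (a powr (p - 1) - K) * X"
    unfolding K_def X_def by (rule powr_difference_lower[OF assms])
  then have "(a - b) * ((p - 1) * ((a - b) * K\<^sup>2)) \<le> (a - b) * ((a powr (p - 1) - K) * X)"
    using ab by (intro mult_left_mono) auto
  then have "((a - b) * K)\<^sup>2 \<le> P * (X / (p - 1))"
    using p by (simp add: P_def field_simps power2_eq_square)
  \<comment> \<open>\<open>powr_difference_lower\<close>, multiplied by \<open>a - b\<close>, is the
    bound on the square of \<open>z\<close> that this step needs; the argument \<open>- g\<close>
    gives the mixed term its sign.\<close>
  then have "- (2 * s * (- g) * ((a - b) * K)) \<le> s\<^sup>2 * P + (- g)\<^sup>2 * (X / (p - 1))"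
    using P X p by (intro two_mult_le_of_square_le) auto
  moreover have "g\<^sup>2 * ((a - b) * K) \<le> g\<^sup>2 * X" using z by (intro mult_left_mono) auto
  moreover have "(a - b) * (s\<^sup>2 * a powr (p - 1) - t\<^sup>2 * K)
      = s\<^sup>2 * P - 2 * s * g * ((a - b) * K) - g\<^sup>2 * ((a - b) * K)"
    by (simp add: P_def g_def power2_eq_square algebra_simps)
  moreover have "- (1 + 1 / (p - 1)) * (s - t)\<^sup>2 * X = - (g\<^sup>2 * X) - g\<^sup>2 * (X / (p - 1))"
    by (simp add: g_def power2_eq_square algebra_simps)
  ultimately show ?thesis unfolding K_def[symmetric] X_def[symmetric] by simp
qed

text \<open>Swapping the pairs \<open>(a, s)\<close> and \<open>(b, t)\<close> or negating
  \<open>a\<close> and \<open>b\<close> leaves both sides unchanged. For opposite signs the right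
  side is nonnegative.\<close>

lemma cutoff_ineq:
  fixes a b p s t :: real
  assumes p: "1 < p"
  shows "- (1 + 1 / (p - 1)) * ((s - t)\<^sup>2 * (\<bar>a\<bar> powr p + \<bar>b\<bar> powr p))
    \<le> (a - b) * (s\<^sup>2 * signed_powr a (p - 1) - t\<^sup>2 * signed_powr b (p - 1))"
proof -
  have pos: "- (1 + 1 / (p - 1)) * ((s - t)\<^sup>2 * (\<bar>a\<bar> powr p + \<bar>b\<bar> powr p))
    \<le> (a - b) * (s\<^sup>2 * signed_powr a (p - 1) - t\<^sup>2 * signed_powr b (p - 1))"
    if "0 \<le> a" "0 \<le> b" for a b s t :: real
  proof (cases "b \<le> a")
    case True
    then show ?thesis using cutoff_ineq_ordered[OF p that(2) True, of s t] that
      by (simp add: signed_powr_nonneg mult.assoc)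
  next
    case False
    then have "a \<le> b" by simp
    then show ?thesis using cutoff_ineq_ordered[OF p that(1), of b t s] that
      by (simp add: signed_powr_nonneg power2_commute[of t s] add_divide_distrib algebra_simps)
  qed
  have mixed: "- (1 + 1 / (p - 1)) * ((s - t)\<^sup>2 * (\<bar>a\<bar> powr p + \<bar>b\<bar> powr p))
    \<le> (a - b) * (s\<^sup>2 * signed_powr a (p - 1) - t\<^sup>2 * signed_powr b (p - 1))"
    if "0 \<le> a" "b \<le> 0" for a b s t :: real
  proof -
    have "0 \<le> (1 + 1 / (p - 1)) * ((s - t)\<^sup>2 * (\<bar>a\<bar> powr p + \<bar>b\<bar> powr p))"
      using p by (intro mult_nonneg_nonneg) auto
    moreover have "0 \<le> s\<^sup>2 * signed_powr a (p - 1)" "t\<^sup>2 * signed_powr b (p - 1) \<le> 0"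
      using that signed_powr_nonneg_iff by (auto intro!: mult_nonneg_nonneg mult_nonneg_nonpos)
    then have "0 \<le> (a - b) * (s\<^sup>2 * signed_powr a (p - 1) - t\<^sup>2 * signed_powr b (p - 1))"
      using that by (intro mult_nonneg_nonneg) auto
    ultimately show ?thesis unfolding mult_minus_left by linarith
  qed
  consider "0 \<le> a" "0 \<le> b" | "a \<le> 0" "b \<le> 0" | "0 \<le> a" "b \<le> 0" | "a \<le> 0" "0 \<le> b" by linarith
  then show ?thesis
  proof cases
    case 2
    then show ?thesis using pos[of "- a" "- b" s t] by (simp add: algebra_simps)
  next
    case 4
    then show ?thesis using mixed[of "- a" "- b" s t] by (simp add: algebra_simps)
  qed (use pos mixed in auto)
qed

subsection \<open>Graphs with an intrinsic metric\<close>

locale intrinsic_graph =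
  fixes \<mu> :: "'a::countable \<Rightarrow> 'a \<Rightarrow> real" and m :: "'a \<Rightarrow> real" and \<rho> :: "'a \<Rightarrow> 'a \<Rightarrow> real"
  assumes graph: "weighted_graph \<mu> m" and pseudo_metric: "pseudo_metric \<rho>"
    and intrinsic: "intrinsic \<mu> m \<rho>" and compatible: "compatible \<mu> m \<rho>"
begin

lemma m_pos [simp]: "0 < m x" and mu_nonneg [simp]: "0 \<le> \<mu> x y" and mu_sym: "\<mu> x y = \<mu> y x"
  and mu_diag [simp]: "\<mu> x x = 0" and mu_summable [simp]: "\<mu> x summable_on UNIV"
  using graph unfolding weighted_graph_def by auto

lemma m_nonneg [simp]: "0 \<le> m x" and m_neq_0 [simp]: "m x \<noteq> 0"
  using m_pos[of x] by linarith+

lemma rho_nonneg [simp]: "0 \<le> \<rho> x y" and rho_sym: "\<rho> x y = \<rho> y x" and rho_triangle: "\<rho> x z \<le> \<rho> x y + \<rho> y z"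
  using pseudo_metric unfolding pseudo_metric_def by auto

text \<open>The degree without the factor \<open>1 / m x\<close>, so bounded weighted degree on a
  ball reads \<open>deg x \<le> C * m x\<close>.\<close>

definition deg :: "'a \<Rightarrow> real" where "deg x = infsum (\<mu> x) UNIV"

lemma deg_nonneg [simp]: "0 \<le> deg x" unfolding deg_def by (intro infsum_nonneg) auto

lemma mu_le_deg: "\<mu> x y \<le> deg x"
  unfolding deg_def using finite_sum_le_infsum[of "\<mu> x" UNIV "{y}"] by simp

lemma jump_bound: "\<exists>s\<ge>0. \<forall>x y. 0 < \<mu> x y \<longrightarrow> \<rho> x y \<le> s"
proof (intro exI[of _ "enn2real (jump_size \<mu> \<rho>)"] conjI allI impI)
  fix x y assume "0 < \<mu> x y"
  then have "ennreal (\<rho> x y) \<le> jump_size \<mu> \<rho>"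
    unfolding jump_size_def by (intro Sup_upper) (auto simp: adjacent_def)
  moreover have "jump_size \<mu> \<rho> < \<infinity>" using compatible by (simp add: compatible_def)
  ultimately show "\<rho> x y \<le> enn2real (jump_size \<mu> \<rho>)"
    by (metis enn2real_ennreal enn2real_mono infinity_ennreal_def rho_nonneg)
qed simp

lemma deg_bound: "\<exists>C\<ge>0. \<forall>x. \<rho> x o1 \<le> r \<longrightarrow> deg x \<le> C * m x"
proof -
  obtain C where C: "\<And>x. \<rho> x o1 \<le> max r 0 \<Longrightarrow> weighted_degree \<mu> m x \<le> C"
    using compatible unfolding compatible_def by (meson max.cobounded2)
  have "deg x \<le> max C 0 * m x" if "\<rho> x o1 \<le> r" for x
  proof -
    have "deg x = weighted_degree \<mu> m x * m x"
      using m_pos[of x] by (simp add: deg_def weighted_degree_def)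
    also have "\<dots> \<le> max C 0 * m x"
      using C[of x] that by (intro mult_right_mono) (auto simp: le_max_iff_disj)
    finally show ?thesis .
  qed
  then show ?thesis by (intro exI[of _ "max C 0"]) auto
qed

text \<open>All neighbours of \<open>x\<close> lie within the jump size of \<open>x\<close>, hence
  in a ball where \<open>deg y\<close> is at most \<open>C * m y\<close>, and
  \<open>\<mu> x y\<close> is one term of \<open>deg y\<close>. It is the reason why functions in
  L^p have summable rows.\<close>

lemma neighbour_bound: "\<exists>C\<ge>0. \<forall>y. \<mu> x y \<le> C * m y"
proof -
  obtain s where s: "\<And>x y. 0 < \<mu> x y \<Longrightarrow> \<rho> x y \<le> s" using jump_bound by blast
  obtain C where C: "C \<ge> 0" "\<And>y. \<rho> y x \<le> s \<Longrightarrow> deg y \<le> C * m y" using deg_bound by metis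
  have "\<mu> x y \<le> C * m y" for y
  proof (cases "0 < \<mu> x y")
    case True
    then have "deg y \<le> C * m y" using s by (intro C(2)) (simp add: rho_sym)
    then show ?thesis using mu_le_deg[of y x] by (simp add: mu_sym)
  next
    case False
    then have "\<mu> x y = 0" using mu_nonneg[of x y] by linarith
    then show ?thesis using C(1) m_pos[of y] by simp
  qed
  then show ?thesis using C(1) by blast
qed

lemma rho_kernel:
  "(\<lambda>y. \<mu> x y * (\<rho> x y)\<^sup>2) summable_on UNIV" "(\<Sum>\<^sub>\<infinity>y. \<mu> x y * (\<rho> x y)\<^sup>2) \<le> m x"
  using intrinsic unfolding intrinsic_def by auto

abbreviation lap :: "('a \<Rightarrow> real) \<Rightarrow> 'a \<Rightarrow> real" where "lap \<equiv> formal_laplacian \<mu> m"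

lemma dom_summable: "u \<in> laplacian_dom \<mu> \<Longrightarrow> (\<lambda>y. \<mu> x y * u y) summable_on UNIV"
  using summable_on_iff_abs_summable_on_real[of "\<lambda>y. \<mu> x y * u y"]
  by (simp add: laplacian_dom_def abs_mult)

lemma lap_eq:
  assumes "u \<in> laplacian_dom \<mu>"
  shows "(\<lambda>y. \<mu> x y * (u x - u y)) summable_on UNIV"
    and "m x * lap u x = (\<Sum>\<^sub>\<infinity>y. \<mu> x y * (u x - u y))"
    and "m x * lap u x = deg x * u x - (\<Sum>\<^sub>\<infinity>y. \<mu> x y * u y)"
proof -
  have eq: "(\<lambda>y. \<mu> x y * (u x - u y)) = (\<lambda>y. \<mu> x y * u x + - (\<mu> x y * u y))" by (auto simp: algebra_simps)
  have s: "(\<lambda>y. \<mu> x y * u x) summable_on UNIV" "(\<lambda>y. - (\<mu> x y * u y)) summable_on UNIV"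
    using dom_summable[OF assms, of x] summable_on_cmult_left[of "\<mu> x" UNIV "u x"] by (auto simp: summable_on_uminus)
  show "(\<lambda>y. \<mu> x y * (u x - u y)) summable_on UNIV" unfolding eq by (intro summable_on_add s)
  show 1: "m x * lap u x = (\<Sum>\<^sub>\<infinity>y. \<mu> x y * (u x - u y))"
    using m_pos[of x] by (simp add: formal_laplacian_def)
  have "(\<Sum>\<^sub>\<infinity>y. \<mu> x y * (u x - u y)) = deg x * u x - (\<Sum>\<^sub>\<infinity>y. \<mu> x y * u y)"
    unfolding eq infsum_add[OF s] deg_def by (simp add: infsum_cmult_left' infsum_uminus)
  then show "m x * lap u x = deg x * u x - (\<Sum>\<^sub>\<infinity>y. \<mu> x y * u y)" using 1 by simp
qed

lemma lap_eq_divide: "u \<in> laplacian_dom \<mu> \<Longrightarrow> lap u x = (deg x * u x - (\<Sum>\<^sub>\<infinity>y. \<mu> x y * u y)) / m x"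
  using lap_eq(3)[of u x] m_pos[of x] by (simp add: field_simps)

lemma dom_linear:
  assumes "u \<in> laplacian_dom \<mu>" "v \<in> laplacian_dom \<mu>"
  shows "(\<lambda>x. a * u x + b * v x) \<in> laplacian_dom \<mu>"
    and "lap (\<lambda>x. a * u x + b * v x) = (\<lambda>x. a * lap u x + b * lap v x)"
proof -
  show dom: "(\<lambda>x. a * u x + b * v x) \<in> laplacian_dom \<mu>"
    unfolding laplacian_dom_def mem_Collect_eq
  proof
    fix x
    have "(\<lambda>y. \<bar>a\<bar> * (\<mu> x y * \<bar>u y\<bar>) + \<bar>b\<bar> * (\<mu> x y * \<bar>v y\<bar>)) summable_on UNIV"
      using assms by (intro summable_on_add summable_on_cmult_right) (auto simp: laplacian_dom_def)
    then show "(\<lambda>y. \<mu> x y * \<bar>a * u y + b * v y\<bar>) summable_on UNIV"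
    proof (rule summable_on_comparison_test)
      fix y
      have "\<mu> x y * \<bar>a * u y + b * v y\<bar> \<le> \<mu> x y * (\<bar>a\<bar> * \<bar>u y\<bar> + \<bar>b\<bar> * \<bar>v y\<bar>)"
        by (intro mult_left_mono) (auto intro: order_trans[OF abs_triangle_ineq] simp: abs_mult)
      then show "\<mu> x y * \<bar>a * u y + b * v y\<bar> \<le> \<bar>a\<bar> * (\<mu> x y * \<bar>u y\<bar>) + \<bar>b\<bar> * (\<mu> x y * \<bar>v y\<bar>)"
        by (simp add: algebra_simps)
    qed simp
  qed
  show "lap (\<lambda>x. a * u x + b * v x) = (\<lambda>x. a * lap u x + b * lap v x)"
  proof
    fix x
    have "(\<Sum>\<^sub>\<infinity>y. \<mu> x y * (a * u y + b * v y)) = (\<Sum>\<^sub>\<infinity>y. a * (\<mu> x y * u y) + b * (\<mu> x y * v y))"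
      by (simp add: algebra_simps)
    also have "\<dots> = a * (\<Sum>\<^sub>\<infinity>y. \<mu> x y * u y) + b * (\<Sum>\<^sub>\<infinity>y. \<mu> x y * v y)"
      using assms by (subst infsum_add) (auto intro!: summable_on_cmult_right dom_summable simp: infsum_cmult_right')
    finally show "lap (\<lambda>x. a * u x + b * v x) x = a * lap u x + b * lap v x"
      using assms dom by (simp add: lap_eq_divide field_simps)
  qed
qed

text \<open>
  The solution of \<open>u + h \<Delta> u = 1\<^sub>z\<close> is the increasing limit of the iteration
  \<open>(m + h deg) u\<^sub>n\<^sub>+\<^sub>1 = m 1\<^sub>z + h \<Sum>\<^sub>y \<mu> u\<^sub>n\<close>. It is bounded by \<open>1\<close> and integrable, so it lies in all \<open>L\<^sup>p\<close>
  simultaneously, which makes the resolvents on these spaces consistent.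
\<close>
lemma resolvent_point:
  assumes h: "0 < h"
  shows "\<exists>u. u \<in> laplacian_dom \<mu> \<and> (\<forall>x. 0 \<le> u x \<and> u x \<le> 1) \<and> (\<lambda>x. u x * m x) summable_on UNIV \<and>
    (\<lambda>x. u x + h * lap u x) = (\<lambda>x. if x = z then 1 else 0)"
proof -
  define \<delta> :: "'a \<Rightarrow> real" where "\<delta> x = (if x = z then 1 else 0)" for x
  define B where "B x = m x + h * deg x" for x
  have B: "0 < B x" for x using h by (auto simp: B_def intro!: add_pos_nonneg)
  define u where "u = rec_nat (\<lambda>_. 0) (\<lambda>n v x. (m x * \<delta> x + h * (\<Sum>\<^sub>\<infinity>y. \<mu> x y * v y)) / B x)"
  have u0: "u 0 x = 0" for x by (simp add: u_def)
  have uSuc: "B x * u (Suc n) x = m x * \<delta> x + h * (\<Sum>\<^sub>\<infinity>y. \<mu> x y * u n y)" for n x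
    using B[of x] by (simp add: u_def)
  have cancel: "v \<le> w" if "B x * v \<le> B x * w" for v w x using B[of x] that by simp
  have row: "(\<lambda>y. \<mu> x y * v y) summable_on UNIV" if "\<And>y. 0 \<le> v y \<and> v y \<le> 1" for x and v :: "'a \<Rightarrow> real"
    by (rule summable_on_comparison_test[OF mu_summable[of x]]) (use that in \<open>auto simp: mult_left_le\<close>)
  have u01: "0 \<le> u n x \<and> u n x \<le> 1" for n x
  proof (induction n arbitrary: x)
    case (Suc n)
    have "0 \<le> (\<Sum>\<^sub>\<infinity>y. \<mu> x y * u n y)" using Suc by (intro infsum_nonneg) auto
    then have "B x * 0 \<le> B x * u (Suc n) x" unfolding uSuc using h by (simp add: \<delta>_def)
    moreover have "(\<Sum>\<^sub>\<infinity>y. \<mu> x y * u n y) \<le> deg x" unfolding deg_def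
      using Suc by (intro infsum_mono row) (auto simp: mult_left_le)
    then have "h * (\<Sum>\<^sub>\<infinity>y. \<mu> x y * u n y) \<le> h * deg x" using h by (intro mult_left_mono) auto
    then have "B x * u (Suc n) x \<le> B x * 1" unfolding uSuc by (auto simp: B_def \<delta>_def add_increasing)
    ultimately show ?case using cancel by blast
  qed (simp add: u0)
  have mono1: "u n x \<le> u (Suc n) x" for n x
  proof (induction n arbitrary: x)
    case (Suc n)
    have "(\<Sum>\<^sub>\<infinity>y. \<mu> x y * u n y) \<le> (\<Sum>\<^sub>\<infinity>y. \<mu> x y * u (Suc n) y)"
      using Suc u01 by (intro infsum_mono row mult_left_mono) auto
    then have "B x * u (Suc n) x \<le> B x * u (Suc (Suc n)) x"
      using h unfolding uSuc[of x n] uSuc[of x "Suc n"] by (intro add_left_mono mult_left_mono) auto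
    then show ?case by (rule cancel)
  qed (use u01 u0 in simp)
  \<comment> \<open>Summing the iteration over all vertices gives the mass bound \<open>m z\<close>
    independently of \<open>n\<close>. Summability against \<open>deg\<close> is carried along only
    to cancel the term \<open>h * deg\<close>; no uniform bound is claimed for it.\<close>
  have step: "(\<lambda>x. u n x * deg x) summable_on UNIV \<and> (\<lambda>x. u n x * m x) summable_on UNIV
      \<and> (\<Sum>\<^sub>\<infinity>x. u n x * m x) \<le> m z" for n
  proof (induction n)
    case (Suc n)
    have \<delta>: "(\<lambda>x. m x * \<delta> x) summable_on UNIV" "(\<Sum>\<^sub>\<infinity>x. m x * \<delta> x) = m z"
    proof -
      have "((\<lambda>x. m x * \<delta> x) has_sum m z) UNIV"
        by (rule has_sum_finite_neutralI[of "{z}"]) (auto simp: \<delta>_def)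
      then show "(\<lambda>x. m x * \<delta> x) summable_on UNIV" "(\<Sum>\<^sub>\<infinity>x. m x * \<delta> x) = m z"
        by (auto simp: infsumI summable_on_def)
    qed
    have pair: "(\<lambda>(x, y). \<mu> x y * u n y) summable_on UNIV"
      "(\<Sum>\<^sub>\<infinity>(x, y). \<mu> x y * u n y) \<le> (\<Sum>\<^sub>\<infinity>x. u n x * deg x)"
      using infsum_double_kernel[of \<mu> deg "u n"] Suc u01 by (auto simp: mu_sym deg_def)
    have W: "(\<lambda>x. \<Sum>\<^sub>\<infinity>y. \<mu> x y * u n y) summable_on UNIV"
      "(\<Sum>\<^sub>\<infinity>x. \<Sum>\<^sub>\<infinity>y. \<mu> x y * u n y) \<le> (\<Sum>\<^sub>\<infinity>x. u n x * deg x)"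
      using summable_on_Sigma_banach[of "\<lambda>x y. \<mu> x y * u n y" UNIV "\<lambda>_. UNIV"]
        infsum_Sigma'_banach[of "\<lambda>x y. \<mu> x y * u n y" UNIV "\<lambda>_. UNIV"] pair by auto
    have BS: "(\<lambda>x. B x * u (Suc n) x) summable_on UNIV"
      "(\<Sum>\<^sub>\<infinity>x. B x * u (Suc n) x) = m z + h * (\<Sum>\<^sub>\<infinity>x. \<Sum>\<^sub>\<infinity>y. \<mu> x y * u n y)"
      unfolding uSuc using W \<delta>
      by (auto intro!: summable_on_add summable_on_cmult_right simp: infsum_add summable_on_cmult_right infsum_cmult_right')
    have mS: "(\<lambda>x. u (Suc n) x * m x) summable_on UNIV"
      by (rule summable_on_comparison_test[OF BS(1)]) (use u01[of "Suc n"] h in \<open>auto simp: B_def algebra_simps less_imp_le\<close>)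
    have hS: "(\<lambda>x. h * (u (Suc n) x * deg x)) summable_on UNIV"
      by (rule summable_on_comparison_test[OF BS(1)]) (use u01[of "Suc n"] h in \<open>auto simp: B_def algebra_simps less_imp_le\<close>)
    then have dS: "(\<lambda>x. u (Suc n) x * deg x) summable_on UNIV"
      using h summable_on_cmult_right[OF hS, of "1/h"] by simp
    \<comment> \<open>By monotonicity of the iteration the incoming mass at step \<open>n\<close> is
      at most the outgoing mass at step \<open>Suc n\<close>, and the latter cancels against the
      \<open>deg\<close> part of \<open>B\<close>.\<close>
    have "(\<Sum>\<^sub>\<infinity>x. u n x * deg x) \<le> (\<Sum>\<^sub>\<infinity>x. u (Suc n) x * deg x)"
      using Suc dS mono1 by (intro infsum_mono mult_right_mono) auto
    then have "(\<Sum>\<^sub>\<infinity>x. B x * u (Suc n) x) \<le> m z + h * (\<Sum>\<^sub>\<infinity>x. u (Suc n) x * deg x)"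
      unfolding BS(2) using W(2) h by (intro add_left_mono mult_left_mono) auto
    moreover have "(\<Sum>\<^sub>\<infinity>x. B x * u (Suc n) x) = (\<Sum>\<^sub>\<infinity>x. u (Suc n) x * m x + h * (u (Suc n) x * deg x))"
      by (simp add: B_def algebra_simps)
    moreover have "\<dots> = (\<Sum>\<^sub>\<infinity>x. u (Suc n) x * m x) + h * (\<Sum>\<^sub>\<infinity>x. u (Suc n) x * deg x)"
      using mS hS by (simp add: infsum_add infsum_cmult_right')
    ultimately show ?case using mS dS by simp
  qed (simp add: u0 less_imp_le)
  have "\<forall>x. \<exists>l. (\<lambda>n. u n x) \<longlonglongrightarrow> l"
  proof
    fix x
    have "incseq (\<lambda>n. u n x)" using mono1 by (rule incseq_SucI)
    then show "\<exists>l. (\<lambda>n. u n x) \<longlonglongrightarrow> l" using u01 incseq_convergent[of "\<lambda>n. u n x" 1] by metis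
  qed
  then obtain v where v: "\<And>x. (\<lambda>n. u n x) \<longlonglongrightarrow> v x" by metis
  have v01: "0 \<le> v x \<and> v x \<le> 1" for x
    using tendsto_lowerbound[OF v, of 0 x] tendsto_upperbound[OF v, of x 1] u01 by auto
  have vm: "(\<lambda>x. v x * m x) summable_on UNIV"
    by (rule infsum_fatou(1)[where f = "\<lambda>n x. u n x * m x" and G = sequentially and C = "m z"])
      (use step u01 in \<open>auto intro!: tendsto_mult_right v mult_nonneg_nonneg less_imp_le\<close>)
  have vdom: "v \<in> laplacian_dom \<mu>" unfolding laplacian_dom_def using row[of v] v01 by simp
  have "(\<lambda>n. \<Sum>\<^sub>\<infinity>y. \<mu> x y * u n y) \<longlonglongrightarrow> (\<Sum>\<^sub>\<infinity>y. \<mu> x y * v y)" for x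
    by (rule infsum_dominated_convergence(2)[OF mu_summable[of x]])
      (use u01 in \<open>auto intro!: tendsto_mult_left v simp: abs_mult mult_left_le\<close>)
  then have "(\<lambda>n. m x * \<delta> x + h * (\<Sum>\<^sub>\<infinity>y. \<mu> x y * u n y)) \<longlonglongrightarrow> m x * \<delta> x + h * (\<Sum>\<^sub>\<infinity>y. \<mu> x y * v y)" for x
    by (intro tendsto_intros)
  then have "(\<lambda>n. B x * u (Suc n) x) \<longlonglongrightarrow> m x * \<delta> x + h * (\<Sum>\<^sub>\<infinity>y. \<mu> x y * v y)" for x
    by (simp add: uSuc)
  moreover have "(\<lambda>n. B x * u (Suc n) x) \<longlonglongrightarrow> B x * v x" for x
    by (intro tendsto_mult_left LIMSEQ_Suc v)
  ultimately have limit: "B x * v x = m x * \<delta> x + h * (\<Sum>\<^sub>\<infinity>y. \<mu> x y * v y)" for x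
    using LIMSEQ_unique by blast
  have "m x * (v x + h * lap v x) = m x * \<delta> x" for x
  proof -
    have "m x * (v x + h * lap v x) = m x * v x + h * (m x * lap v x)" by (simp add: algebra_simps)
    then show ?thesis using limit[of x] unfolding lap_eq(3)[OF vdom] by (simp add: B_def algebra_simps)
  qed
  then have "v x + h * lap v x = \<delta> x" for x using m_pos[of x] by (metis less_irrefl mult_cancel_left)
  then show ?thesis using vdom v01 vm by (auto simp: \<delta>_def fun_eq_iff)
qed

end

section \<open>The maximal Laplacian is m-accretive\<close>

context intrinsic_graph
begin

section \<open>Cutoff functions of the metric\<close>

definition cutoff :: "'a \<Rightarrow> real \<Rightarrow> 'a \<Rightarrow> real" where
  "cutoff o1 R x = max 0 (1 - \<rho> x o1 / R)"

lemma cutoff_bounds: "0 < R \<Longrightarrow> 0 \<le> cutoff o1 R x" "0 < R \<Longrightarrow> cutoff o1 R x \<le> 1"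
  by (auto simp: cutoff_def)

lemma cutoff_support: "0 < R \<Longrightarrow> cutoff o1 R x \<noteq> 0 \<Longrightarrow> \<rho> x o1 \<le> R"
  by (auto simp: cutoff_def max_def field_simps split: if_splits)

lemma cutoff_lipschitz: assumes "0 < R" shows "\<bar>cutoff o1 R x - cutoff o1 R y\<bar> \<le> \<rho> x y / R"
proof -
  have "\<bar>cutoff o1 R x - cutoff o1 R y\<bar> \<le> \<bar>\<rho> x o1 / R - \<rho> y o1 / R\<bar>"
    unfolding cutoff_def by (auto simp: max_def)
  also have "\<dots> = \<bar>\<rho> x o1 - \<rho> y o1\<bar> / R" using assms by (simp flip: diff_divide_distrib)
  also have "\<dots> \<le> \<rho> x y / R"
    using assms rho_triangle[of x o1 y] rho_triangle[of y o1 x] rho_sym[of x y]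
    by (intro divide_right_mono) auto
  finally show ?thesis .
qed

lemma cutoff_tendsto: "(\<lambda>n. cutoff o1 (real (Suc n)) x) \<longlonglongrightarrow> 1"
proof -
  have "(\<lambda>n. \<rho> x o1 * inverse (real (Suc n))) \<longlonglongrightarrow> 0"
    by (intro tendsto_mult_right_zero LIMSEQ_inverse_real_of_nat)
  then have "(\<lambda>n. max 0 (1 - \<rho> x o1 * inverse (real (Suc n)))) \<longlonglongrightarrow> max 0 (1 - 0)"
    by (intro tendsto_max tendsto_diff tendsto_const)
  then show ?thesis by (simp add: cutoff_def divide_inverse)
qed

lemma dom_pointwise: "(\<lambda>x. if x = z then 1 else 0) \<in> laplacian_dom \<mu>"
proof -
  have "(\<lambda>y. \<mu> x y * \<bar>if y = z then 1 else 0\<bar>) summable_on UNIV" for x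
    by (rule summable_on_comparison_test[OF mu_summable[of x]]) auto
  then show ?thesis by (simp add: laplacian_dom_def)
qed

end

section \<open>The Laplacian on L^p\<close>

locale intrinsic_graph_lp = intrinsic_graph +
  fixes p :: real
  assumes p: "1 < p"
begin

sublocale lp m p
  by standard (auto simp: p)

text \<open>Where \<open>\<bar>u y\<bar>\<close> is at most \<open>N u\<close>, the row is bounded
  by \<open>N u * deg x\<close>. Elsewhere \<open>\<bar>u y\<bar>\<close> is at most
  \<open>N u powr (1 - p) * \<bar>u y\<bar> powr p\<close>, and \<open>neighbour_bound\<close>
  exchanges \<mu> for \<open>m\<close>, which gives at most \<open>C * N u\<close>.\<close>

lemma row_bound: "\<exists>C\<ge>0. \<forall>u\<in>V. (\<lambda>y. \<mu> x y * \<bar>u y\<bar>) summable_on UNIV \<and> (\<Sum>\<^sub>\<infinity>y. \<mu> x y * \<bar>u y\<bar>) \<le> C * N u"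
proof -
  obtain C where C: "C \<ge> 0" "\<And>y. \<mu> x y \<le> C * m y" using neighbour_bound by blast
  have "(\<lambda>y. \<mu> x y * \<bar>u y\<bar>) summable_on UNIV \<and> (\<Sum>\<^sub>\<infinity>y. \<mu> x y * \<bar>u y\<bar>) \<le> (deg x + C) * N u" if u: "u \<in> V" for u
  proof (cases "N u = 0")
    case True
    then have "u y = 0" for y using lp_norm_eq_0[OF u] by blast
    then show ?thesis using True by simp
  next
    case False
    then have e: "0 < N u" using lp_nonneg[of u] by linarith
    let ?g = "\<lambda>y. N u * \<mu> x y + C * N u powr (1 - p) * (\<bar>u y\<bar> powr p * m y)"
    have le: "\<mu> x y * \<bar>u y\<bar> \<le> ?g y" for y
    proof (cases "\<bar>u y\<bar> \<le> N u")
      case True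
      then have "\<mu> x y * \<bar>u y\<bar> \<le> \<mu> x y * N u" by (intro mult_left_mono) auto
      then show ?thesis using C(1) by (simp add: add_increasing2 mult.commute)
    next
      case False
      then have "\<bar>u y\<bar> = \<bar>u y\<bar> powr (1 - p) * \<bar>u y\<bar> powr p" using e by (simp flip: powr_add)
      also have "\<dots> \<le> N u powr (1 - p) * \<bar>u y\<bar> powr p"
        using False e p by (intro mult_right_mono powr_mono2') auto
      finally have "\<mu> x y * \<bar>u y\<bar> \<le> (C * m y) * (N u powr (1 - p) * \<bar>u y\<bar> powr p)"
        using C by (intro mult_mono) auto
      then show ?thesis using e by (simp add: add_increasing mult_ac)
    qed
    have s: "(\<lambda>y. N u * \<mu> x y) summable_on UNIV"
      "(\<lambda>y. C * N u powr (1 - p) * (\<bar>u y\<bar> powr p * m y)) summable_on UNIV"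
      by (auto intro!: summable_on_cmult_right lp_spaceD u)
    have sum: "(\<lambda>y. \<mu> x y * \<bar>u y\<bar>) summable_on UNIV"
      by (rule summable_on_comparison_test[OF summable_on_add[OF s]]) (use le in auto)
    have "(\<Sum>\<^sub>\<infinity>y. \<mu> x y * \<bar>u y\<bar>) \<le> infsum ?g UNIV"
      by (intro infsum_mono sum summable_on_add s le)
    also have "\<dots> = N u * deg x + C * N u powr (1 - p) * N u powr p"
      unfolding infsum_add[OF s] by (simp add: infsum_cmult_right' deg_def lp_norm_powr)
    also have "C * N u powr (1 - p) * N u powr p = C * N u"
      using e by (simp add: mult.assoc flip: powr_add)
    finally show ?thesis using sum by (simp add: algebra_simps)
  qed
  then show ?thesis using C(1) by (intro exI[of _ "deg x + C"]) auto
qed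

lemma lp_dom: "u \<in> V \<Longrightarrow> u \<in> laplacian_dom \<mu>"
  using row_bound unfolding laplacian_dom_def by blast

lemma row_tendsto:
  assumes "\<And>n. u n \<in> V" "v \<in> V" "(\<lambda>n. N (\<lambda>x. u n x - v x)) \<longlonglongrightarrow> 0"
  shows "(\<lambda>n. \<Sum>\<^sub>\<infinity>y. \<mu> x y * u n y) \<longlonglongrightarrow> (\<Sum>\<^sub>\<infinity>y. \<mu> x y * v y)"
proof -
  obtain C where C: "\<And>u. u \<in> V \<Longrightarrow> (\<lambda>y. \<mu> x y * \<bar>u y\<bar>) summable_on UNIV"
    "\<And>u. u \<in> V \<Longrightarrow> (\<Sum>\<^sub>\<infinity>y. \<mu> x y * \<bar>u y\<bar>) \<le> C * N u" using row_bound by blast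
  have "\<bar>(\<Sum>\<^sub>\<infinity>y. \<mu> x y * u n y) - (\<Sum>\<^sub>\<infinity>y. \<mu> x y * v y)\<bar> \<le> C * N (\<lambda>x. u n x - v x)" for n
  proof -
    have d: "(\<lambda>x. u n x - v x) \<in> V" using assms by (intro lp_space_diff)
    have "(\<Sum>\<^sub>\<infinity>y. \<mu> x y * u n y) - (\<Sum>\<^sub>\<infinity>y. \<mu> x y * v y) = (\<Sum>\<^sub>\<infinity>y. \<mu> x y * (u n y - v y))"
      using infsum_add[OF dom_summable[OF lp_dom[OF assms(1)[of n]]] summable_on_uminus[THEN iffD2, OF dom_summable[OF lp_dom[OF assms(2)]]], of x x]
      by (simp add: infsum_uminus right_diff_distrib)
    moreover have "\<bar>\<Sum>\<^sub>\<infinity>y. \<mu> x y * (u n y - v y)\<bar> \<le> (\<Sum>\<^sub>\<infinity>y. \<mu> x y * \<bar>u n y - v y\<bar>)"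
      using C(1)[OF d] by (intro abs_infsum_le) (auto simp: abs_mult)
    ultimately show ?thesis using C(2)[OF d] by linarith
  qed
  then have "(\<lambda>n. (\<Sum>\<^sub>\<infinity>y. \<mu> x y * u n y) - (\<Sum>\<^sub>\<infinity>y. \<mu> x y * v y)) \<longlonglongrightarrow> 0"
    by (intro Lim_null_comparison[OF _ tendsto_mult_right_zero[OF assms(3), of C]]) auto
  then show ?thesis by (simp add: LIM_zero_iff)
qed

definition lap_dom :: "('a \<Rightarrow> real) set" where "lap_dom = {u \<in> V. lap u \<in> V}"

lemma lap_linear: "u \<in> V \<Longrightarrow> v \<in> V \<Longrightarrow> lap (\<lambda>x. a * u x + b * v x) = (\<lambda>x. a * lap u x + b * lap v x)"
  by (intro dom_linear lp_dom)

lemma lap_dom_linear: "u \<in> lap_dom \<Longrightarrow> v \<in> lap_dom \<Longrightarrow> (\<lambda>x. a * u x + b * v x) \<in> lap_dom"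
  unfolding lap_dom_def mem_Collect_eq by (auto simp: lap_linear intro!: lp_space_add lp_space_scale)

text \<open>Off \<open>z\<close> the Laplacian of the point mass is
  \<open>- \<mu> x z / m x\<close>. This quotient is bounded by \<open>neighbour_bound\<close> and
  integrable because \<mu> has finite row sums, hence it is in L^p.\<close>

lemma point_lap_dom: "(\<lambda>x. if x = z then 1 else 0) \<in> lap_dom"
proof -
  let ?d = "\<lambda>x. if x = z then 1 else 0 :: real"
  have d: "?d \<in> V" by (rule finitely_supported_lp) (simp add: finitely_supported_def)
  obtain C where C: "C \<ge> 0" "\<And>y. \<mu> z y \<le> C * m y" using neighbour_bound by blast
  have "(\<lambda>x. \<mu> x z / m x) \<in> V"
    unfolding lp_space_def mem_Collect_eq
  proof (rule summable_on_comparison_test)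
    show "(\<lambda>x. C powr (p - 1) * \<mu> z x) summable_on UNIV" by (intro summable_on_cmult_right mu_summable)
    fix x
    let ?q = "\<mu> x z / m x"
    have q: "0 \<le> ?q" "?q \<le> C" using C(2)[of x] m_pos[of x] by (auto simp: field_simps mu_sym)
    have "\<bar>?q\<bar> powr p = ?q powr (p - 1) * ?q"
      using q(1) powr_mult_base[of ?q "p - 1"] by (simp add: mult.commute)
    also have "\<dots> \<le> C powr (p - 1) * ?q" using q p by (intro mult_right_mono powr_mono2) auto
    finally have "\<bar>?q\<bar> powr p * m x \<le> C powr (p - 1) * ?q * m x" by (intro mult_right_mono) auto
    then show "\<bar>?q\<bar> powr p * m x \<le> C powr (p - 1) * \<mu> z x" by (simp add: mu_sym)
  qed auto
  then have "(\<lambda>x. deg z / m z * ?d x - \<mu> x z / m x) \<in> V" by (intro lp_space_diff lp_space_scale d)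
  moreover have "lap ?d = (\<lambda>x. deg z / m z * ?d x - \<mu> x z / m x)"
  proof
    fix x
    have "(\<Sum>\<^sub>\<infinity>y. \<mu> x y * ?d y) = \<mu> x z"
      by (rule infsumI, rule has_sum_finite_neutralI[of "{z}"]) auto
    then show "lap ?d x = deg z / m z * ?d x - \<mu> x z / m x"
      using lap_eq_divide[OF dom_pointwise, of z x] by (auto simp: diff_divide_distrib)
  qed
  ultimately show ?thesis using d by (simp add: lap_dom_def)
qed

lemma finitely_supported_lap_dom: "f \<in> finitely_supported \<Longrightarrow> f \<in> lap_dom"
proof (induction rule: finitely_supported_induct)
  case zero
  show ?case using lap_dom_linear[OF point_lap_dom point_lap_dom, of 0 _ 0] by simp
next
  case (add f z c)
  then show ?case using lap_dom_linear[OF add point_lap_dom, of 1 c z] by simp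
qed

text \<open>Restricting both endpoints to the ball of radius \<open>R\<close> plus jump size keeps
  the kernel symmetric and bounds all its row sums by a multiple of \<open>m\<close>. Rows that
  start in the smaller ball are unchanged, since their neighbours do not leave the larger
  one.\<close>

lemma ball_kernel: 
  "\<exists>\<kappa> C. 0 \<le> C \<and> (\<forall>x y. 0 \<le> \<kappa> x y \<and> \<kappa> x y = \<kappa> y x) \<and> (\<forall>x. \<kappa> x summable_on UNIV \<and> infsum (\<kappa> x) UNIV \<le> C * m x)
    \<and> (\<forall>x y. \<rho> x o1 \<le> R \<longrightarrow> \<kappa> x y = \<mu> x y)"
proof -
  obtain s where s: "s \<ge> 0" "\<And>x y. 0 < \<mu> x y \<Longrightarrow> \<rho> x y \<le> s" using jump_bound by blast
  obtain C where C: "C \<ge> 0" "\<And>x. \<rho> x o1 \<le> R + s \<Longrightarrow> deg x \<le> C * m x" using deg_bound by blast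
  define \<kappa> where "\<kappa> x y = (if \<rho> x o1 \<le> R + s \<and> \<rho> y o1 \<le> R + s then \<mu> x y else 0)" for x y
  have sum: "\<kappa> x summable_on UNIV" for x
    by (rule summable_on_comparison_test[OF mu_summable[of x]]) (auto simp: \<kappa>_def)
  have "infsum (\<kappa> x) UNIV \<le> C * m x" for x
  proof (cases "\<rho> x o1 \<le> R + s")
    case True
    have "infsum (\<kappa> x) UNIV \<le> deg x" unfolding deg_def by (intro infsum_mono sum mu_summable) (auto simp: \<kappa>_def)
    then show ?thesis using C(2)[OF True] by simp
  next
    case False
    then have "\<kappa> x = (\<lambda>_. 0)" by (auto simp: \<kappa>_def)
    then show ?thesis using C(1) by simp
  qed
  moreover have "\<kappa> x y = \<mu> x y" if "\<rho> x o1 \<le> R" for x y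
  proof (cases "0 < \<mu> x y")
    case True
    then have "\<rho> y o1 \<le> R + s" using s(2)[OF True] rho_triangle[of y o1 x] rho_sym[of x y] that by simp
    then show ?thesis using that s(1) by (simp add: \<kappa>_def)
  next
    case False
    then have "\<mu> x y = 0" using mu_nonneg[of x y] by linarith
    then show ?thesis by (simp add: \<kappa>_def)
  qed
  ultimately show ?thesis using C(1) sum by (intro exI[of _ \<kappa>] exI[of _ C]) (auto simp: \<kappa>_def mu_sym)
qed

text \<open>The support of \<open>w\<close> allows \<mu> to be replaced by the kernel of
  \<open>ball_kernel\<close>, and Young's inequality for conjugate exponents then gives absolute
  summability over pairs. Adding the sum with exchanged variables produces the factor 2. Only
  \<open>u\<close> itself has to be in L^p, not its Laplacian.\<close>

lemma green:
  assumes u: "u \<in> V" and w: "(\<lambda>x. \<bar>w x\<bar> powr (p / (p - 1)) * m x) summable_on UNIV"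
    and "\<forall>x. w x \<noteq> 0 \<longrightarrow> \<rho> x o1 \<le> R"
  shows "(\<lambda>x. w x * lap u x * m x) summable_on UNIV"
    and "(\<lambda>(x, y). \<mu> x y * ((w x - w y) * (u x - u y))) summable_on UNIV"
    and "2 * (\<Sum>\<^sub>\<infinity>x. w x * lap u x * m x) = (\<Sum>\<^sub>\<infinity>(x, y). \<mu> x y * ((w x - w y) * (u x - u y)))"
proof -
  note supp = assms(3)[rule_format]
  define q where "q = p / (p - 1)"
  have q: "1 < q" "1 / p + 1 / q = 1" using p by (auto simp: q_def field_simps)
  obtain \<kappa> C where \<kappa>: "0 \<le> C" "\<And>x y. 0 \<le> \<kappa> x y" "\<And>x y. \<kappa> x y = \<kappa> y x" "\<And>x. \<kappa> x summable_on UNIV"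
    "\<And>x. infsum (\<kappa> x) UNIV \<le> C * m x" "\<And>x y. \<rho> x o1 \<le> R \<Longrightarrow> \<kappa> x y = \<mu> x y"
    using ball_kernel by metis
  have Y: "\<bar>a\<bar> * \<bar>b\<bar> \<le> \<bar>a\<bar> powr q + \<bar>b\<bar> powr p" for a b :: real
  proof -
    have "\<bar>b\<bar> * \<bar>a\<bar> \<le> \<bar>b\<bar> powr p / p + \<bar>a\<bar> powr q / q" using p q by (intro Youngs_inequality) auto
    also have "\<dots> \<le> \<bar>b\<bar> powr p + \<bar>a\<bar> powr q"
      using p q divide_left_mono[of 1 p "\<bar>b\<bar> powr p"] divide_left_mono[of 1 q "\<bar>a\<bar> powr q"] by (intro add_mono) auto
    finally show ?thesis by (simp add: mult.commute add.commute)
  qed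
  have sc: "(\<lambda>x. \<bar>w x\<bar> powr q * (C * m x)) summable_on UNIV" "(\<lambda>x. \<bar>u x\<bar> powr p * (C * m x)) summable_on UNIV"
    using summable_on_cmult_right[OF w, of C] summable_on_cmult_right[OF lp_spaceD[OF u], of C]
    by (auto simp: q_def mult_ac)
  note kw = infsum_double_kernel[of \<kappa> "\<lambda>x. C * m x" "\<lambda>x. \<bar>w x\<bar> powr q", OF \<kappa>(2,3,4,5) _ sc(1), simplified]
  note ku = infsum_double_kernel[of \<kappa> "\<lambda>x. C * m x" "\<lambda>x. \<bar>u x\<bar> powr p", OF \<kappa>(2,3,4,5) _ sc(2), simplified]
  let ?g = "\<lambda>(x, y). \<mu> x y * w x * (u x - u y)"
  have dom: "(\<lambda>z. (\<lambda>(x, y). \<kappa> x y * \<bar>w x\<bar> powr q) z + (\<lambda>(x, y). \<kappa> x y * \<bar>w x\<bar> powr q) z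
      + ((\<lambda>(x, y). \<kappa> x y * \<bar>u x\<bar> powr p) z + (\<lambda>(x, y). \<kappa> x y * \<bar>u y\<bar> powr p) z)) summable_on UNIV"
    by (intro summable_on_add kw ku)
  have g: "?g summable_on UNIV"
  proof (rule summable_on_comparison_abs[OF dom])
    fix z :: "'a \<times> 'a"
    obtain x y where z: "z = (x, y)" by (cases z)
    have "\<bar>\<mu> x y * w x * (u x - u y)\<bar> = \<kappa> x y * (\<bar>w x\<bar> * \<bar>u x - u y\<bar>)"
      using \<kappa>(6)[of x y] supp[of x] by (cases "w x = 0") (auto simp: abs_mult)
    also have "\<dots> \<le> \<kappa> x y * (\<bar>w x\<bar> * (\<bar>u x\<bar> + \<bar>u y\<bar>))"
      using \<kappa>(2) by (intro mult_left_mono) auto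
    also have "\<dots> \<le> \<kappa> x y * (\<bar>w x\<bar> powr q + \<bar>w x\<bar> powr q + (\<bar>u x\<bar> powr p + \<bar>u y\<bar> powr p))"
      using \<kappa>(2) Y[of "w x" "u x"] Y[of "w x" "u y"] by (intro mult_left_mono) (auto simp: distrib_left)
    finally show "\<bar>?g z\<bar> \<le> (\<lambda>(x, y). \<kappa> x y * \<bar>w x\<bar> powr q) z + (\<lambda>(x, y). \<kappa> x y * \<bar>w x\<bar> powr q) z
      + ((\<lambda>(x, y). \<kappa> x y * \<bar>u x\<bar> powr p) z + (\<lambda>(x, y). \<kappa> x y * \<bar>u y\<bar> powr p) z)"
      by (simp add: z algebra_simps)
  qed
  have row: "(\<Sum>\<^sub>\<infinity>y. \<mu> x y * w x * (u x - u y)) = w x * lap u x * m x" for x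
  proof -
    have "(\<Sum>\<^sub>\<infinity>y. \<mu> x y * w x * (u x - u y)) = (\<Sum>\<^sub>\<infinity>y. w x * (\<mu> x y * (u x - u y)))"
      by (simp add: mult_ac)
    also have "\<dots> = w x * (m x * lap u x)" by (simp add: infsum_cmult_right' lap_eq(2)[OF lp_dom[OF u]])
    finally show ?thesis by (simp add: mult_ac)
  qed
  show "(\<lambda>x. w x * lap u x * m x) summable_on UNIV"
    using summable_on_Sigma_banach[of "\<lambda>x y. \<mu> x y * w x * (u x - u y)" UNIV "\<lambda>_. UNIV"] g by (simp add: row)
  have S: "(\<Sum>\<^sub>\<infinity>x. w x * lap u x * m x) = infsum ?g UNIV"
    using infsum_Sigma'_banach[of "\<lambda>x y. \<mu> x y * w x * (u x - u y)" UNIV "\<lambda>_. UNIV"] g by (simp add: row)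
  have bij: "bij_betw prod.swap (UNIV :: ('a \<times> 'a) set) UNIV" by simp
  have g': "(\<lambda>z. ?g (prod.swap z)) summable_on UNIV" and S': "infsum (\<lambda>z. ?g (prod.swap z)) UNIV = infsum ?g UNIV"
    using g summable_on_reindex_bij_betw[OF bij, of ?g] infsum_reindex_bij_betw[OF bij, of ?g] by auto
  have eq: "(\<lambda>(x, y). \<mu> x y * ((w x - w y) * (u x - u y))) = (\<lambda>z. ?g z + ?g (prod.swap z))"
  proof
    fix z show "(\<lambda>(x, y). \<mu> x y * ((w x - w y) * (u x - u y))) z = ?g z + ?g (prod.swap z)"
    proof (cases z)
      case (Pair x y)
      then show ?thesis by (simp add: mu_sym[of y x] algebra_simps)
    qed
  qed
  show "(\<lambda>(x, y). \<mu> x y * ((w x - w y) * (u x - u y))) summable_on UNIV"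
    unfolding eq by (intro summable_on_add g g')
  show "2 * (\<Sum>\<^sub>\<infinity>x. w x * lap u x * m x) = (\<Sum>\<^sub>\<infinity>(x, y). \<mu> x y * ((w x - w y) * (u x - u y)))"
    unfolding eq infsum_add[OF g g'] S S' by simp
qed

lemma rho_kernel_bound:
  assumes u: "u \<in> V"
  shows "(\<lambda>(x, y). \<mu> x y * (\<rho> x y)\<^sup>2 * (\<bar>u x\<bar> powr p + \<bar>u y\<bar> powr p)) summable_on UNIV"
    and "(\<Sum>\<^sub>\<infinity>(x, y). \<mu> x y * (\<rho> x y)\<^sup>2 * (\<bar>u x\<bar> powr p + \<bar>u y\<bar> powr p)) \<le> 2 * N u powr p"
proof -
  have sym: "\<mu> x y * (\<rho> x y)\<^sup>2 = \<mu> y x * (\<rho> y x)\<^sup>2" for x y by (simp add: mu_sym rho_sym)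
  note k = infsum_double_kernel[of "\<lambda>x y. \<mu> x y * (\<rho> x y)\<^sup>2" m "\<lambda>x. \<bar>u x\<bar> powr p",
      OF _ sym rho_kernel _ lp_spaceD[OF u], simplified]
  have eq: "(\<lambda>(x, y). \<mu> x y * (\<rho> x y)\<^sup>2 * (\<bar>u x\<bar> powr p + \<bar>u y\<bar> powr p)) =
    (\<lambda>z. (\<lambda>(x, y). \<mu> x y * (\<rho> x y)\<^sup>2 * \<bar>u x\<bar> powr p) z + (\<lambda>(x, y). \<mu> x y * (\<rho> x y)\<^sup>2 * \<bar>u y\<bar> powr p) z)"
    by (auto simp: fun_eq_iff algebra_simps)
  show "(\<lambda>(x, y). \<mu> x y * (\<rho> x y)\<^sup>2 * (\<bar>u x\<bar> powr p + \<bar>u y\<bar> powr p)) summable_on UNIV"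
    unfolding eq by (intro summable_on_add k)
  show "(\<Sum>\<^sub>\<infinity>(x, y). \<mu> x y * (\<rho> x y)\<^sup>2 * (\<bar>u x\<bar> powr p + \<bar>u y\<bar> powr p)) \<le> 2 * N u powr p"
    unfolding eq infsum_add[OF k(1,3)] using k(2,4) by (simp add: lp_norm_powr)
qed

text \<open>Caccioppoli: the gradient of the cutoff only contributes \<open>O(1 / R\<^sup>2)\<close> because the metric is intrinsic.\<close>
lemma cutoff_pairing:
  assumes u: "u \<in> V" and R: "0 < R"
  shows "- (1 + 1 / (p - 1)) / R\<^sup>2 * N u powr p
    \<le> (\<Sum>\<^sub>\<infinity>x. (cutoff o1 R x)\<^sup>2 * signed_powr (u x) (p - 1) * lap u x * m x)"
proof -
  define w where "w x = (cutoff o1 R x)\<^sup>2 * signed_powr (u x) (p - 1)" for x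
  let ?c = "1 + 1 / (p - 1)"
  have c: "0 \<le> ?c" using p by simp
  \<comment> \<open>The test function lies in the dual space because
    \<open>(p - 1) * (p / (p - 1)) = p\<close>.\<close>
  have w1: "(\<lambda>x. \<bar>w x\<bar> powr (p / (p - 1)) * m x) summable_on UNIV"
  proof (rule summable_on_comparison_test[OF lp_spaceD[OF u]])
    fix x
    have "\<bar>w x\<bar> \<le> \<bar>u x\<bar> powr (p - 1)"
      using cutoff_bounds[OF R, of o1 x] by (auto simp: w_def abs_mult intro!: mult_left_le_one_le power_le_one)
    then have "\<bar>w x\<bar> powr (p / (p - 1)) \<le> (\<bar>u x\<bar> powr (p - 1)) powr (p / (p - 1))"
      using p by (intro powr_mono2) auto
    also have "\<dots> = \<bar>u x\<bar> powr p" using p by (simp add: powr_powr)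
    finally show "\<bar>w x\<bar> powr (p / (p - 1)) * m x \<le> \<bar>u x\<bar> powr p * m x" by (intro mult_right_mono) auto
  qed simp
  have supp: "\<forall>x. w x \<noteq> 0 \<longrightarrow> \<rho> x o1 \<le> R" using cutoff_support[OF R, of o1] by (auto simp: w_def)
  note G = green[OF u w1 supp]
  let ?K = "\<lambda>(x, y). \<mu> x y * (\<rho> x y)\<^sup>2 * (\<bar>u x\<bar> powr p + \<bar>u y\<bar> powr p)"
  have le: "- ?c / R\<^sup>2 * ?K z \<le> (\<lambda>(x, y). \<mu> x y * ((w x - w y) * (u x - u y))) z" for z
  proof -
    obtain x y where z: "z = (x, y)" by (cases z)
    let ?X = "\<bar>u x\<bar> powr p + \<bar>u y\<bar> powr p"
    have "(cutoff o1 R x - cutoff o1 R y)\<^sup>2 \<le> (\<rho> x y / R)\<^sup>2"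
      using cutoff_lipschitz[OF R, of o1 x y] R by (subst abs_le_square_iff[symmetric]) auto
    then have "?c * ((cutoff o1 R x - cutoff o1 R y)\<^sup>2 * ?X) \<le> ?c * ((\<rho> x y / R)\<^sup>2 * ?X)"
      using c by (intro mult_left_mono mult_right_mono) auto
    then have "- (?c * ((\<rho> x y / R)\<^sup>2 * ?X)) \<le> (u x - u y) * (w x - w y)"
      using cutoff_ineq[OF p, of "cutoff o1 R x" "cutoff o1 R y" "u x" "u y"] unfolding w_def mult_minus_left by linarith
    then have "\<mu> x y * - (?c * ((\<rho> x y / R)\<^sup>2 * ?X)) \<le> \<mu> x y * ((u x - u y) * (w x - w y))"
      by (intro mult_left_mono) auto
    moreover have "- c / R\<^sup>2 * (\<mu> x y * (\<rho> x y)\<^sup>2 * X) = \<mu> x y * - (c * ((\<rho> x y / R)\<^sup>2 * X))" for c X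
      by (simp add: power_divide)
    ultimately show ?thesis unfolding z prod.case by (simp only: mult.commute[of "u x - u y"])
  qed
  have "- ?c / R\<^sup>2 * (2 * N u powr p) \<le> - ?c / R\<^sup>2 * infsum ?K UNIV"
    using rho_kernel_bound(2)[OF u] c R by (intro mult_left_mono_neg) (auto simp: divide_nonpos_pos)
  also have "\<dots> = (\<Sum>\<^sub>\<infinity>z. - ?c / R\<^sup>2 * ?K z)" by (simp only: infsum_cmult_right')
  also have "\<dots> \<le> (\<Sum>\<^sub>\<infinity>(x, y). \<mu> x y * ((w x - w y) * (u x - u y)))"
    by (intro infsum_mono summable_on_cmult_right rho_kernel_bound(1) u G le)
  also have "\<dots> = 2 * (\<Sum>\<^sub>\<infinity>x. w x * lap u x * m x)" using G(3) by simp
  finally show ?thesis unfolding w_def by simp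
qed

text \<open>The radius tends to infinity in \<open>cutoff_pairing\<close>. Since \<open>u\<close>
  and \<open>lap u\<close> are both in L^p, \<open>mult_powr_le\<close> provides a summable majorant
  for the left out cutoff.\<close>

lemma pairing_nonneg:
  assumes u: "u \<in> lap_dom"
  shows "(\<lambda>x. signed_powr (u x) (p - 1) * lap u x * m x) summable_on UNIV"
    and "0 \<le> (\<Sum>\<^sub>\<infinity>x. signed_powr (u x) (p - 1) * lap u x * m x)"
proof -
  have uV: "u \<in> V" "lap u \<in> V" using u by (auto simp: lap_dom_def)
  let ?h = "\<lambda>x. \<bar>lap u x\<bar> powr p * m x + \<bar>u x\<bar> powr p * m x"
  have h: "?h summable_on UNIV" by (intro summable_on_add lp_spaceD uV)
  \<comment> \<open>The centre of the cutoffs is an arbitrary vertex.\<close>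
  define o1 :: 'a where "o1 = undefined"
  let ?f = "\<lambda>n x. (cutoff o1 (real (Suc n)) x)\<^sup>2 * signed_powr (u x) (p - 1) * lap u x * m x"
  have le: "\<bar>?f n x\<bar> \<le> ?h x" for n x
  proof -
    have "\<bar>?f n x\<bar> = (cutoff o1 (real (Suc n)) x)\<^sup>2 * (\<bar>lap u x\<bar> * \<bar>u x\<bar> powr (p - 1) * m x)"
      by (simp add: abs_mult mult_ac)
    also have "\<dots> \<le> 1 * (\<bar>lap u x\<bar> * \<bar>u x\<bar> powr (p - 1) * m x)"
      using cutoff_bounds[of "real (Suc n)" o1 x] by (intro mult_right_mono power_le_one) auto
    also have "\<dots> \<le> (\<bar>lap u x\<bar> powr p + \<bar>u x\<bar> powr p) * m x"
      using mult_powr_le[OF p, of "\<bar>lap u x\<bar>" "\<bar>u x\<bar>"] by (simp add: mult_right_mono)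
    finally show ?thesis by (simp add: distrib_right)
  qed
  have lim: "(\<lambda>n. ?f n x) \<longlonglongrightarrow> 1\<^sup>2 * signed_powr (u x) (p - 1) * lap u x * m x" for x
    by (intro tendsto_intros cutoff_tendsto)
  note D = infsum_dominated_convergence[of ?h ?f "\<lambda>x. signed_powr (u x) (p - 1) * lap u x * m x", OF h le]
  show "(\<lambda>x. signed_powr (u x) (p - 1) * lap u x * m x) summable_on UNIV"
    using lim by (intro D(1)) simp
  have "(\<lambda>n. infsum (?f n) UNIV) \<longlonglongrightarrow> (\<Sum>\<^sub>\<infinity>x. signed_powr (u x) (p - 1) * lap u x * m x)"
    using lim by (intro D(2)) simp
  moreover have "(\<lambda>n. - (1 + 1 / (p - 1)) * N u powr p * (inverse (real (Suc n)))\<^sup>2) \<longlonglongrightarrow> - (1 + 1 / (p - 1)) * N u powr p * 0\<^sup>2"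
    by (intro tendsto_mult_left tendsto_power LIMSEQ_inverse_real_of_nat)
  then have "(\<lambda>n. - (1 + 1 / (p - 1)) / (real (Suc n))\<^sup>2 * N u powr p) \<longlonglongrightarrow> 0"
    by (simp add: divide_inverse power_inverse mult_ac)
  ultimately show "0 \<le> (\<Sum>\<^sub>\<infinity>x. signed_powr (u x) (p - 1) * lap u x * m x)"
    by (rule tendsto_le[OF sequentially_bot]) (intro always_eventually allI cutoff_pairing uV, simp)
qed

text \<open>The tangent inequality for the p-th power at \<open>u x\<close> in direction
  \<open>h * lap u x\<close>, summed over the graph; its linear term is the nonnegative
  pairing.\<close>

lemma lap_accretive:
  assumes u: "u \<in> lap_dom" and h: "0 < h"
  shows "N u \<le> N (\<lambda>x. u x + h * lap u x)"
proof (rule lp_norm_leI)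
  have uV: "u \<in> V" "lap u \<in> V" using u by (auto simp: lap_dom_def)
  have s1: "(\<lambda>x. \<bar>u x\<bar> powr p * m x) summable_on UNIV" by (intro lp_spaceD uV)
  have s2: "(\<lambda>x. p * h * (signed_powr (u x) (p - 1) * lap u x * m x)) summable_on UNIV"
    by (intro summable_on_cmult_right pairing_nonneg u)
  have "(\<Sum>\<^sub>\<infinity>x. \<bar>u x\<bar> powr p * m x) \<le> (\<Sum>\<^sub>\<infinity>x. \<bar>u x\<bar> powr p * m x) + p * h * (\<Sum>\<^sub>\<infinity>x. signed_powr (u x) (p - 1) * lap u x * m x)"
    using pairing_nonneg[OF u] p h by simp
  also have "\<dots> = (\<Sum>\<^sub>\<infinity>x. \<bar>u x\<bar> powr p * m x + p * h * (signed_powr (u x) (p - 1) * lap u x * m x))"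
    using infsum_add[OF s1 s2] by (simp only: infsum_cmult_right')
  also have "\<dots> \<le> (\<Sum>\<^sub>\<infinity>x. \<bar>u x + h * lap u x\<bar> powr p * m x)"
  proof (intro infsum_mono summable_on_add s1 s2 lp_spaceD lp_space_add lp_space_scale uV)
    fix x
    have "(\<bar>u x\<bar> powr p + p * signed_powr (u x) (p - 1) * (u x + h * lap u x - u x)) * m x \<le> \<bar>u x + h * lap u x\<bar> powr p * m x"
      by (intro mult_right_mono tangent_signed_powr p) auto
    then show "\<bar>u x\<bar> powr p * m x + p * h * (signed_powr (u x) (p - 1) * lap u x * m x) \<le> \<bar>u x + h * lap u x\<bar> powr p * m x"
      by (simp add: algebra_simps)
  qed
  also have "\<dots> = N (\<lambda>x. u x + h * lap u x) powr p" by (simp add: lp_norm_powr)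
  finally show "(\<Sum>\<^sub>\<infinity>x. \<bar>u x\<bar> powr p * m x) \<le> N (\<lambda>x. u x + h * lap u x) powr p" .
qed simp

section \<open>Solving the resolvent equation\<close>

lemma resolvent_point_lp: assumes "u \<in> laplacian_dom \<mu>" "\<And>x. 0 \<le> u x \<and> u x \<le> 1" "(\<lambda>x. u x * m x) summable_on UNIV"
  shows "u \<in> V"
  unfolding lp_space_def mem_Collect_eq
proof (rule summable_on_comparison_test[OF assms(3)])
  fix x
  have "\<bar>u x\<bar> powr p \<le> u x powr 1"
    using assms(2)[of x] p powr_mono'[of 1 p "u x"] by simp
  then show "\<bar>u x\<bar> powr p * m x \<le> u x * m x" using assms(2)[of x] by (intro mult_right_mono) auto
qed simp

lemma resolvent_V: "u \<in> V \<Longrightarrow> (\<lambda>x. u x + h * lap u x) \<in> V \<Longrightarrow> h \<noteq> 0 \<Longrightarrow> u \<in> lap_dom"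
  using lp_space_scale[OF lp_space_diff[of "\<lambda>x. u x + h * lap u x" u], of "1 / h"]
  by (simp add: lap_dom_def)

end

text \<open>One and the same solution serves for every exponent \<open>p\<close>; this is what later
  identifies the resolvents on different L^p spaces.\<close>

lemma (in intrinsic_graph) resolvent_finitely_supported:
  assumes h: "0 < h" and f: "f \<in> finitely_supported"
  shows "\<exists>u. (\<forall>p>1. u \<in> lp_space m p) \<and> (\<lambda>x. u x + h * lap u x) = f"
  using f
proof (induction rule: finitely_supported_induct)
  case zero
  have "lap (\<lambda>_. 0) = (\<lambda>_. 0)" by (simp add: formal_laplacian_def)
  then show ?case by (intro exI[of _ "\<lambda>_. 0"]) (auto simp: lp_space_def)
next
  case (add f z c)
  then obtain u where u: "\<And>p. 1 < p \<Longrightarrow> u \<in> lp_space m p" "(\<lambda>x. u x + h * lap u x) = f" by blast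
  obtain v where v: "v \<in> laplacian_dom \<mu>" "\<And>x. 0 \<le> v x \<and> v x \<le> 1" "(\<lambda>x. v x * m x) summable_on UNIV"
    "(\<lambda>x. v x + h * lap v x) = (\<lambda>x. if x = z then 1 else 0)"
    using resolvent_point[OF h] by metis
  have "(\<lambda>x. u x + c * v x) \<in> lp_space m p" if "1 < p" for p
  proof -
    interpret intrinsic_graph_lp \<mu> m \<rho> p by standard (rule that)
    show ?thesis by (intro lp_space_add lp_space_scale resolvent_point_lp v u that)
  qed
  moreover have "lap (\<lambda>x. u x + c * v x) = (\<lambda>x. lap u x + c * lap v x)"
  proof -
    \<comment> \<open>Any exponent would do: the interpretation only places \<open>u\<close> in the
      domain of the formal Laplacian.\<close>
    interpret intrinsic_graph_lp \<mu> m \<rho> 2 by standard simp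
    show ?thesis using dom_linear(2)[OF lp_dom[OF u(1)] v(1), of 1 c] by simp
  qed
  then have "(\<lambda>x. u x + c * v x + h * lap (\<lambda>x. u x + c * v x) x) = (\<lambda>x. (u x + h * lap u x) + c * (v x + h * lap v x))"
    by (simp add: algebra_simps)
  moreover have "\<dots> = (\<lambda>x. f x + c * (if x = z then 1 else 0))"
    by (simp only: fun_cong[OF u(2)] fun_cong[OF v(4)])
  ultimately show ?case by (intro exI[of _ "\<lambda>x. u x + c * v x"]) auto
qed

context intrinsic_graph_lp
begin

lemma lap_diff: "u \<in> V \<Longrightarrow> v \<in> V \<Longrightarrow> lap (\<lambda>x. u x - v x) = (\<lambda>x. lap u x - lap v x)"
  using lap_linear[of u v 1 "-1"] by simp

text \<open>Accretivity bounds the distance of two solutions by that of their right sides, so the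
  solutions for truncated \<open>f\<close> form a Cauchy sequence. Continuity of the row sums on L^p
  passes the equation to the limit at each vertex.\<close>

lemma resolvent_surjective:
  assumes f: "f \<in> V" and h: "0 < h"
  shows "\<exists>u\<in>lap_dom. (\<lambda>x. u x + h * lap u x) = f"
proof -
  have "\<exists>F. finite F \<and> N (\<lambda>x. f x - truncate f F x) < 1 / real (Suc n)" for n
  proof -
    have "\<forall>\<^sub>F F in finite_subsets_at_top UNIV. N (\<lambda>x. f x - truncate f F x) < 1 / real (Suc n)"
      by (rule order_tendstoD[OF truncate_tendsto[OF f]]) simp
    then show ?thesis by (auto simp: eventually_finite_subsets_at_top)
  qed
  then obtain F where F: "\<And>n. finite (F n)" "\<And>n. N (\<lambda>x. f x - truncate f (F n) x) < 1 / real (Suc n)" by metis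
  define g where "g n = truncate f (F n)" for n
  have gfs: "g n \<in> finitely_supported" for n unfolding g_def by (intro truncate_finitely_supported F)
  have gV: "g n \<in> V" for n by (intro finitely_supported_lp gfs)
  have glim: "(\<lambda>n. N (\<lambda>x. g n x - f x)) \<longlonglongrightarrow> 0"
  proof (rule Lim_null_comparison[OF _ LIMSEQ_inverse_real_of_nat], rule always_eventually, rule allI)
    fix n
    have "N (\<lambda>x. g n x - f x) = N (\<lambda>x. f x - g n x)"
      by (simp add: lp_norm_def abs_minus_commute)
    then show "norm (N (\<lambda>x. g n x - f x)) \<le> inverse (real (Suc n))"
      using F(2)[of n] by (simp add: g_def inverse_eq_divide)
  qed
  obtain u where u: "\<And>n p. 1 < p \<Longrightarrow> u n \<in> lp_space m p" "\<And>n. (\<lambda>x. u n x + h * lap (u n) x) = g n"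
    using resolvent_finitely_supported[OF h gfs] by metis
  have uV: "u n \<in> V" for n using u(1) p by blast
  have uD: "u n \<in> lap_dom" for n using resolvent_V[OF uV[of n], of h] u(2)[of n] gV[of n] h by simp
  have contr: "N (\<lambda>x. u i x - u j x) \<le> N (\<lambda>x. g i x - g j x)" for i j
  proof -
    have "(\<lambda>x. u i x - u j x) \<in> lap_dom" using lap_dom_linear[OF uD uD, of 1 i "-1" j] by simp
    from lap_accretive[OF this h] have "N (\<lambda>x. u i x - u j x) \<le> N (\<lambda>x. (u i x + h * lap (u i) x) - (u j x + h * lap (u j) x))"
      by (simp add: lap_diff uV algebra_simps)
    also have "(\<lambda>x. (u i x + h * lap (u i) x) - (u j x + h * lap (u j) x)) = (\<lambda>x. g i x - g j x)"
      using fun_cong[OF u(2)[of i]] fun_cong[OF u(2)[of j]] by simp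
    finally show ?thesis .
  qed
  have "\<exists>l\<in>V. (\<lambda>n. N (\<lambda>x. u n x - l x)) \<longlonglongrightarrow> 0"
  proof (rule lp_complete[OF uV])
    fix e :: real assume "0 < e"
    then have "\<forall>\<^sub>F n in sequentially. N (\<lambda>x. g n x - f x) < e / 2" using order_tendstoD(2)[OF glim, of "e/2"] by simp
    then obtain M where M: "\<And>n. n \<ge> M \<Longrightarrow> N (\<lambda>x. g n x - f x) < e / 2" by (auto simp: eventually_sequentially)
    have "N (\<lambda>x. u i x - u j x) < e" if "i \<ge> M" "j \<ge> M" for i j
    proof -
      have "N (\<lambda>x. u i x - u j x) \<le> N (\<lambda>x. (g i x - f x) + (-1) * (g j x - f x))" using contr[of i j] by simp
      also have "\<dots> \<le> N (\<lambda>x. g i x - f x) + N (\<lambda>x. (-1) * (g j x - f x))"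
        by (intro lp_norm_triangle lp_space_scale lp_space_diff gV f)
      also have "\<dots> < e" unfolding lp_norm_scale using M[OF that(1)] M[OF that(2)] by simp
      finally show ?thesis .
    qed
    then show "\<exists>M. \<forall>i\<ge>M. \<forall>j\<ge>M. N (\<lambda>x. u i x - u j x) < e" by blast
  qed
  then obtain v where v: "v \<in> V" "(\<lambda>n. N (\<lambda>x. u n x - v x)) \<longlonglongrightarrow> 0" by blast
  have "v x + h * lap v x = f x" for x
  proof -
    have ux: "(\<lambda>n. u n x) \<longlonglongrightarrow> v x" by (rule lp_pointwise_tendsto[OF lp_space_diff[OF uV v(1)] v(2)])
    have gx: "(\<lambda>n. g n x) \<longlonglongrightarrow> f x" by (rule lp_pointwise_tendsto[OF lp_space_diff[OF gV f] glim])
    have "(\<lambda>n. u n x + h * ((deg x * u n x - (\<Sum>\<^sub>\<infinity>y. \<mu> x y * u n y)) / m x)) \<longlonglongrightarrow>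
      v x + h * ((deg x * v x - (\<Sum>\<^sub>\<infinity>y. \<mu> x y * v y)) / m x)"
      by (intro tendsto_intros ux row_tendsto uV v) simp
    then have "(\<lambda>n. u n x + h * lap (u n) x) \<longlonglongrightarrow> v x + h * lap v x"
      by (simp add: lap_eq_divide lp_dom uV v)
    then have "(\<lambda>n. g n x) \<longlonglongrightarrow> v x + h * lap v x" using fun_cong[OF u(2)] by simp
    then show ?thesis using LIMSEQ_unique[OF gx] by simp
  qed
  then have "(\<lambda>x. v x + h * lap v x) = f" by auto
  then show ?thesis using resolvent_V[OF v(1), of h] f h by auto
qed

lemma N_fun: "N (\<lambda>x. f x - g x) = N (f - g)" "N (\<lambda>x. c * f x) = N (c *\<^sub>R f)"
  by (simp_all add: fun_diff_def scaleR_fun_def)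

sublocale m_accretive V N lap_dom lap
proof
  have V0: "0 \<in> V" using finitely_supported_lp[of 0] by (simp add: finitely_supported_def)
  show "subspace V"
    unfolding subspace_def using V0 lp_space_add lp_space_scale
    by (auto simp: plus_fun_def scaleR_fun_def)
  show "0 \<le> N f" for f by simp
  show "N (f + g) \<le> N f + N g" if "f \<in> V" "g \<in> V" for f g
    using lp_norm_triangle[OF that] by (simp add: plus_fun_def)
  show "N (c *\<^sub>R f) = \<bar>c\<bar> * N f" for c f using lp_norm_scale by (simp add: scaleR_fun_def)
  show "f = 0" if "f \<in> V" "N f = 0" for f using lp_norm_eq_0[OF that] by auto
  show "\<exists>l\<in>V. (\<lambda>n. N (X n - l)) \<longlonglongrightarrow> 0"
    if "\<And>n. X n \<in> V" "\<And>e. 0 < e \<Longrightarrow> \<exists>M. \<forall>i\<ge>M. \<forall>j\<ge>M. N (X i - X j) < e" for X :: "nat \<Rightarrow> 'a \<Rightarrow> real"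
    using lp_complete[of X] that by (simp add: N_fun)
  have "0 \<in> lap_dom" using finitely_supported_lap_dom[of 0] by (simp add: finitely_supported_def)
  then show "subspace lap_dom"
    unfolding subspace_def using lap_dom_linear[of _ _ 1 1] lap_dom_linear[of _ 0 _ 0]
    by (auto simp: plus_fun_def scaleR_fun_def)
  show "lap_dom \<subseteq> V" by (auto simp: lap_dom_def)
  show "lap u \<in> V" if "u \<in> lap_dom" for u using that by (simp add: lap_dom_def)
  show "lap (u + v) = lap u + lap v" if "u \<in> lap_dom" "v \<in> lap_dom" for u v
    using lap_linear[of u v 1 1] that by (simp add: plus_fun_def lap_dom_def)
  show "lap (c *\<^sub>R u) = c *\<^sub>R lap u" if "u \<in> lap_dom" for u c
    using lap_linear[of u u c 0] that by (simp add: scaleR_fun_def lap_dom_def)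
  show "N u \<le> N (u + h *\<^sub>R lap u)" if "u \<in> lap_dom" "0 < h" for u h
    using lap_accretive[OF that] by (simp add: plus_fun_def scaleR_fun_def)
  show "\<exists>u\<in>lap_dom. u + h *\<^sub>R lap u = f" if "f \<in> V" "0 < h" for f h
    using resolvent_surjective[OF that] by (simp add: plus_fun_def scaleR_fun_def)
  show "\<exists>u\<in>lap_dom. N (f - u) < e" if f: "f \<in> V" and e: "0 < e" for f e
  proof -
    have "\<forall>\<^sub>F F in finite_subsets_at_top UNIV. N (\<lambda>x. f x - truncate f F x) < e"
      by (rule order_tendstoD(2)[OF truncate_tendsto[OF f] e])
    then obtain F where F: "finite F" "N (\<lambda>x. f x - truncate f F x) < e" by (auto simp: eventually_finite_subsets_at_top)
    then show ?thesis
      using finitely_supported_lap_dom[OF truncate_finitely_supported[OF F(1), of f]] by (auto simp: N_fun intro!: bexI)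
  qed
qed

end

section \<open>The Dirichlet form\<close>

lemma infsum_Cauchy_Schwarz:
  fixes a b :: "'a \<Rightarrow> real"
  assumes a: "(\<lambda>z. (a z)\<^sup>2) summable_on UNIV" and b: "(\<lambda>z. (b z)\<^sup>2) summable_on UNIV"
  shows "(\<lambda>z. a z * b z) summable_on UNIV"
    and "(\<Sum>\<^sub>\<infinity>z. a z * b z)\<^sup>2 \<le> (\<Sum>\<^sub>\<infinity>z. (a z)\<^sup>2) * (\<Sum>\<^sub>\<infinity>z. (b z)\<^sup>2)"
proof -
  show s: "(\<lambda>z. a z * b z) summable_on UNIV"
  proof (rule summable_on_comparison_abs[OF summable_on_add[OF a b]])
    fix z
    have "2 * \<bar>a z\<bar> * \<bar>b z\<bar> \<le> (a z)\<^sup>2 + (b z)\<^sup>2" using sum_squares_bound[of "\<bar>a z\<bar>" "\<bar>b z\<bar>"] by simp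
    moreover have "0 \<le> \<bar>a z\<bar> * \<bar>b z\<bar>" by simp
    ultimately show "\<bar>a z * b z\<bar> \<le> (a z)\<^sup>2 + (b z)\<^sup>2" by (simp only: abs_mult)
  qed
  show "(\<Sum>\<^sub>\<infinity>z. a z * b z)\<^sup>2 \<le> (\<Sum>\<^sub>\<infinity>z. (a z)\<^sup>2) * (\<Sum>\<^sub>\<infinity>z. (b z)\<^sup>2)"
  proof (rule tendsto_upperbound)
    show "((\<lambda>F. (sum (\<lambda>z. a z * b z) F)\<^sup>2) \<longlongrightarrow> (\<Sum>\<^sub>\<infinity>z. a z * b z)\<^sup>2) (finite_subsets_at_top UNIV)"
      by (intro tendsto_power infsum_tendsto s)
    show "\<forall>\<^sub>F F in finite_subsets_at_top UNIV. (sum (\<lambda>z. a z * b z) F)\<^sup>2 \<le> (\<Sum>\<^sub>\<infinity>z. (a z)\<^sup>2) * (\<Sum>\<^sub>\<infinity>z. (b z)\<^sup>2)"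
    proof (rule eventually_finite_subsets_at_top_weakI)
      fix F :: "'a set" assume F: "finite F"
      have "(sum (\<lambda>z. a z * b z) F)\<^sup>2 \<le> (\<Sum>z\<in>F. (a z)\<^sup>2) * (\<Sum>z\<in>F. (b z)\<^sup>2)" by (rule Cauchy_Schwarz_ineq_sum)
      also have "\<dots> \<le> (\<Sum>\<^sub>\<infinity>z. (a z)\<^sup>2) * (\<Sum>\<^sub>\<infinity>z. (b z)\<^sup>2)"
        using F a b by (intro mult_mono finite_sum_le_infsum sum_nonneg infsum_nonneg) auto
      finally show "(sum (\<lambda>z. a z * b z) F)\<^sup>2 \<le> (\<Sum>\<^sub>\<infinity>z. (a z)\<^sup>2) * (\<Sum>\<^sub>\<infinity>z. (b z)\<^sup>2)" .
    qed
  qed simp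
qed

lemma infsum_ennreal_eq:
  fixes f :: "'a \<Rightarrow> real"
  assumes "f summable_on UNIV" "\<And>x. 0 \<le> f x"
  shows "(\<Sum>\<^sub>\<infinity>x. ennreal (f x)) = ennreal (infsum f UNIV)"
  using infsum_nonneg_is_SUPREMUM_ennreal[OF assms] assms(2)
  by (subst nonneg_infsum_complete) (simp_all add: sum_ennreal)

context intrinsic_graph
begin

interpretation L2: intrinsic_graph_lp \<mu> m \<rho> 2
  by standard simp

abbreviation "V2 \<equiv> lp_space m 2"
abbreviation "N2 \<equiv> lp_norm m 2"

subsection \<open>The energy\<close>

text \<open>The weight is distributed as a square root, so the energy is half a squared l2 norm over
  ordered pairs and Cauchy-Schwarz for sums applies to \<open>bil\<close>. Finiteness is recorded
  separately by \<open>fin_energy\<close>, since a divergent real sum would give \<open>en\<close>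
  the value 0.\<close>

definition grad :: "('a \<Rightarrow> real) \<Rightarrow> 'a \<times> 'a \<Rightarrow> real" where
  "grad f = (\<lambda>(x, y). sqrt (\<mu> x y) * (f x - f y))"

definition fin_energy :: "('a \<Rightarrow> real) \<Rightarrow> bool" where
  "fin_energy f \<longleftrightarrow> (\<lambda>z. (grad f z)\<^sup>2) summable_on UNIV"

definition en :: "('a \<Rightarrow> real) \<Rightarrow> real" where
  "en f = (\<Sum>\<^sub>\<infinity>z. (grad f z)\<^sup>2) / 2"

definition bil :: "('a \<Rightarrow> real) \<Rightarrow> ('a \<Rightarrow> real) \<Rightarrow> real" where
  "bil f g = (\<Sum>\<^sub>\<infinity>z. grad f z * grad g z) / 2"

lemma grad_linear: "grad (\<lambda>x. a * f x + b * g x) = (\<lambda>z. a * grad f z + b * grad g z)"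
  by (auto simp: grad_def algebra_simps)

lemma grad_mult: "grad f z * grad g z = (case z of (x, y) \<Rightarrow> \<mu> x y * ((f x - f y) * (g x - g y)))"
  by (cases z) (simp add: grad_def mult_ac flip: real_sqrt_mult)

lemma grad_sq: "(grad f z)\<^sup>2 = (case z of (x, y) \<Rightarrow> \<mu> x y * (f x - f y)\<^sup>2)"
  by (cases z) (simp add: grad_def power_mult_distrib)

lemma en_nonneg [simp]: "0 \<le> en f" unfolding en_def by (simp add: infsum_nonneg)

lemma energy_eq: "fin_energy f \<Longrightarrow> energy \<mu> f = ennreal (en f)"
proof -
  assume f: "fin_energy f"
  have "energy \<mu> f = (1/2) * (\<Sum>\<^sub>\<infinity>z. ennreal ((grad f z)\<^sup>2))"
    unfolding energy_def grad_sq by (simp add: case_prod_unfold)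
  also have "\<dots> = (1/2) * ennreal (\<Sum>\<^sub>\<infinity>z. (grad f z)\<^sup>2)"
    using f by (subst infsum_ennreal_eq) (auto simp: fin_energy_def)
  also have "\<dots> = ennreal (1/2) * ennreal (\<Sum>\<^sub>\<infinity>z. (grad f z)\<^sup>2)"
    using divide_ennreal[of 1 2] by simp
  also have "\<dots> = ennreal (en f)" unfolding en_def by (subst ennreal_mult[symmetric]) (auto simp: infsum_nonneg)
  finally show ?thesis .
qed

lemma fin_energy_linear: assumes "fin_energy f" "fin_energy g"
  shows "fin_energy (\<lambda>x. a * f x + b * g x)"
  unfolding fin_energy_def grad_linear
proof (rule summable_on_comparison_test)
  show "(\<lambda>z. (2 * a\<^sup>2) * (grad f z)\<^sup>2 + (2 * b\<^sup>2) * (grad g z)\<^sup>2) summable_on UNIV"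
    using assms unfolding fin_energy_def by (intro summable_on_add summable_on_cmult_right)
  show "(a * grad f z + b * grad g z)\<^sup>2 \<le> (2 * a\<^sup>2) * (grad f z)\<^sup>2 + (2 * b\<^sup>2) * (grad g z)\<^sup>2" for z
    using sum_squares_bound[of "a * grad f z" "b * grad g z"] by (simp add: power2_sum power_mult_distrib)
qed simp

lemma fin_energy_diff: "fin_energy f \<Longrightarrow> fin_energy g \<Longrightarrow> fin_energy (\<lambda>x. f x - g x)"
  using fin_energy_linear[of f g 1 "-1"] by simp

lemma en_linear: assumes "fin_energy f" "fin_energy g"
  shows "en (\<lambda>x. f x + b * g x) = en f + 2 * b * bil f g + b\<^sup>2 * en g"
proof -
  note fg = assms[unfolded fin_energy_def]
  have "(grad (\<lambda>x. f x + b * g x) z)\<^sup>2 = (grad f z)\<^sup>2 + ((2 * b) * (grad f z * grad g z) + b\<^sup>2 * (grad g z)\<^sup>2)" for z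
    using grad_linear[of 1 f b g] by (simp add: power2_eq_square algebra_simps)
  then have "(\<Sum>\<^sub>\<infinity>z. (grad (\<lambda>x. f x + b * g x) z)\<^sup>2)
      = (\<Sum>\<^sub>\<infinity>z. (grad f z)\<^sup>2 + ((2 * b) * (grad f z * grad g z) + b\<^sup>2 * (grad g z)\<^sup>2))" by simp
  also have "\<dots> = (\<Sum>\<^sub>\<infinity>z. (grad f z)\<^sup>2) + (\<Sum>\<^sub>\<infinity>z. (2 * b) * (grad f z * grad g z) + b\<^sup>2 * (grad g z)\<^sup>2)"
    by (intro infsum_add summable_on_add summable_on_cmult_right fg infsum_Cauchy_Schwarz(1))
  also have "(\<Sum>\<^sub>\<infinity>z. (2 * b) * (grad f z * grad g z) + b\<^sup>2 * (grad g z)\<^sup>2)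
    = (\<Sum>\<^sub>\<infinity>z. (2 * b) * (grad f z * grad g z)) + (\<Sum>\<^sub>\<infinity>z. b\<^sup>2 * (grad g z)\<^sup>2)"
    by (intro infsum_add summable_on_add summable_on_cmult_right fg infsum_Cauchy_Schwarz(1))
  finally show ?thesis by (simp only: en_def bil_def infsum_cmult_right') (simp add: field_simps)
qed

lemma bil_Cauchy_Schwarz: "fin_energy f \<Longrightarrow> fin_energy g \<Longrightarrow> \<bar>bil f g\<bar> \<le> sqrt (en f * en g)"
proof (rule real_le_rsqrt)
  assume "fin_energy f" "fin_energy g"
  then show "\<bar>bil f g\<bar>\<^sup>2 \<le> en f * en g"
    using infsum_Cauchy_Schwarz(2)[of "grad f" "grad g"]
    by (simp add: fin_energy_def bil_def en_def power_divide)
qed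

lemma bil_add_right: "fin_energy f \<Longrightarrow> fin_energy g \<Longrightarrow> fin_energy h \<Longrightarrow> bil f (\<lambda>x. g x + h x) = bil f g + bil f h"
proof -
  assume *: "fin_energy f" "fin_energy g" "fin_energy h"
  have "(\<lambda>z. grad f z * grad (\<lambda>x. g x + h x) z) = (\<lambda>z. grad f z * grad g z + grad f z * grad h z)"
    using grad_linear[of 1 g 1 h] by (simp add: distrib_left)
  then show ?thesis unfolding bil_def
    using infsum_add[OF infsum_Cauchy_Schwarz(1)[of "grad f" "grad g"] infsum_Cauchy_Schwarz(1)[of "grad f" "grad h"]] *
    by (simp add: fin_energy_def)
qed

text \<open>The parallelogram law with the energy of the sum dropped.\<close>

lemma en_diff_le: assumes "fin_energy f" "fin_energy g" "fin_energy h"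
  shows "en (\<lambda>x. f x - g x) \<le> 2 * en (\<lambda>x. f x - h x) + 2 * en (\<lambda>x. g x - h x)"
proof -
  let ?a = "\<lambda>x. f x - h x" and ?b = "\<lambda>x. g x - h x"
  have ab: "fin_energy ?a" "fin_energy ?b" using assms fin_energy_diff by auto
  have "0 \<le> en (\<lambda>x. ?a x + 1 * ?b x)" by simp
  then have "0 \<le> en ?a + 2 * bil ?a ?b + en ?b" unfolding en_linear[OF ab] by simp
  moreover have "en (\<lambda>x. f x - g x) = en (\<lambda>x. ?a x + (-1) * ?b x)" by simp
  then have "en (\<lambda>x. f x - g x) = en ?a - 2 * bil ?a ?b + en ?b" unfolding en_linear[OF ab] by simp
  ultimately show ?thesis by linarith
qed

lemma en_minus: "en (\<lambda>x. f x - g x) = en (\<lambda>x. g x - f x)"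
proof -
  have "(grad (\<lambda>x. f x - g x) z)\<^sup>2 = (grad (\<lambda>x. g x - f x) z)\<^sup>2" for z
    by (cases z) (simp add: grad_sq power2_eq_square[of "_ - _"], simp add: algebra_simps)
  then show ?thesis by (simp add: en_def)
qed

text \<open>Fatou for the squares of \<open>grad\<close>: pointwise convergence suffices for lower
  semicontinuity of the energy.\<close>

lemma en_fatou:
  assumes "\<forall>\<^sub>F n in G. fin_energy (f n) \<and> en (f n) \<le> C" "G \<noteq> bot" "\<And>x. ((\<lambda>n. f n x) \<longlongrightarrow> g x) G"
  shows "fin_energy g" and "en g \<le> C"
proof -
  have ev: "\<forall>\<^sub>F n in G. (\<lambda>z. (grad (f n) z)\<^sup>2) summable_on UNIV \<and> (\<Sum>\<^sub>\<infinity>z. (grad (f n) z)\<^sup>2) \<le> 2 * C"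
    using assms(1) by eventually_elim (auto simp: fin_energy_def en_def)
  have lim: "((\<lambda>n. (grad (f n) z)\<^sup>2) \<longlongrightarrow> (grad g z)\<^sup>2) G" for z
    unfolding grad_def by (cases z) (auto intro!: tendsto_intros assms)
  show "fin_energy g" unfolding fin_energy_def by (rule infsum_fatou(1)[OF ev assms(2) _ lim]) simp
  show "en g \<le> C" using infsum_fatou(2)[OF ev assms(2) _ lim] by (simp add: en_def)
qed

text \<open>On functions supported in a fixed ball the form is a bounded form on L^2: every pair
  that contributes has an endpoint in the ball, where \<mu> agrees with a kernel whose row sums are
  at most \<open>C * m\<close>.\<close>

lemma en_ball_bound:
  "\<exists>C\<ge>0. \<forall>w\<in>V2. (\<forall>x. w x \<noteq> 0 \<longrightarrow> \<rho> x o1 \<le> R) \<longrightarrow> fin_energy w \<and> en w \<le> C * (N2 w)\<^sup>2"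
proof -
  obtain \<kappa> C where \<kappa>: "0 \<le> C" "\<And>x y. 0 \<le> \<kappa> x y" "\<And>x y. \<kappa> x y = \<kappa> y x" "\<And>x. \<kappa> x summable_on UNIV"
    "\<And>x. infsum (\<kappa> x) UNIV \<le> C * m x" "\<And>x y. \<rho> x o1 \<le> R \<Longrightarrow> \<kappa> x y = \<mu> x y"
    using L2.ball_kernel by metis
  have "fin_energy w \<and> en w \<le> (2 * C) * (N2 w)\<^sup>2" if w: "w \<in> V2" and supp: "\<And>x. w x \<noteq> 0 \<Longrightarrow> \<rho> x o1 \<le> R" for w
  proof -
    have wC: "(\<lambda>x. (w x)\<^sup>2 * (C * m x)) summable_on UNIV"
      using summable_on_cmult_right[OF L2.lp_spaceD[OF w], of C] by (simp add: mult_ac)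
    note k = infsum_double_kernel[of \<kappa> "\<lambda>x. C * m x" "\<lambda>x. (w x)\<^sup>2", OF \<kappa>(2,3,4,5) _ wC, simplified]
    let ?g = "\<lambda>z. 2 * ((\<lambda>(x, y). \<kappa> x y * (w x)\<^sup>2) z + (\<lambda>(x, y). \<kappa> x y * (w y)\<^sup>2) z)"
    have g: "?g summable_on UNIV" by (intro summable_on_cmult_right summable_on_add k)
    have le: "(grad w z)\<^sup>2 \<le> ?g z" for z
    proof -
      obtain x y where z: "z = (x, y)" by (cases z)
      have "(w x - w y)\<^sup>2 \<le> 2 * ((w x)\<^sup>2 + (w y)\<^sup>2)"
        using sum_squares_bound[of "w x" "- w y"] by (simp add: power2_diff)
      then have "\<kappa> x y * (w x - w y)\<^sup>2 \<le> \<kappa> x y * (2 * ((w x)\<^sup>2 + (w y)\<^sup>2))"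
        using \<kappa>(2) by (intro mult_left_mono)
      moreover have "\<mu> x y * (w x - w y)\<^sup>2 = \<kappa> x y * (w x - w y)\<^sup>2"
        using \<kappa>(6)[of x y] \<kappa>(6)[of y x] \<kappa>(3)[of x y] mu_sym[of x y] supp[of x] supp[of y]
        by (cases "w x = 0"; cases "w y = 0") auto
      moreover have "\<kappa> x y * (2 * ((w x)\<^sup>2 + (w y)\<^sup>2)) = 2 * (\<kappa> x y * (w x)\<^sup>2 + \<kappa> x y * (w y)\<^sup>2)"
        by (simp add: algebra_simps)
      ultimately show ?thesis unfolding z grad_sq prod.case by linarith
    qed
    have fin: "fin_energy w" unfolding fin_energy_def
      by (rule summable_on_comparison_test[OF g]) (use le in auto)
    have "(\<Sum>\<^sub>\<infinity>z. (grad w z)\<^sup>2) \<le> infsum ?g UNIV"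
      using fin by (intro infsum_mono g le) (simp add: fin_energy_def)
    also have "\<dots> = 2 * ((\<Sum>\<^sub>\<infinity>(x, y). \<kappa> x y * (w x)\<^sup>2) + (\<Sum>\<^sub>\<infinity>(x, y). \<kappa> x y * (w y)\<^sup>2))"
      by (simp only: infsum_cmult_right' infsum_add[OF k(1,3)])
    also have "\<dots> \<le> 4 * (\<Sum>\<^sub>\<infinity>x. (w x)\<^sup>2 * (C * m x))" using k(2,4) by simp
    also have "(\<Sum>\<^sub>\<infinity>x. (w x)\<^sup>2 * (C * m x)) = C * (\<Sum>\<^sub>\<infinity>x. \<bar>w x\<bar> powr 2 * m x)"
      by (subst infsum_cmult_right'[symmetric]) (simp add: mult_ac)
    also have "\<dots> = C * (N2 w)\<^sup>2" using L2.lp_norm_powr[of w] by simp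
    finally show ?thesis using fin by (simp add: en_def)
  qed
  then show ?thesis using \<kappa>(1) by (intro exI[of _ "2 * C"]) auto
qed

lemma finite_in_ball: "finite F \<Longrightarrow> \<exists>R. \<forall>x\<in>F. \<rho> x o1 \<le> R"
  by (intro exI[of _ "\<Sum>x\<in>F. \<rho> x o1"]) (auto intro!: member_le_sum)

lemma finitely_supported_in_ball:
  assumes "f \<in> finitely_supported" shows "\<exists>R. \<forall>x. f x \<noteq> 0 \<longrightarrow> \<rho> x o1 \<le> R"
  using finite_in_ball[of "{x. f x \<noteq> 0}" o1] assms by (auto simp: finitely_supported_def)

lemma fin_energy_finitely_supported: assumes f: "f \<in> finitely_supported" shows "fin_energy f"
proof -
  obtain R where "\<And>x. f x \<noteq> 0 \<Longrightarrow> \<rho> x undefined \<le> R" using finitely_supported_in_ball[OF f] by blast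
  then show ?thesis using en_ball_bound[of undefined R] L2.finitely_supported_lp[OF f] by blast
qed

lemma finitely_supported_diff: "f \<in> finitely_supported \<Longrightarrow> g \<in> finitely_supported \<Longrightarrow> (\<lambda>x. f x - g x) \<in> finitely_supported"
  and finitely_supported_add: "f \<in> finitely_supported \<Longrightarrow> g \<in> finitely_supported \<Longrightarrow> (\<lambda>x. f x + g x) \<in> finitely_supported"
  unfolding finitely_supported_def mem_Collect_eq
  by (rule finite_subset[of _ "{x. f x \<noteq> 0} \<union> {x. g x \<noteq> 0}"]; auto)+

subsection \<open>The closure of the form\<close>

text \<open>This is the closability of the form: the Cauchy condition in energy passes to the
  pointwise limit in the second index by \<open>en_fatou\<close>.\<close>

lemma form_approx_limit:
  assumes \<phi>: "form_approx \<mu> m \<phi> u" and u: "u \<in> V2"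
  shows "fin_energy u" and "(\<lambda>n. en (\<lambda>x. \<phi> n x - u x)) \<longlonglongrightarrow> 0"
proof -
  have fs: "\<phi> n \<in> finitely_supported" for n using \<phi> by (simp add: form_approx_def)
  have \<phi>V: "\<phi> n \<in> V2" for n using fs L2.finitely_supported_lp by blast
  have ptw: "(\<lambda>n. \<phi> n x) \<longlonglongrightarrow> u x" for x
    using \<phi> unfolding form_approx_def
    by (intro L2.lp_pointwise_tendsto[OF L2.lp_space_diff[OF \<phi>V u]]) blast
  have *: "\<exists>n0. \<forall>i\<ge>n0. fin_energy (\<lambda>x. \<phi> i x - u x) \<and> en (\<lambda>x. \<phi> i x - u x) \<le> e" if "0 < e" for e
  proof -
    have "0 < ennreal e" using that by simp
    then obtain n0 where n0: "\<And>i j. i \<ge> n0 \<Longrightarrow> j \<ge> n0 \<Longrightarrow> energy \<mu> (\<lambda>x. \<phi> i x - \<phi> j x) < ennreal e"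
      using \<phi> unfolding form_approx_def by blast
    have "fin_energy (\<lambda>x. \<phi> i x - u x) \<and> en (\<lambda>x. \<phi> i x - u x) \<le> e" if i: "i \<ge> n0" for i
    proof -
      have ev: "\<forall>\<^sub>F j in sequentially. fin_energy (\<lambda>x. \<phi> i x - \<phi> j x) \<and> en (\<lambda>x. \<phi> i x - \<phi> j x) \<le> e"
        unfolding eventually_sequentially
      proof (intro exI[of _ n0] allI impI conjI)
        fix j assume j: "n0 \<le> j"
        show fin: "fin_energy (\<lambda>x. \<phi> i x - \<phi> j x)"
          by (intro fin_energy_finitely_supported finitely_supported_diff fs)
        show "en (\<lambda>x. \<phi> i x - \<phi> j x) \<le> e"
          using n0[OF i j] \<open>0 < e\<close> unfolding energy_eq[OF fin] by (simp add: ennreal_less_iff)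
      qed
      have lim: "(\<lambda>j. \<phi> i x - \<phi> j x) \<longlonglongrightarrow> \<phi> i x - u x" for x by (intro tendsto_diff tendsto_const ptw)
      show ?thesis using en_fatou[OF ev _ lim] by simp
    qed
    then show ?thesis by blast
  qed
  obtain i where "fin_energy (\<lambda>x. \<phi> i x - u x)" using *[of 1] by auto
  from fin_energy_diff[OF fin_energy_finitely_supported[OF fs[of i]] this] show "fin_energy u" by simp
  show "(\<lambda>n. en (\<lambda>x. \<phi> n x - u x)) \<longlonglongrightarrow> 0"
  proof (rule tendstoI)
    fix e :: real assume e: "0 < e"
    obtain n0 where "\<And>i. i \<ge> n0 \<Longrightarrow> en (\<lambda>x. \<phi> i x - u x) \<le> e/2" using *[of "e/2"] e by auto
    then show "\<forall>\<^sub>F n in sequentially. dist (en (\<lambda>x. \<phi> n x - u x)) 0 < e"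
      unfolding eventually_sequentially using e by (intro exI[of _ n0]) (fastforce simp: dist_real_def)
  qed
qed

lemma form_approxI:
  assumes fs: "\<And>n. \<phi> n \<in> finitely_supported" and norm: "(\<lambda>n. N2 (\<lambda>x. \<phi> n x - u x)) \<longlonglongrightarrow> 0"
    and fin: "fin_energy u" and lim: "(\<lambda>n. en (\<lambda>x. \<phi> n x - u x)) \<longlonglongrightarrow> 0"
  shows "form_approx \<mu> m \<phi> u"
  unfolding form_approx_def
proof (intro conjI allI impI fs norm)
  fix e :: ennreal assume "0 < e"
  \<comment> \<open>The tolerance is an extended real and may be infinite, in which case
    \<open>r = 1\<close> is taken.\<close>
  then obtain r where r: "0 < r" "ennreal r \<le> e"
    by (cases e rule: ennreal_cases) (auto intro: that[of 1])
  have "\<forall>\<^sub>F n in sequentially. en (\<lambda>x. \<phi> n x - u x) < r / 4" using r by (intro order_tendstoD(2)[OF lim]) auto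
  then obtain n0 where n0: "\<And>n. n \<ge> n0 \<Longrightarrow> en (\<lambda>x. \<phi> n x - u x) < r / 4" by (auto simp: eventually_sequentially)
  have "energy \<mu> (\<lambda>x. \<phi> i x - \<phi> j x) < e" if "n0 \<le> i" "n0 \<le> j" for i j
  proof -
    have f: "fin_energy (\<phi> k)" for k using fs fin_energy_finitely_supported by blast
    have "en (\<lambda>x. \<phi> i x - \<phi> j x) < r"
      using en_diff_le[OF f f fin, of i j] n0[OF that(1)] n0[OF that(2)] by simp
    then have "ennreal (en (\<lambda>x. \<phi> i x - \<phi> j x)) < ennreal r" using r by (simp add: ennreal_less_iff)
    then show ?thesis using energy_eq[OF fin_energy_diff[OF f f], of i j] r by simp
  qed
  then show "\<exists>n0. \<forall>i\<ge>n0. \<forall>j\<ge>n0. energy \<mu> (\<lambda>x. \<phi> i x - \<phi> j x) < e" by blast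
qed

lemma bil_tendsto_0:
  assumes "fin_energy f" "\<And>n. fin_energy (g n)" "(\<lambda>n. en (g n)) \<longlonglongrightarrow> 0"
  shows "(\<lambda>n. bil f (g n)) \<longlonglongrightarrow> 0"
proof (rule Lim_null_comparison)
  show "\<forall>\<^sub>F n in sequentially. norm (bil f (g n)) \<le> sqrt (en f * en (g n))"
    using bil_Cauchy_Schwarz assms by (auto intro!: always_eventually)
  have "(\<lambda>n. sqrt (en f * en (g n))) \<longlonglongrightarrow> sqrt (en f * 0)" by (intro tendsto_intros assms)
  then show "(\<lambda>n. sqrt (en f * en (g n))) \<longlonglongrightarrow> 0" by simp
qed

text \<open>Expanding the energy of \<open>u + (\<phi> n - u)\<close>, the mixed term vanishes by
  Cauchy-Schwarz. The limit is the same for all approximating sequences, so the definite description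
  in \<open>form_Q\<close> denotes \<open>en u\<close>.\<close>

lemma form_approx_energy:
  assumes "form_approx \<mu> m \<phi> u" "u \<in> V2"
  shows "(\<lambda>n. enn2real (energy \<mu> (\<phi> n))) \<longlonglongrightarrow> en u"
proof -
  note L = form_approx_limit[OF assms]
  have f: "fin_energy (\<phi> n)" for n
    using assms(1) fin_energy_finitely_supported by (auto simp: form_approx_def)
  have d: "fin_energy (\<lambda>x. \<phi> n x - u x)" for n by (rule fin_energy_diff[OF f L(1)])
  have "en (\<phi> n) = en u + 2 * 1 * bil u (\<lambda>x. \<phi> n x - u x) + 1\<^sup>2 * en (\<lambda>x. \<phi> n x - u x)" for n
    using en_linear[OF L(1) d, of 1 n] by simp
  moreover have "enn2real (energy \<mu> (\<phi> n)) = en (\<phi> n)" for n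
    by (simp add: energy_eq[OF f])
  moreover have "(\<lambda>n. en u + 2 * 1 * bil u (\<lambda>x. \<phi> n x - u x) + 1\<^sup>2 * en (\<lambda>x. \<phi> n x - u x)) \<longlonglongrightarrow> en u + 2 * 1 * 0 + 1\<^sup>2 * 0"
    by (intro tendsto_intros bil_tendsto_0 L d)
  ultimately show ?thesis by simp
qed

lemma form_dom_fin: "u \<in> form_dom \<mu> m \<Longrightarrow> fin_energy u"
  using form_approx_limit(1) by (auto simp: form_dom_def)

lemma form_Q_eq: assumes "u \<in> form_dom \<mu> m" shows "form_Q \<mu> m u = en u"
  unfolding form_Q_def
proof (rule the_equality)
  obtain \<phi> where \<phi>: "u \<in> V2" "form_approx \<mu> m \<phi> u" using assms by (auto simp: form_dom_def)
  then show "\<exists>\<phi>. form_approx \<mu> m \<phi> u \<and> (\<lambda>n. enn2real (energy \<mu> (\<phi> n))) \<longlonglongrightarrow> en u"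
    using form_approx_energy by blast
  show "q = en u" if "\<exists>\<phi>. form_approx \<mu> m \<phi> u \<and> (\<lambda>n. enn2real (energy \<mu> (\<phi> n))) \<longlonglongrightarrow> q" for q
    using that form_approx_energy \<phi>(1) LIMSEQ_unique by blast
qed

text \<open>Only sums and differences are treated, as these are the arguments of the polarisation
  formula in \<open>form_bilin\<close>.\<close>

lemma form_dom_add:
  assumes "u \<in> form_dom \<mu> m" "v \<in> form_dom \<mu> m" and c: "c = 1 \<or> c = - 1"
  shows "(\<lambda>x. u x + c * v x) \<in> form_dom \<mu> m"
proof -
  obtain \<phi> \<psi> where \<phi>: "u \<in> V2" "form_approx \<mu> m \<phi> u" and \<psi>: "v \<in> V2" "form_approx \<mu> m \<psi> v"
    using assms by (auto simp: form_dom_def)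
  note L\<phi> = form_approx_limit[OF \<phi>(2,1)] and L\<psi> = form_approx_limit[OF \<psi>(2,1)]
  have fs: "\<phi> n \<in> finitely_supported" "\<psi> n \<in> finitely_supported" for n using \<phi> \<psi> by (auto simp: form_approx_def)
  have fV: "\<phi> n \<in> V2" "\<psi> n \<in> V2" for n using fs L2.finitely_supported_lp by blast+
  have V: "(\<lambda>x. u x + c * v x) \<in> V2" using \<phi> \<psi> by (intro L2.lp_space_add L2.lp_space_scale)
  have eq: "(\<lambda>x. \<phi> n x + c * \<psi> n x - (u x + c * v x)) = (\<lambda>x. (\<phi> n x - u x) + c * (\<psi> n x - v x))" for n
    by (auto simp: algebra_simps)
  have "form_approx \<mu> m (\<lambda>n x. \<phi> n x + c * \<psi> n x) (\<lambda>x. u x + c * v x)"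
  proof (rule form_approxI)
    show "(\<lambda>x. \<phi> n x + c * \<psi> n x) \<in> finitely_supported" for n
      using c finitely_supported_add[OF fs] finitely_supported_diff[OF fs] by auto
    show "fin_energy (\<lambda>x. u x + c * v x)" using fin_energy_linear[OF L\<phi>(1) L\<psi>(1), of 1 c] by simp
    have "(\<lambda>n. N2 (\<lambda>x. \<phi> n x - u x) + \<bar>c\<bar> * N2 (\<lambda>x. \<psi> n x - v x)) \<longlonglongrightarrow> 0 + \<bar>c\<bar> * 0"
      using \<phi> \<psi> by (intro tendsto_intros) (auto simp: form_approx_def)
    then have "(\<lambda>n. N2 (\<lambda>x. \<phi> n x - u x) + \<bar>c\<bar> * N2 (\<lambda>x. \<psi> n x - v x)) \<longlonglongrightarrow> 0" by simp
    then show "(\<lambda>n. N2 (\<lambda>x. \<phi> n x + c * \<psi> n x - (u x + c * v x))) \<longlonglongrightarrow> 0"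
      unfolding eq
      by (rule Lim_null_comparison[rotated])
        (use \<phi> \<psi> fV in \<open>auto intro!: always_eventually order_trans[OF L2.lp_norm_triangle] L2.lp_space_diff L2.lp_space_scale simp: L2.lp_norm_scale\<close>)
    show "(\<lambda>n. en (\<lambda>x. \<phi> n x + c * \<psi> n x - (u x + c * v x))) \<longlonglongrightarrow> 0"
      unfolding eq
    proof (rule Lim_null_comparison)
      have "(\<lambda>n. 2 * en (\<lambda>x. \<phi> n x - u x) + 2 * en (\<lambda>x. \<psi> n x - v x)) \<longlonglongrightarrow> 2 * 0 + 2 * 0"
        by (intro tendsto_intros L\<phi> L\<psi>)
      then show "(\<lambda>n. 2 * en (\<lambda>x. \<phi> n x - u x) + 2 * en (\<lambda>x. \<psi> n x - v x)) \<longlonglongrightarrow> 0" by simp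
      have f: "fin_energy (\<lambda>x. \<phi> n x - u x)" "fin_energy (\<lambda>x. \<psi> n x - v x)" for n
        using fin_energy_diff[OF fin_energy_finitely_supported[OF fs(1)] L\<phi>(1)]
          fin_energy_diff[OF fin_energy_finitely_supported[OF fs(2)] L\<psi>(1)] by auto
      have c2: "c\<^sup>2 = 1" using c by auto
      have "en (\<lambda>x. (\<phi> n x - u x) + c * (\<psi> n x - v x)) \<le> 2 * en (\<lambda>x. \<phi> n x - u x) + 2 * en (\<lambda>x. \<psi> n x - v x)" for n
        using en_linear[OF f, of n c n] en_linear[OF f, of n "- c" n]
          en_nonneg[of "\<lambda>x. \<phi> n x - u x + - c * (\<psi> n x - v x)"] c2 by simp
      then show "\<forall>\<^sub>F n in sequentially. norm (en (\<lambda>x. (\<phi> n x - u x) + c * (\<psi> n x - v x)))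
        \<le> 2 * en (\<lambda>x. \<phi> n x - u x) + 2 * en (\<lambda>x. \<psi> n x - v x)" by (auto intro!: always_eventually)
    qed
  qed
  then show ?thesis using V by (auto simp: form_dom_def)
qed

lemma form_bilin_eq: assumes "u \<in> form_dom \<mu> m" "v \<in> form_dom \<mu> m" shows "form_bilin \<mu> m u v = bil u v"
proof -
  have "form_Q \<mu> m (\<lambda>x. u x + v x) = en (\<lambda>x. u x + 1 * v x)" "form_Q \<mu> m (\<lambda>x. u x - v x) = en (\<lambda>x. u x + (-1) * v x)"
    using form_Q_eq[OF form_dom_add[OF assms, of 1]] form_Q_eq[OF form_dom_add[OF assms, of "-1"]] by auto
  then show ?thesis
    using en_linear[OF form_dom_fin[OF assms(1)] form_dom_fin[OF assms(2)], of 1]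
      en_linear[OF form_dom_fin[OF assms(1)] form_dom_fin[OF assms(2)], of "-1"]
    by (simp add: form_bilin_def)
qed

lemma finitely_supported_form_dom: assumes "f \<in> finitely_supported" shows "f \<in> form_dom \<mu> m"
proof -
  have "form_approx \<mu> m (\<lambda>_. f) f"
    using fin_energy_finitely_supported[OF assms] by (intro form_approxI assms) (auto simp: lp_norm_def en_def grad_def)
  then show ?thesis using L2.finitely_supported_lp[OF assms] by (auto simp: form_dom_def)
qed

section \<open>Identification of the form operator\<close>

lemma green_bil:
  assumes "u \<in> V2" "f \<in> finitely_supported"
  shows "bil u f = l2_inner m (lap u) f"
proof -
  obtain R where R: "\<forall>x. f x \<noteq> 0 \<longrightarrow> \<rho> x undefined \<le> R" using finitely_supported_in_ball[OF assms(2)] by blast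
  have "(\<lambda>x. \<bar>f x\<bar> powr (2 / (2 - 1)) * m x) summable_on UNIV"
    using L2.lp_spaceD[OF L2.finitely_supported_lp[OF assms(2)]] by simp
  from L2.green(3)[OF assms(1) this R] show ?thesis
    by (simp add: bil_def l2_inner_def grad_mult mult_ac)
qed

text \<open>Testing with the point mass at \<open>z\<close> reads off the value at \<open>z\<close>,
  so Green's formula identifies \<open>v\<close> with \<open>lap u\<close>; then
  \<open>lap u\<close> inherits square integrability from \<open>v\<close>.\<close>

lemma form_operator_lap:
  assumes "(u, v) \<in> form_operator \<mu> m"
  shows "u \<in> L2.lap_dom" and "v = lap u"
proof -
  have u: "u \<in> form_dom \<mu> m" "u \<in> V2" "v \<in> V2" and uv: "\<And>w. w \<in> form_dom \<mu> m \<Longrightarrow> form_bilin \<mu> m u w = l2_inner m v w"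
    using assms by (auto simp: form_operator_def form_dom_def)
  show "v = lap u"
  proof
    fix z
    let ?d = "\<lambda>x::'a. if x = z then 1 else 0 :: real"
    have d: "?d \<in> finitely_supported" by (simp add: finitely_supported_def)
    have point: "l2_inner m f ?d = f z * m z" for f
      unfolding l2_inner_def by (rule infsumI, rule has_sum_finite_neutralI[of "{z}"]) auto
    have "l2_inner m v ?d = l2_inner m (lap u) ?d"
      using uv[OF finitely_supported_form_dom[OF d]] form_bilin_eq[OF u(1) finitely_supported_form_dom[OF d]]
        green_bil[OF u(2) d] by simp
    then show "v z = lap u z" by (simp add: point)
  qed
  then show "u \<in> L2.lap_dom" using u unfolding L2.lap_dom_def by blast
qed

lemma l2_product:
  assumes "f \<in> V2" "g \<in> V2"
  shows "(\<lambda>x. f x * g x * m x) summable_on UNIV" and "\<bar>l2_inner m f g\<bar> \<le> N2 f * N2 g"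
proof -
  have sq: "(f x * sqrt (m x))\<^sup>2 = \<bar>f x\<bar> powr 2 * m x" for f :: "'a \<Rightarrow> real" and x
    by (simp add: power_mult_distrib)
  have prod: "(f x * sqrt (m x)) * (g x * sqrt (m x)) = f x * g x * m x" for x
    by (simp add: mult_ac)
  have s: "(\<lambda>x. (f x * sqrt (m x))\<^sup>2) summable_on UNIV" "(\<lambda>x. (g x * sqrt (m x))\<^sup>2) summable_on UNIV"
    unfolding sq using assms L2.lp_spaceD by auto
  note CS = infsum_Cauchy_Schwarz[OF s, unfolded prod sq]
  show "(\<lambda>x. f x * g x * m x) summable_on UNIV" by (rule CS(1))
  have "(l2_inner m f g)\<^sup>2 \<le> (N2 f * N2 g)\<^sup>2"
    using CS(2) unfolding L2.lp_norm_powr[symmetric] l2_inner_def by (simp add: power_mult_distrib)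
  then show "\<bar>l2_inner m f g\<bar> \<le> N2 f * N2 g" using abs_le_square_iff[of "l2_inner m f g" "N2 f * N2 g"] by simp
qed

lemma cutoff_mono: "0 < R \<Longrightarrow> R \<le> R' \<Longrightarrow> cutoff o1 R x \<le> cutoff o1 R' x"
  unfolding cutoff_def by (intro max.mono order_refl diff_left_mono divide_left_mono) auto

text \<open>
  The identity behind the estimate is
  \<open>(a u - b v)\<^sup>2 = (a\<^sup>2 u - b\<^sup>2 v) (u - v) + (a - b)\<^sup>2 u v\<close>, where \<open>a, b\<close> are the values of the cutoff.
\<close>
lemma en_cutoff_difference:
  fixes o1 :: 'a
  assumes u: "u \<in> L2.lap_dom" and R: "0 < R" "R \<le> R'"
  defines "\<psi> \<equiv> \<lambda>x. cutoff o1 R' x - cutoff o1 R x"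
  shows "fin_energy (\<lambda>x. \<psi> x * u x)"
    and "en (\<lambda>x. \<psi> x * u x) \<le> (\<Sum>\<^sub>\<infinity>x. (1 - cutoff o1 R x)\<^sup>2 * (\<bar>u x\<bar> * \<bar>lap u x\<bar>) * m x) + 2 / R\<^sup>2 * (N2 u)\<^sup>2"
proof -
  have R': "0 < R'" using R by simp
  have uV: "u \<in> V2" "lap u \<in> V2" using u unfolding L2.lap_dom_def by blast+
  have psi: "0 \<le> \<psi> x" "\<psi> x \<le> 1 - cutoff o1 R x" "\<psi> x \<le> 1" for x
    using cutoff_mono[OF R, of o1 x] cutoff_bounds[OF R', of o1 x] cutoff_bounds[OF R(1), of o1 x] by (auto simp: \<psi>_def)
  have psi2: "(\<psi> x)\<^sup>2 \<le> 1" for x using psi[of x] by (simp add: power_le_one)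
  have supp: "\<psi> x \<noteq> 0 \<Longrightarrow> \<rho> x o1 \<le> R'" for x
    using cutoff_support[OF R', of o1 x] cutoff_support[OF R(1), of o1 x] R
    by (cases "cutoff o1 R x = 0") (auto simp: \<psi>_def)
  \<comment> \<open>Both cutoffs are Lipschitz with constant \<open>1 / R\<close>, as
    \<open>R \<le> R'\<close>; the square of the sum of the constants is
    \<open>4 / R\<^sup>2\<close>.\<close>
  have lip: "(\<psi> x - \<psi> y)\<^sup>2 \<le> 4 / R\<^sup>2 * (\<rho> x y)\<^sup>2" for x y
  proof -
    have "\<rho> x y / R' \<le> \<rho> x y / R" using R by (intro divide_left_mono) auto
    then have "\<bar>\<psi> x - \<psi> y\<bar> \<le> 2 * (\<rho> x y / R)"
      using cutoff_lipschitz[OF R(1), of o1 x y] cutoff_lipschitz[OF R', of o1 x y] unfolding \<psi>_def by linarith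
    then have "\<bar>\<psi> x - \<psi> y\<bar>\<^sup>2 \<le> (2 * (\<rho> x y / R))\<^sup>2" by (intro power_mono) auto
    then show ?thesis by (simp add: power_mult_distrib power_divide)
  qed
  have pV: "(\<lambda>x. \<psi> x * u x) \<in> V2"
    using psi by (intro L2.lp_space_comparison(1)[OF uV(1)]) (auto simp: abs_mult intro!: mult_left_le_one_le)
  show fin: "fin_energy (\<lambda>x. \<psi> x * u x)"
    using en_ball_bound[of o1 R'] pV supp by fastforce
  let ?w = "\<lambda>x. (\<psi> x)\<^sup>2 * u x"
  have wV: "?w \<in> V2"
    using psi2 by (intro L2.lp_space_comparison(1)[OF uV(1)]) (auto simp: abs_mult intro!: mult_left_le_one_le)
  have G1: "(\<lambda>x. \<bar>?w x\<bar> powr (2 / (2 - 1)) * m x) summable_on UNIV" using L2.lp_spaceD[OF wV] by simp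
  have G2: "\<forall>x. ?w x \<noteq> 0 \<longrightarrow> \<rho> x o1 \<le> R'" using supp by auto
  note G = L2.green[OF uV(1) G1 G2]
  let ?K = "\<lambda>(x, y). \<mu> x y * (\<rho> x y)\<^sup>2 * (\<bar>u x\<bar> powr 2 + \<bar>u y\<bar> powr 2)"
  note K = L2.rho_kernel_bound[OF uV(1)]
  have le: "(grad (\<lambda>x. \<psi> x * u x) z)\<^sup>2 \<le> (\<lambda>(x, y). \<mu> x y * ((?w x - ?w y) * (u x - u y))) z + 2 / R\<^sup>2 * ?K z" for z
  proof -
    obtain x y where z: "z = (x, y)" by (cases z)
    have gen: "a * (b + (4 / R\<^sup>2 * r) * (X / 2)) = a * b + 2 / R\<^sup>2 * (a * r * X)" for a b r X :: real
      by (simp add: distrib_left)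
    have "(\<psi> x * u x - \<psi> y * u y)\<^sup>2 = (?w x - ?w y) * (u x - u y) + (\<psi> x - \<psi> y)\<^sup>2 * (u x * u y)"
      by (simp add: power2_eq_square algebra_simps)
    also have "(\<psi> x - \<psi> y)\<^sup>2 * (u x * u y) \<le> (4 / R\<^sup>2 * (\<rho> x y)\<^sup>2) * ((\<bar>u x\<bar> powr 2 + \<bar>u y\<bar> powr 2) / 2)"
      using sum_squares_bound[of "u x" "u y"]
      by (intro order_trans[OF mult_left_mono mult_right_mono[OF lip]]) auto
    finally have "(\<psi> x * u x - \<psi> y * u y)\<^sup>2 \<le> (?w x - ?w y) * (u x - u y)
      + (4 / R\<^sup>2 * (\<rho> x y)\<^sup>2) * ((\<bar>u x\<bar> powr 2 + \<bar>u y\<bar> powr 2) / 2)" by simp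
    then have "\<mu> x y * (\<psi> x * u x - \<psi> y * u y)\<^sup>2 \<le> \<mu> x y * ((?w x - ?w y) * (u x - u y)
      + (4 / R\<^sup>2 * (\<rho> x y)\<^sup>2) * ((\<bar>u x\<bar> powr 2 + \<bar>u y\<bar> powr 2) / 2))" by (intro mult_left_mono) auto
    also have "\<dots> = \<mu> x y * ((?w x - ?w y) * (u x - u y)) + 2 / R\<^sup>2 * (\<mu> x y * (\<rho> x y)\<^sup>2 * (\<bar>u x\<bar> powr 2 + \<bar>u y\<bar> powr 2))"
      by (rule gen)
    finally show ?thesis unfolding z grad_sq prod.case .
  qed
  have "(\<Sum>\<^sub>\<infinity>z. (grad (\<lambda>x. \<psi> x * u x) z)\<^sup>2) \<le>
      (\<Sum>\<^sub>\<infinity>z. (\<lambda>(x, y). \<mu> x y * ((?w x - ?w y) * (u x - u y))) z + 2 / R\<^sup>2 * ?K z)"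
    using fin unfolding fin_energy_def by (intro infsum_mono le summable_on_add summable_on_cmult_right G K)
  also have "\<dots> = 2 * (\<Sum>\<^sub>\<infinity>x. ?w x * lap u x * m x) + 2 / R\<^sup>2 * infsum ?K UNIV"
    using infsum_add[OF G(2) summable_on_cmult_right[OF K(1), of "2 / R\<^sup>2"]] G(3) by (simp only: infsum_cmult_right')
  also have "2 / R\<^sup>2 * infsum ?K UNIV \<le> 2 / R\<^sup>2 * (2 * N2 u powr 2)"
    using K(2) by (intro mult_left_mono) auto
  finally have 1: "en (\<lambda>x. \<psi> x * u x) \<le> (\<Sum>\<^sub>\<infinity>x. ?w x * lap u x * m x) + 2 / R\<^sup>2 * (N2 u)\<^sup>2"
    by (simp add: en_def)
  have aV: "(\<lambda>x. \<bar>u x\<bar>) \<in> V2" "(\<lambda>x. \<bar>lap u x\<bar>) \<in> V2"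
    using L2.lp_space_comparison(1)[OF uV(1), of "\<lambda>x. \<bar>u x\<bar>"] L2.lp_space_comparison(1)[OF uV(2), of "\<lambda>x. \<bar>lap u x\<bar>"]
    by simp_all
  \<comment> \<open>Bounding \<open>\<psi>\<close> by \<open>1 - cutoff o1 R\<close> removes
    \<open>R'\<close> from the estimate, so that \<open>R'\<close> can later tend to
    infinity.\<close>
  have "(\<Sum>\<^sub>\<infinity>x. ?w x * lap u x * m x) \<le> (\<Sum>\<^sub>\<infinity>x. (1 - cutoff o1 R x)\<^sup>2 * (\<bar>u x\<bar> * \<bar>lap u x\<bar>) * m x)"
  proof (rule infsum_mono[OF G(1)])
    show "(\<lambda>x. (1 - cutoff o1 R x)\<^sup>2 * (\<bar>u x\<bar> * \<bar>lap u x\<bar>) * m x) summable_on UNIV"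
      using l2_product(1)[OF aV]
      by (rule summable_on_comparison_test)
        (use cutoff_bounds[OF R(1)] in \<open>auto simp: mult.assoc intro!: mult_left_le_one_le power_le_one\<close>)
    fix x
    have "?w x * lap u x \<le> (\<psi> x)\<^sup>2 * (\<bar>u x\<bar> * \<bar>lap u x\<bar>)"
      using abs_ge_self[of "?w x * lap u x"] by (simp add: abs_mult mult_ac)
    also have "\<dots> \<le> (1 - cutoff o1 R x)\<^sup>2 * (\<bar>u x\<bar> * \<bar>lap u x\<bar>)"
      using psi[of x] by (intro mult_right_mono power_mono) auto
    finally show "?w x * lap u x * m x \<le> (1 - cutoff o1 R x)\<^sup>2 * (\<bar>u x\<bar> * \<bar>lap u x\<bar>) * m x"
      by (intro mult_right_mono) auto
  qed
  then show "en (\<lambda>x. \<psi> x * u x) \<le> (\<Sum>\<^sub>\<infinity>x. (1 - cutoff o1 R x)\<^sup>2 * (\<bar>u x\<bar> * \<bar>lap u x\<bar>) * m x) + 2 / R\<^sup>2 * (N2 u)\<^sup>2"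
    using 1 by simp
qed

text \<open>Finite energy of \<open>u\<close> is not known beforehand. The estimate for the
  difference of two cutoffs is uniform in the larger radius, so \<open>en_fatou\<close> carries it
  to \<open>u - w n\<close>; its right side tends to 0 by dominated convergence.\<close>

lemma cutoff_approx:
  fixes o1 :: 'a
  assumes u: "u \<in> L2.lap_dom"
  defines "w \<equiv> \<lambda>n x. cutoff o1 (real (Suc n)) x * u x"
  shows "\<And>n. fin_energy (\<lambda>x. w n x - u x)" and "(\<lambda>n. en (\<lambda>x. w n x - u x)) \<longlonglongrightarrow> 0"
    and "(\<lambda>n. N2 (\<lambda>x. w n x - u x)) \<longlonglongrightarrow> 0"
proof -
  have uV: "u \<in> V2" "lap u \<in> V2" using u unfolding L2.lap_dom_def by blast+
  have aV: "(\<lambda>x. \<bar>u x\<bar>) \<in> V2" "(\<lambda>x. \<bar>lap u x\<bar>) \<in> V2"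
    using L2.lp_space_comparison(1)[OF uV(1), of "\<lambda>x. \<bar>u x\<bar>"] L2.lp_space_comparison(1)[OF uV(2), of "\<lambda>x. \<bar>lap u x\<bar>"]
    by simp_all
  let ?c = "\<lambda>n x. cutoff o1 (real (Suc n)) x"
  have cb: "0 \<le> ?c n x" "?c n x \<le> 1" for n x using cutoff_bounds[of "real (Suc n)" o1 x] by auto
  let ?e = "\<lambda>n. (\<Sum>\<^sub>\<infinity>x. (1 - ?c n x)\<^sup>2 * (\<bar>u x\<bar> * \<bar>lap u x\<bar>) * m x) + 2 / (real (Suc n))\<^sup>2 * (N2 u)\<^sup>2"
  have *: "fin_energy (\<lambda>x. u x - w n x) \<and> en (\<lambda>x. u x - w n x) \<le> ?e n" for n
  proof -
    have ev: "\<forall>\<^sub>F k in sequentially. fin_energy (\<lambda>x. w k x - w n x) \<and> en (\<lambda>x. w k x - w n x) \<le> ?e n"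
      unfolding eventually_sequentially
    proof (intro exI[of _ n] allI impI)
      fix k assume "n \<le> k"
      then show "fin_energy (\<lambda>x. w k x - w n x) \<and> en (\<lambda>x. w k x - w n x) \<le> ?e n"
        using en_cutoff_difference[OF u, of "real (Suc n)" "real (Suc k)" o1]
        by (simp add: w_def left_diff_distrib del: of_nat_Suc)
    qed
    have "(\<lambda>k. w k x) \<longlonglongrightarrow> 1 * u x" for x unfolding w_def by (intro tendsto_intros cutoff_tendsto)
    then have lim: "(\<lambda>k. w k x - w n x) \<longlonglongrightarrow> u x - w n x" for x by (intro tendsto_intros) simp
    show ?thesis using en_fatou[OF ev _ lim] by simp
  qed
  have "fin_energy (\<lambda>x. w n x - u x)" for n
  proof -
    have "fin_energy (\<lambda>x. u x - w n x)" using * by blast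
    from fin_energy_linear[OF this this, of "-1" 0] show ?thesis by simp
  qed
  then show "\<And>n. fin_energy (\<lambda>x. w n x - u x)" .
  have one: "(\<lambda>n. 1 - ?c n x) \<longlonglongrightarrow> 1 - 1" for x by (intro tendsto_intros cutoff_tendsto)
  have sq1: "(1 - ?c n x)\<^sup>2 \<le> 1" for n x using cb[of n x] by (simp add: power_le_one)
  have "(\<lambda>n. \<Sum>\<^sub>\<infinity>x. (1 - ?c n x)\<^sup>2 * (\<bar>u x\<bar> * \<bar>lap u x\<bar>) * m x) \<longlonglongrightarrow> (\<Sum>\<^sub>\<infinity>x. (1 - 1)\<^sup>2 * (\<bar>u x\<bar> * \<bar>lap u x\<bar>) * m x)"
  proof (rule infsum_dominated_convergence(2)[OF l2_product(1)[OF aV]])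
    show "\<bar>(1 - ?c n x)\<^sup>2 * (\<bar>u x\<bar> * \<bar>lap u x\<bar>) * m x\<bar> \<le> \<bar>u x\<bar> * \<bar>lap u x\<bar> * m x" for n x
      using sq1[of n x] by (simp add: abs_mult mult.assoc mult_left_le_one_le del: of_nat_Suc)
    show "(\<lambda>n. (1 - ?c n x)\<^sup>2 * (\<bar>u x\<bar> * \<bar>lap u x\<bar>) * m x) \<longlonglongrightarrow> (1 - 1)\<^sup>2 * (\<bar>u x\<bar> * \<bar>lap u x\<bar>) * m x" for x
      by (intro tendsto_mult_right tendsto_power one)
  qed
  then have a: "(\<lambda>n. \<Sum>\<^sub>\<infinity>x. (1 - ?c n x)\<^sup>2 * (\<bar>u x\<bar> * \<bar>lap u x\<bar>) * m x) \<longlonglongrightarrow> 0" by simp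
  have "(\<lambda>n. 2 * (inverse (real (Suc n)))\<^sup>2 * (N2 u)\<^sup>2) \<longlonglongrightarrow> 2 * 0\<^sup>2 * (N2 u)\<^sup>2"
    by (intro tendsto_mult_right tendsto_mult_left tendsto_power LIMSEQ_inverse_real_of_nat)
  then have b: "(\<lambda>n. 2 / (real (Suc n))\<^sup>2 * (N2 u)\<^sup>2) \<longlonglongrightarrow> 0" by (simp add: divide_inverse power_inverse)
  have e: "?e \<longlonglongrightarrow> 0" using tendsto_add[OF a b] by simp
  show "(\<lambda>n. en (\<lambda>x. w n x - u x)) \<longlonglongrightarrow> 0"
    by (rule Lim_null_comparison[OF _ e]) (use * in \<open>auto intro!: always_eventually simp: en_minus[of "w _" u] simp del: of_nat_Suc\<close>)
  have "(\<lambda>n. \<Sum>\<^sub>\<infinity>x. \<bar>w n x - u x\<bar> powr 2 * m x) \<longlonglongrightarrow> (\<Sum>\<^sub>\<infinity>x. (1 - 1)\<^sup>2 * (\<bar>u x\<bar> powr 2 * m x))"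
  proof (rule infsum_dominated_convergence(2)[OF L2.lp_spaceD[OF uV(1)]])
    have eq: "\<bar>w n x - u x\<bar> powr 2 * m x = (1 - ?c n x)\<^sup>2 * (\<bar>u x\<bar> powr 2 * m x)" for n x
      by (simp add: w_def power2_eq_square algebra_simps del: of_nat_Suc)
    show "\<bar>\<bar>w n x - u x\<bar> powr 2 * m x\<bar> \<le> \<bar>u x\<bar> powr 2 * m x" for n x
      unfolding eq using sq1[of n x] by (simp add: abs_mult mult_left_le_one_le del: of_nat_Suc)
    show "(\<lambda>n. \<bar>w n x - u x\<bar> powr 2 * m x) \<longlonglongrightarrow> (1 - 1)\<^sup>2 * (\<bar>u x\<bar> powr 2 * m x)" for x
      unfolding eq by (intro tendsto_mult_right tendsto_power one)
  qed
  then have "(\<lambda>n. (N2 (\<lambda>x. w n x - u x))\<^sup>2) \<longlonglongrightarrow> 0"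
    using L2.lp_norm_powr by simp
  then have "(\<lambda>n. sqrt ((N2 (\<lambda>x. w n x - u x))\<^sup>2)) \<longlonglongrightarrow> sqrt 0" by (intro tendsto_real_sqrt)
  then show "(\<lambda>n. N2 (\<lambda>x. w n x - u x)) \<longlonglongrightarrow> 0" by simp
qed

text \<open>Within a ball the energy is controlled by the L^2 norm, so approximation by finitely
  supported functions in L^2 is approximation in energy too. Balls may be infinite sets, so cutting
  off alone does not reach finite support.\<close>

lemma truncation:
  assumes w: "w \<in> V2" and supp: "\<And>x. w x \<noteq> 0 \<Longrightarrow> \<rho> x o1 \<le> R" and e: "0 < e"
  shows "\<exists>g\<in>finitely_supported. fin_energy w \<and> en (\<lambda>x. g x - w x) < e \<and> N2 (\<lambda>x. g x - w x) < e"
proof -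
  obtain C where C: "C \<ge> 0" "\<And>v. v \<in> V2 \<Longrightarrow> (\<And>x. v x \<noteq> 0 \<Longrightarrow> \<rho> x o1 \<le> R) \<Longrightarrow> fin_energy v \<and> en v \<le> C * (N2 v)\<^sup>2"
    using en_ball_bound[of o1 R] by blast
  \<comment> \<open>With \<open>d \<le> 1\<close> the squared norm is at most \<open>d\<close>, and
    the last entry of the minimum makes \<open>C * d\<close> smaller than \<open>e\<close>.\<close>
  define d where "d = min (e / 2) (min 1 (e / 2 / (C + 1)))"
  have d: "0 < d" "d < e" "d \<le> 1" using e C(1) by (auto simp: d_def)
  have Cd: "C * d < e"
  proof -
    have "C * d \<le> C * (e / 2 / (C + 1))" using C(1) by (intro mult_left_mono) (auto simp: d_def)
    also have "\<dots> \<le> e / 2" using mult_div_le[of "e/2" C] e C(1) by (simp add: mult.commute)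
    finally show ?thesis using e by simp
  qed
  have "\<forall>\<^sub>F F in finite_subsets_at_top UNIV. N2 (\<lambda>x. w x - L2.truncate w F x) < d"
    by (rule order_tendstoD(2)[OF L2.truncate_tendsto[OF w] d(1)])
  then obtain F where F: "finite F" "N2 (\<lambda>x. w x - L2.truncate w F x) < d" by (auto simp: eventually_finite_subsets_at_top)
  let ?g = "L2.truncate w F"
  have g: "?g \<in> finitely_supported" by (rule L2.truncate_finitely_supported[OF F(1)])
  have D: "(\<lambda>x. ?g x - w x) \<in> V2" by (intro L2.lp_space_diff L2.finitely_supported_lp g w)
  have N: "N2 (\<lambda>x. ?g x - w x) < d"
  proof -
    have "N2 (\<lambda>x. ?g x - w x) = N2 (\<lambda>x. w x - ?g x)" by (simp add: lp_norm_def abs_minus_commute)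
    then show ?thesis using F(2) by simp
  qed
  have "en (\<lambda>x. ?g x - w x) \<le> C * (N2 (\<lambda>x. ?g x - w x))\<^sup>2"
    using C(2)[OF D] supp by (auto split: if_splits)
  also have "(N2 (\<lambda>x. ?g x - w x))\<^sup>2 \<le> d"
    using N d(3) L2.lp_nonneg[of "\<lambda>x. ?g x - w x"] mult_mono[of "N2 (\<lambda>x. ?g x - w x)" d "N2 (\<lambda>x. ?g x - w x)" 1]
    by (simp add: power2_eq_square)
  finally have "en (\<lambda>x. ?g x - w x) < e" using Cd C(1) by (smt (verit) mult_left_mono)
  moreover have "fin_energy w" using C(2)[OF w supp] by blast
  ultimately show ?thesis using g N d by (intro bexI[of _ ?g]) auto
qed

text \<open>A diagonal choice: \<open>w n\<close> approximates \<open>u\<close> by cutoffs, and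
  \<open>g n\<close> approximates \<open>w n\<close> with error below \<open>1 / (n + 1)\<close> in
  norm and in energy.\<close>

lemma lap_dom_form_dom: assumes u: "u \<in> L2.lap_dom" shows "u \<in> form_dom \<mu> m"
proof -
  have uV: "u \<in> V2" "lap u \<in> V2" using u unfolding L2.lap_dom_def by blast+
  define o1 :: 'a where "o1 = undefined"
  define w where "w n x = cutoff o1 (real (Suc n)) x * u x" for n x
  note w = cutoff_approx[OF u, of o1, folded w_def]
  have wV: "w n \<in> V2" for n
    using cutoff_bounds[of "real (Suc n)" o1] unfolding w_def
    by (intro L2.lp_space_comparison(1)[OF uV(1)]) (auto simp: abs_mult intro!: mult_left_le_one_le)
  have supp: "w n x \<noteq> 0 \<Longrightarrow> \<rho> x o1 \<le> real (Suc n)" for n x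
    using cutoff_support[of "real (Suc n)" o1 x] by (auto simp: w_def)
  have "\<exists>g\<in>finitely_supported. fin_energy (w n) \<and> en (\<lambda>x. g x - w n x) < inverse (real (Suc n)) \<and> N2 (\<lambda>x. g x - w n x) < inverse (real (Suc n))" for n
    by (rule truncation[OF wV supp]) auto
  then obtain g where g: "\<And>n. g n \<in> finitely_supported" "\<And>n. fin_energy (w n)"
    "\<And>n. en (\<lambda>x. g n x - w n x) < inverse (real (Suc n))" "\<And>n. N2 (\<lambda>x. g n x - w n x) < inverse (real (Suc n))"
    by metis
  have gf: "fin_energy (g n)" for n using g(1) fin_energy_finitely_supported by blast
  have gV: "g n \<in> V2" for n using g(1) L2.finitely_supported_lp by blast
  have fin: "fin_energy u" using fin_energy_diff[OF g(2)[of 0] w(1)[of 0]] by simp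
  have "form_approx \<mu> m g u"
  proof (rule form_approxI[OF g(1) _ fin])
    have "(\<lambda>n. inverse (real (Suc n)) + N2 (\<lambda>x. w n x - u x)) \<longlonglongrightarrow> 0"
      using tendsto_add[OF LIMSEQ_inverse_real_of_nat w(3)] by simp
    then show "(\<lambda>n. N2 (\<lambda>x. g n x - u x)) \<longlonglongrightarrow> 0"
    proof (rule Lim_null_comparison[rotated], intro always_eventually allI)
      fix n
      have "N2 (\<lambda>x. (g n x - w n x) + (w n x - u x)) \<le> N2 (\<lambda>x. g n x - w n x) + N2 (\<lambda>x. w n x - u x)"
        by (intro L2.lp_norm_triangle L2.lp_space_diff gV wV uV)
      then show "norm (N2 (\<lambda>x. g n x - u x)) \<le> inverse (real (Suc n)) + N2 (\<lambda>x. w n x - u x)"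
        using g(4)[of n] by simp
    qed
    have "(\<lambda>n. 2 * inverse (real (Suc n)) + 2 * en (\<lambda>x. w n x - u x)) \<longlonglongrightarrow> 2 * 0 + 2 * 0"
      by (intro tendsto_intros LIMSEQ_inverse_real_of_nat w)
    then have "(\<lambda>n. 2 * inverse (real (Suc n)) + 2 * en (\<lambda>x. w n x - u x)) \<longlonglongrightarrow> 0" by simp
    then show "(\<lambda>n. en (\<lambda>x. g n x - u x)) \<longlonglongrightarrow> 0"
    proof (rule Lim_null_comparison[rotated], intro always_eventually allI)
      fix n
      show "norm (en (\<lambda>x. g n x - u x)) \<le> 2 * inverse (real (Suc n)) + 2 * en (\<lambda>x. w n x - u x)"
        using en_diff_le[OF gf fin g(2), of n n] g(3)[of n] en_minus[of u "w n"] by simp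
    qed
  qed
  then show ?thesis using uV by (auto simp: form_dom_def)
qed

text \<open>For the inclusion not covered by \<open>form_operator_lap\<close>, Green's formula
  against finitely supported functions extends to the whole form domain: both sides are continuous
  along an approximating sequence, one in energy and the other in L^2.\<close>

lemma form_operator_eq: "form_operator \<mu> m = {(u, lap u) | u. u \<in> L2.lap_dom}"
proof -
  have "(u, lap u) \<in> form_operator \<mu> m" if u: "u \<in> L2.lap_dom" for u
  proof -
    have uV: "u \<in> V2" "lap u \<in> V2" using u unfolding L2.lap_dom_def by blast+
    have uF: "u \<in> form_dom \<mu> m" by (rule lap_dom_form_dom[OF u])
    have "form_bilin \<mu> m u w = l2_inner m (lap u) w" if w: "w \<in> form_dom \<mu> m" for w
    proof -
      obtain \<phi> where \<phi>: "w \<in> V2" "form_approx \<mu> m \<phi> w" using w by (auto simp: form_dom_def)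
      have fs: "\<phi> n \<in> finitely_supported" for n using \<phi> by (simp add: form_approx_def)
      have \<phi>V: "\<phi> n \<in> V2" for n using fs L2.finitely_supported_lp by blast
      note L = form_approx_limit[OF \<phi>(2,1)]
      have d: "fin_energy (\<lambda>x. \<phi> n x - w x)" for n
        by (rule fin_energy_diff[OF fin_energy_finitely_supported[OF fs] L(1)])
      have 1: "(\<lambda>n. bil u (\<lambda>x. \<phi> n x - w x)) \<longlonglongrightarrow> 0"
        by (intro bil_tendsto_0 form_dom_fin uF d L)
      have 2: "(\<lambda>n. l2_inner m (lap u) (\<lambda>x. \<phi> n x - w x)) \<longlonglongrightarrow> 0"
      proof (rule Lim_null_comparison)
        show "(\<lambda>n. N2 (lap u) * N2 (\<lambda>x. \<phi> n x - w x)) \<longlonglongrightarrow> 0"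
          using \<phi> by (intro tendsto_mult_right_zero) (simp add: form_approx_def)
        show "\<forall>\<^sub>F n in sequentially. norm (l2_inner m (lap u) (\<lambda>x. \<phi> n x - w x)) \<le> N2 (lap u) * N2 (\<lambda>x. \<phi> n x - w x)"
          using l2_product(2)[OF uV(2) L2.lp_space_diff[OF \<phi>V \<phi>(1)]] by (auto intro!: always_eventually)
      qed
      have "bil u w - l2_inner m (lap u) w = l2_inner m (lap u) (\<lambda>x. \<phi> n x - w x) - bil u (\<lambda>x. \<phi> n x - w x)" for n
      proof -
        have "bil u (\<phi> n) = bil u w + bil u (\<lambda>x. \<phi> n x - w x)"
          using bil_add_right[OF form_dom_fin[OF uF] L(1) d, of n] by simp
        moreover have "l2_inner m (lap u) (\<phi> n) = l2_inner m (lap u) w + l2_inner m (lap u) (\<lambda>x. \<phi> n x - w x)"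
          using infsum_add[OF l2_product(1)[OF uV(2) \<phi>(1)] l2_product(1)[OF uV(2) L2.lp_space_diff[OF \<phi>V[of n] \<phi>(1)]]]
          by (simp add: l2_inner_def algebra_simps)
        ultimately show ?thesis using green_bil[OF uV(1) fs[of n]] by simp
      qed
      moreover have "(\<lambda>n. l2_inner m (lap u) (\<lambda>x. \<phi> n x - w x) - bil u (\<lambda>x. \<phi> n x - w x)) \<longlonglongrightarrow> 0 - 0"
        by (intro tendsto_diff 1 2)
      ultimately have "(\<lambda>n::nat. bil u w - l2_inner m (lap u) w) \<longlonglongrightarrow> 0" by simp
      then have "bil u w = l2_inner m (lap u) w" by (simp add: LIMSEQ_const_iff)
      then show ?thesis using form_bilin_eq[OF uF w] by simp
    qed
    then show ?thesis using uF uV by (simp add: form_operator_def)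
  qed
  then show ?thesis using form_operator_lap by auto
qed

end

section \<open>The generator\<close>

context intrinsic_graph_lp
begin

lemma T_C0_semigroup: "C0_semigroup V N T"
  unfolding C0_semigroup_def
proof (intro conjI allI impI ballI)
  show "T t f \<in> V" if "0 \<le> t" "f \<in> V" for t f using T_V[OF that(2,1)] .
  show "T t (\<lambda>x. a * f x + b * g x) = (\<lambda>x. a * T t f x + b * T t g x)"
    if "0 \<le> t" "f \<in> V" "g \<in> V" for t f g a b
  proof -
    have "T t (a *\<^sub>R f + b *\<^sub>R g) = a *\<^sub>R T t f + b *\<^sub>R T t g"
      using that by (simp only: T_add T_scale V_closed)
    then show ?thesis by (simp add: plus_fun_def scaleR_fun_def)
  qed
  show "\<exists>C. \<forall>f\<in>V. N (T t f) \<le> C * N f" if "0 \<le> t" for t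
    using T_contraction that by (intro exI[of _ 1]) auto
  show "T 0 f = f" if "f \<in> V" for f using that by (rule T_0)
  show "T (s + t) f = T s (T t f)" if "0 \<le> s" "0 \<le> t" "f \<in> V" for s t f using that by (intro T_semigroup)
  show "((\<lambda>t. N (\<lambda>x. T t f x - f x)) \<longlongrightarrow> 0) (at_right 0)" if "f \<in> V" for f
    using T_continuous[OF that] by (simp add: fun_diff_def)
qed

lemma difference_quotient: "(\<lambda>x. (u x - S t u x) / t - v x) = (1/t) *\<^sub>R (u - S t u) - v" for u v :: "'a \<Rightarrow> real"
  by (auto simp: fun_diff_def scaleR_fun_def)

lemma T_generator_eq: "generator V N T = {(u, lap u) | u. u \<in> lap_dom}"
proof -
  have "u \<in> V \<and> v \<in> V \<and> ((\<lambda>t. N ((1/t) *\<^sub>R (u - T t u) - v)) \<longlongrightarrow> 0) (at_right 0)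
    \<longleftrightarrow> u \<in> lap_dom \<and> v = lap u" (is "?L \<longleftrightarrow> ?R") for u v
  proof
    assume ?L
    then show ?R using T_generator_converse[of u v] by blast
  next
    assume R: ?R
    then have "u \<in> V" "v \<in> V" unfolding lap_dom_def by blast+
    with R show ?L using T_generator[of u] by blast
  qed
  then show ?thesis unfolding generator_def difference_quotient by auto
qed

lemma semigroup_eq_T:
  assumes C0: "C0_semigroup V N S" and gen: "generator V N S = {(u, lap u) | u. u \<in> lap_dom}"
    and "f \<in> V" "0 \<le> t"
  shows "S t f = T t f"
proof (rule semigroup_unique[of S])
  note C0 = C0[unfolded C0_semigroup_def]
  have lin: "S t (\<lambda>x. a * f x + b * g x) = (\<lambda>x. a * S t f x + b * S t g x)"
    if "0 \<le> t" "f \<in> V" "g \<in> V" for t f g a b using C0 that by blast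
  show "S t f \<in> V" if "0 \<le> t" "f \<in> V" for t f using C0 that by blast
  show "S t (f - g) = S t f - S t g" if "0 \<le> t" "f \<in> V" "g \<in> V" for t f g
    using lin[OF that, of 1 "-1"] by (simp add: fun_diff_def)
  show "S t (c *\<^sub>R f) = c *\<^sub>R S t f" if "0 \<le> t" "f \<in> V" for t f c
    using lin[OF that that(2), of c 0] by (simp add: scaleR_fun_def)
  show "\<exists>C. \<forall>f\<in>V. N (S t f) \<le> C * N f" if "0 \<le> t" for t using C0 that by blast
  show "S 0 f = f" if "f \<in> V" for f using C0 that by blast
  show "S (s + t) f = S s (S t f)" if "0 \<le> s" "0 \<le> t" "f \<in> V" for s t f using C0 that by blast
  show "((\<lambda>t. N (S t f - f)) \<longlongrightarrow> 0) (at_right 0)" if "f \<in> V" for f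
    using C0 that by (simp add: fun_diff_def)
  have gen': "(u, v) \<in> generator V N S \<longleftrightarrow> u \<in> V \<and> v \<in> V \<and> ((\<lambda>t. N ((1/t) *\<^sub>R (u - S t u) - v)) \<longlongrightarrow> 0) (at_right 0)" for u v
    unfolding generator_def difference_quotient by blast
  show "((\<lambda>t. N ((1/t) *\<^sub>R (u - S t u) - lap u)) \<longlongrightarrow> 0) (at_right 0)" if "u \<in> lap_dom" for u
    using gen gen'[of u "lap u"] that by blast
  show "u \<in> lap_dom \<and> v = lap u"
    if "u \<in> V" "v \<in> V" "((\<lambda>t. N ((1/t) *\<^sub>R (u - S t u) - v)) \<longlongrightarrow> 0) (at_right 0)" for u v
    using gen gen'[of u v] that by blast
qed fact+

section \<open>Consistency for different exponents\<close>

lemma J_tendsto_truncate: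
  assumes f: "f \<in> V" and h: "0 < h"
  shows "((\<lambda>F. J h (truncate f F) x) \<longlongrightarrow> J h f x) (finite_subsets_at_top UNIV)"
proof (rule lp_pointwise_tendsto)
  have r: "truncate f F \<in> V" for F by (rule lp_space_comparison(1)[OF f]) auto
  have JV: "J h g \<in> V" if "g \<in> V" for g using J_V[OF that, of h] h by linarith
  show "(\<lambda>x. J h (truncate f F) x - J h f x) \<in> V" for F by (intro lp_space_diff JV r f)
  show "((\<lambda>F. N (\<lambda>x. J h (truncate f F) x - J h f x)) \<longlongrightarrow> 0) (finite_subsets_at_top UNIV)"
  proof (rule Lim_null_comparison[OF always_eventually truncate_tendsto[OF f]], rule allI)
    fix F
    have "N (J h (truncate f F) - J h f) = N (J h (f - truncate f F))"
      using h by (subst J_diff[OF f r]) (auto simp only: N_commute less_imp_le)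
    also have "\<dots> \<le> N (f - truncate f F)" using h by (intro J_contraction V_closed f r) simp
    finally show "norm (N (\<lambda>x. J h (truncate f F) x - J h f x)) \<le> N (\<lambda>x. f x - truncate f F x)"
      by (simp add: fun_diff_def)
  qed
qed

lemma J_finitely_supported:
  assumes "\<And>p. 1 < p \<Longrightarrow> u \<in> lp_space m p" "(\<lambda>x. u x + h * lap u x) = f" "f \<in> finitely_supported" "0 < h"
  shows "J h f = u"
proof (rule J_eqI)
  have "u \<in> V" using assms(1) p by blast
  moreover have "(\<lambda>x. u x + h * lap u x) \<in> V" unfolding assms(2) by (rule finitely_supported_lp[OF assms(3)])
  moreover have "h \<noteq> 0" using assms(4) by simp
  ultimately show "u \<in> lap_dom" by (rule resolvent_V)
  show "u + h *\<^sub>R lap u = f" using assms(2) by (simp add: plus_fun_def scaleR_fun_def)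
qed (use assms in simp)

lemma T_pointwise: assumes "f \<in> V" "0 \<le> t" shows "(\<lambda>k. E k t f x) \<longlonglongrightarrow> T t f x"
proof (rule lp_pointwise_tendsto)
  show "(\<lambda>x. E k t f x - T t f x) \<in> V" for k
    using assms by (intro lp_space_diff E_V T_V)
  show "(\<lambda>k. N (\<lambda>x. E k t f x - T t f x)) \<longlonglongrightarrow> 0" using T_lim[OF assms] by (simp add: fun_diff_def)
qed

end

text \<open>The two norms need not be comparable, but pointwise convergence is common to both
  spaces. It transfers equality from finitely supported functions to the resolvents on the
  intersection, then from powers of resolvents to the semigroups.\<close>

lemma (in intrinsic_graph) T_consistent:
  assumes p: "1 < p" and q: "1 < q" and f: "f \<in> lp_space m p" "f \<in> lp_space m q" and t: "0 \<le> t"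
  shows "m_accretive.T (lp_space m p) (lp_norm m p) (intrinsic_graph_lp.lap_dom \<mu> m p) lap t f
    = m_accretive.T (lp_space m q) (lp_norm m q) (intrinsic_graph_lp.lap_dom \<mu> m q) lap t f"
proof -
  interpret P: intrinsic_graph_lp \<mu> m \<rho> p by standard (rule p)
  interpret Q: intrinsic_graph_lp \<mu> m \<rho> q by standard (rule q)
  have J: "P.J h g = Q.J h g" if "0 \<le> h" and g: "g \<in> lp_space m p" "g \<in> lp_space m q" for h g
  proof (cases "h = 0")
    case False
    with that have h: "0 < h" by simp
    have "P.J h (P.truncate g F) = Q.J h (P.truncate g F)" if F: "finite F" for F
    proof -
      note fs = P.truncate_finitely_supported[OF F, of g]
      obtain u where u: "\<And>p. 1 < p \<Longrightarrow> u \<in> lp_space m p" "(\<lambda>x. u x + h * lap u x) = P.truncate g F"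
        using resolvent_finitely_supported[OF h fs] by blast
      show ?thesis
        by (rule trans[OF P.J_finitely_supported[OF u fs h] Q.J_finitely_supported[OF u fs h, symmetric]])
    qed
    then have ev: "\<forall>\<^sub>F F in finite_subsets_at_top UNIV. P.J h (P.truncate g F) x = Q.J h (P.truncate g F) x" for x
      by (intro eventually_finite_subsets_at_top_weakI) (simp only:)
    show ?thesis
    proof
      fix x
      have "((\<lambda>F. Q.J h (P.truncate g F) x) \<longlongrightarrow> P.J h g x) (finite_subsets_at_top UNIV)"
        by (rule Lim_transform_eventually[OF P.J_tendsto_truncate[OF g(1) h] ev])
      then show "P.J h g x = Q.J h g x"
        using tendsto_unique[OF finite_subsets_at_top_neq_bot] Q.J_tendsto_truncate[OF g(2) h] by blast
    qed
  qed (simp only: P.J_0 Q.J_0)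
  \<comment> \<open>Membership in both spaces is part of the induction, because the resolvents are
    known to agree only on the intersection.\<close>
  have "(P.J h ^^ n) f = (Q.J h ^^ n) f \<and> (P.J h ^^ n) f \<in> lp_space m p \<and> (P.J h ^^ n) f \<in> lp_space m q"
    if "0 \<le> h" for h n
  proof (induction n)
    case 0
    then show ?case unfolding funpow.simps id_apply using f by blast
  next
    case (Suc n)
    then show ?case
      using J[OF that, of "(P.J h ^^ n) f"] P.J_V[of "(P.J h ^^ n) f" h] Q.J_V[of "(P.J h ^^ n) f" h] that
      by (simp only: funpow.simps o_apply) metis
  qed
  then have E: "P.E k t f = Q.E k t f" for k
    using t unfolding P.E_def Q.E_def by simp
  show ?thesis
  proof
    fix x show "P.T t f x = Q.T t f x"
      using LIMSEQ_unique[OF P.T_pointwise[OF f(1) t, of x]] Q.T_pointwise[OF f(2) t, of x] unfolding E by blast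
  qed
qed

context intrinsic_graph_lp
begin

text \<open>The semigroups \<open>T\<close> witness both choices. The chosen extension
  \<open>S\<close> is pinned down by its values on finitely supported functions: these are dense,
  and each \<open>S t\<close> is bounded.\<close>

lemma lp_generator_eq: "lp_generator \<mu> m p = {(u, lap u) | u. u \<in> lap_dom}"
proof -
  interpret L2: intrinsic_graph_lp \<mu> m \<rho> 2 by standard simp
  have "\<exists>S. C0_semigroup (lp_space m 2) (lp_norm m 2) S \<and> generator (lp_space m 2) (lp_norm m 2) S = form_operator \<mu> m"
    using L2.T_C0_semigroup L2.T_generator_eq form_operator_eq by blast
  then have "C0_semigroup (lp_space m 2) (lp_norm m 2) (heat_semigroup \<mu> m) \<and>
      generator (lp_space m 2) (lp_norm m 2) (heat_semigroup \<mu> m) = form_operator \<mu> m"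
    unfolding heat_semigroup_def by (rule someI_ex)
  then have heat: "heat_semigroup \<mu> m t f = L2.T t f" if "f \<in> lp_space m 2" "0 \<le> t" for f t
    using L2.semigroup_eq_T[of "heat_semigroup \<mu> m" f t] that form_operator_eq by metis
  have TT: "T t f = L2.T t f" if "f \<in> lp_space m 2" "f \<in> V" "0 \<le> t" for f t
    using that p by (intro T_consistent) auto
  have "\<exists>S. C0_semigroup V N S \<and> (\<forall>t\<ge>0. \<forall>f \<in> lp_space m 2 \<inter> V. S t f = heat_semigroup \<mu> m t f)"
    using T_C0_semigroup TT heat by (intro exI[of _ T]) auto
  then have S: "C0_semigroup V N (lp_semigroup \<mu> m p) \<and>
      (\<forall>t\<ge>0. \<forall>f \<in> lp_space m 2 \<inter> V. lp_semigroup \<mu> m p t f = heat_semigroup \<mu> m t f)"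
    unfolding lp_semigroup_def by (rule someI_ex)
  define S where "S = lp_semigroup \<mu> m p"
  have S1: "S t f = T t f" if "f \<in> finitely_supported" "0 \<le> t" for t f
  proof -
    have "f \<in> V" "f \<in> lp_space m 2"
      using finitely_supported_lp[OF that(1)] L2.finitely_supported_lp[OF that(1)] by blast+
    then show ?thesis using S that(2) heat TT unfolding S_def by (metis IntI)
  qed
  have ST: "S t f = T t f" if f: "f \<in> V" and t: "0 \<le> t" for t f
  proof -
    have SV: "S t g \<in> V" if "g \<in> V" for g using S t that unfolding C0_semigroup_def S_def by blast
    have S_diff: "S t (g - k) = S t g - S t k" if "g \<in> V" "k \<in> V" for g k
    proof -
      have "S t (\<lambda>x. 1 * g x + (-1) * k x) = (\<lambda>x. 1 * S t g x + (-1) * S t k x)"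
        using S t that unfolding C0_semigroup_def S_def by blast
      then show ?thesis by (simp add: fun_diff_def)
    qed
    have "\<exists>C. \<forall>g\<in>V. N (S t g) \<le> C * N g"
      using S t unfolding C0_semigroup_def S_def by blast
    then obtain C where C: "\<And>g. g \<in> V \<Longrightarrow> N (S t g) \<le> C * N g" by blast
    have r: "truncate f F \<in> V" for F by (rule lp_space_comparison(1)[OF f]) auto
    \<comment> \<open>\<open>C\<close> bounds \<open>S t\<close> at the fixed time \<open>t\<close>,
      and the added 1 accounts for the contraction \<open>T t\<close>.\<close>
    have "((\<lambda>F. (C + 1) * N (f - truncate f F)) \<longlongrightarrow> 0) (finite_subsets_at_top UNIV)"
      using tendsto_mult_right_zero[OF truncate_tendsto[OF f], of "C + 1"] by (simp only: fun_diff_def)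
    moreover have "\<forall>\<^sub>F F in finite_subsets_at_top UNIV. N (S t f - T t f) \<le> (C + 1) * N (f - truncate f F)"
    proof (rule eventually_finite_subsets_at_top_weakI)
      fix F :: "'a set" assume "finite F"
      then have eq: "S t (truncate f F) = T t (truncate f F)" by (intro S1 truncate_finitely_supported t)
      define g where "g = f - truncate f F"
      have g: "g \<in> V" unfolding g_def by (rule V_closed(3)[OF f r])
      have "S t f - T t f = S t g - T t g"
        unfolding g_def S_diff[OF f r] T_diff[OF f r t] eq by simp
      then have "N (S t f - T t f) = N (S t g - T t g)" by (simp only:)
      also have "\<dots> \<le> N (S t g) + N (T t g)" by (rule N_diff_le[OF SV[OF g] T_V[OF g t]])
      also have "\<dots> \<le> C * N g + N g" by (rule add_mono[OF C[OF g] T_contraction[OF g t]])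
      finally show "N (S t f - T t f) \<le> (C + 1) * N (f - truncate f F)"
        unfolding g_def[symmetric] by (simp only: distrib_right mult_1)
    qed
    ultimately have "N (S t f - T t f) \<le> 0" by (rule tendsto_lowerbound) simp
    then have "N (S t f - T t f) = 0" using N_nonneg[of "S t f - T t f"] by linarith
    then have "S t f - T t f = 0" 
      by (rule N_zeroD[OF V_closed(3)[OF SV[OF f] T_V[OF f t]]])
    then show ?thesis by simp
  qed
  \<comment> \<open>The limits are taken from the right, so agreement of \<open>S\<close> and
    \<open>T\<close> at positive times suffices.\<close>
  have "((\<lambda>t. N (\<lambda>x. (u x - S t u x) / t - v x)) \<longlongrightarrow> 0) (at_right 0) \<longleftrightarrow>
    ((\<lambda>t. N (\<lambda>x. (u x - T t u x) / t - v x)) \<longlongrightarrow> 0) (at_right 0)" if "u \<in> V" for u v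
    using ST[OF that] by (intro tendsto_cong) (auto simp: eventually_at_right_field intro!: exI[of _ 1])
  then have "generator V N S = generator V N T" unfolding generator_def by blast
  then show ?thesis unfolding lp_generator_def S_def T_generator_eq .
qed

end

theorem corollary1p4:
  fixes \<mu> :: "'a::countable \<Rightarrow> 'a \<Rightarrow> real" and m :: "'a \<Rightarrow> real" and p :: real
  assumes "weighted_graph \<mu> m"
    and "connected_graph \<mu>"
    and "\<exists>\<rho>. pseudo_metric \<rho> \<and> intrinsic \<mu> m \<rho> \<and> compatible \<mu> m \<rho>"
    and "1 < p"
  shows "lp_generator \<mu> m p \<subseteq> {(u, formal_laplacian \<mu> m u) | u. u \<in> laplacian_dom \<mu>} \<and>
    Domain (lp_generator \<mu> m p) =
      {u \<in> lp_space m p \<inter> laplacian_dom \<mu>. formal_laplacian \<mu> m u \<in> lp_space m p}"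
proof -
  obtain \<rho> where "pseudo_metric \<rho>" "intrinsic \<mu> m \<rho>" "compatible \<mu> m \<rho>" using assms(3) by blast
  then interpret intrinsic_graph_lp \<mu> m \<rho> p
    using assms by unfold_locales
  show ?thesis unfolding lp_generator_eq lap_dom_def using lp_dom by blast
qed

end
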